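(* Let $g \in M^1(\mathbb{R}^d)$ and let $\Lambda \subseteq \mathbb{R}^{2d}$ be a set. For each $n\in\mathbb{N}$ let $T_n:\mathbb{R}^{2d}\to\mathbb{R}^{2d}$ be a differentiable map with Jacobian matrix $DT_n$. Assume that $$\sup_{z\in\mathbb{R}^{2d}} |DT_n(z)-I| \longrightarrow 0 \quad\text{as } n\to\infty .$$ Then the following holds. (a) If $\mathcal{G}(g,\Lambda)$ is a frame for $L^2(\mathbb{R}^d)$, then $\mathcal{G}(g,T_n(\Lambda))$ is a frame for $L^2(\mathbb{R}^d)$ for all sufficiently large $n$. (b) If $\mathcal{G}(g,\Lambda)$ is a Riesz sequence in $L^2(\mathbb{R}^d)$, then $\mathcal{G}(g,T_n(\Lambda))$ is a Riesz sequence in $L^2(\mathbb{R}^d)$ for all sufficiently large $n$.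
   Context: For $z=(x,\xi)\in\mathbb{R}^d\times\mathbb{R}^d\simeq\mathbb{R}^{2d}$, the time-frequency shift is $\pi(z)g(t)=e^{2\pi i\xi\cdot t}g(t-x)$. The space $M^1(\mathbb{R}^d)$ (Feichtinger algebra) consists of all $g\in L^2(\mathbb{R}^d)$ with $\int_{\mathbb{R}^{2d}}|\langle g,\pi(z)g\rangle|\,dz<\infty$. For a set $\Lambda\subseteq\mathbb{R}^{2d}$, $\mathcal{G}(g,\Lambda)=\{\pi(\lambda)g:\lambda\in\Lambda\}$ is the Gabor system indexed by $\Lambda$. It is a frame for $L^2(\mathbb{R}^d)$ if there are constants $0<A\le B<\infty$ with $A\|f\|_2^2\le\sum_{\lambda\in\Lambda}|\langle f,\pi(\lambda)g\rangle|^2\le B\|f\|_2^2$ for all $f\in L^2(\mathbb{R}^d)$. It is a Riesz sequence if there are constants $0<A\le B<\infty$ with $A\|c\|_2\le\|\sum_{\lambda\in\Lambda}c_\lambda\pi(\lambda)g\|_2\le B\|c\|_2$ for all $c\in\ell^2(\Lambda)$. $T_n(\Lambda)=\{T_n(\lambda):\lambda\in\Lambda\}$, $I$ is the $2d\times 2d$ identity matrix, and $|\cdot|$ applied to matrices is any fixed matrix norm. *)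

theory Defs
  imports "HOL-Analysis.Analysis"
begin

text \<open>
  L2 of R^d is represented by square-integrable functions rather than by equivalence classes
  modulo null sets; every notion below is invariant under changes on null sets.
\<close>

definition L2 :: "(real^'d \<Rightarrow> complex) set" where
  "L2 = {f. f \<in> borel_measurable lebesgue \<and> integrable lebesgue (\<lambda>t. (cmod (f t))\<^sup>2)}"

definition L2_inner :: "(real^'d \<Rightarrow> complex) \<Rightarrow> (real^'d \<Rightarrow> complex) \<Rightarrow> complex" where
  "L2_inner f h = (LINT t|lebesgue. f t * cnj (h t))"

definition L2_norm :: "(real^'d \<Rightarrow> complex) \<Rightarrow> real" where
  "L2_norm f = sqrt (LINT t|lebesgue. (cmod (f t))\<^sup>2)"

text \<open>
  A point z = (x, xi) of R^(2d) is a vector indexed by the disjoint sum \<^typ>\<open>'d + 'd\<close>: the left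
  summand carries the coordinates of x, the right summand those of xi.
\<close>

definition time_part :: "real^('d + 'd) \<Rightarrow> real^'d" where
  "time_part z = (\<chi> i. z $ Inl i)"

definition freq_part :: "real^('d + 'd) \<Rightarrow> real^'d" where
  "freq_part z = (\<chi> i. z $ Inr i)"

definition tf_shift :: "real^('d + 'd) \<Rightarrow> (real^'d \<Rightarrow> complex) \<Rightarrow> real^'d \<Rightarrow> complex" where
  "tf_shift z g t =
     exp (2 * complex_of_real pi * \<i> * complex_of_real (freq_part z \<bullet> t)) * g (t - time_part z)"

definition M1 :: "(real^'d \<Rightarrow> complex) set" where
  "M1 = {g \<in> L2. (\<integral>\<^sup>+ z. ennreal (cmod (L2_inner g (tf_shift z g))) \<partial>lebesgue) < \<infinity>}"

definition gabor_frame :: "(real^'d \<Rightarrow> complex) \<Rightarrow> (real^('d + 'd)) set \<Rightarrow> bool" where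
  "gabor_frame g \<Lambda> \<longleftrightarrow>
     (\<exists>A B. 0 < A \<and> A \<le> B \<and>
       (\<forall>f\<in>L2. (\<lambda>z. (cmod (L2_inner f (tf_shift z g)))\<^sup>2) summable_on \<Lambda> \<and>
          A * (L2_norm f)\<^sup>2 \<le> (\<Sum>\<^sub>\<infinity>z\<in>\<Lambda>. (cmod (L2_inner f (tf_shift z g)))\<^sup>2) \<and>
          (\<Sum>\<^sub>\<infinity>z\<in>\<Lambda>. (cmod (L2_inner f (tf_shift z g)))\<^sup>2) \<le> B * (L2_norm f)\<^sup>2))"

text \<open>
  Unconditional convergence of a series in L2, as the limit of the net of finite partial sums;
  the sum \<open>F\<close> is determined up to a null set.
\<close>

definition has_L2_sum :: "('i \<Rightarrow> real^'d \<Rightarrow> complex) \<Rightarrow> (real^'d \<Rightarrow> complex) \<Rightarrow> 'i set \<Rightarrow> bool" where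
  "has_L2_sum u F I \<longleftrightarrow> F \<in> L2 \<and>
     ((\<lambda>S. L2_norm (\<lambda>t. (\<Sum>i\<in>S. u i t) - F t)) \<longlongrightarrow> 0) (finite_subsets_at_top I)"

definition gabor_riesz_sequence :: "(real^'d \<Rightarrow> complex) \<Rightarrow> (real^('d + 'd)) set \<Rightarrow> bool" where
  "gabor_riesz_sequence g \<Lambda> \<longleftrightarrow>
     (\<exists>A B. 0 < A \<and> A \<le> B \<and>
       (\<forall>c :: real^('d + 'd) \<Rightarrow> complex. (\<lambda>z. (cmod (c z))\<^sup>2) summable_on \<Lambda> \<longrightarrow>
          (\<exists>F. has_L2_sum (\<lambda>z t. c z * tf_shift z g t) F \<Lambda> \<and>
             A * sqrt (\<Sum>\<^sub>\<infinity>z\<in>\<Lambda>. (cmod (c z))\<^sup>2) \<le> L2_norm F \<and>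
             L2_norm F \<le> B * sqrt (\<Sum>\<^sub>\<infinity>z\<in>\<Lambda>. (cmod (c z))\<^sup>2))))"

text \<open>
  Any norm on the vector space of matrices; submultiplicativity is not required.
\<close>

definition matrix_norm :: "(real^'m^'n \<Rightarrow> real) \<Rightarrow> bool" where
  "matrix_norm N \<longleftrightarrow> (\<forall>A. 0 \<le> N A) \<and> (\<forall>A. N A = 0 \<longleftrightarrow> A = 0) \<and>
     (\<forall>c A. N (c *\<^sub>R A) = \<bar>c\<bar> * N A) \<and> (\<forall>A B. N (A + B) \<le> N A + N B)"

end

theory Submission
  imports Defs "HOL-Probability.Characteristic_Functions"
begin

text \<open>
  For \<open>g\<close> in \<open>M1\<close> the function \<open>|\<langle>g, \<pi>(z) g\<rangle>|\<close> is dominated, together with its local suprema, by an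
  integrable function, so cross Gram matrices over relatively separated sets pass Schur's test with
  uniformly small tails. If the coefficients of a finite combination of time-frequency shifts are
  restricted to a ball of radius \<open>R\<close> and one averages over the centre of the ball, quadratic forms
  change by an error that vanishes as \<open>R \<rightarrow> \<infinity>\<close>. Inside one such ball a map \<open>T\<close> for which \<open>T - id\<close>
  is \<open>\<epsilon>\<close>-Lipschitz is a translation up to \<open>O(\<epsilon> R)\<close>, and a translation of all nodes only
  introduces a common unitary and unimodular factors. Hence lower bounds for \<open>\<Lambda>\<close> pass to \<open>T \<Lambda>\<close> once
  \<open>R\<close> and then \<open>\<epsilon>\<close> are fixed. For frames this is applied to approximate expansions
  \<open>f \<approx> \<Sum> c\<^sub>\<lambda> \<pi>(\<lambda>) g\<close> with \<open>\<parallel>c\<parallel> \<le> C \<parallel>f\<parallel>\<close>; no inverse-closedness (Wiener) lemma is needed.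
\<close>

subsection \<open>Square-integrable functions\<close>

text \<open>The obstacle is that \<open>T z - z\<close> may grow linearly in \<open>z\<close>: a
  Lipschitz bound controls differences only, so nothing is small globally and every comparison has
  to be made relative to a centre. Averaging over all centres keeps the error proportional to the
  norm of the coefficients instead of their number. The radius has to be fixed before
  \<open>T\<close> is known. This is possible because all Schur constants depend only on
  \<open>g\<close>, a radius and a multiplicity, and a map with \<open>\<epsilon> \<le> 1/2\<close>
  preserves the multiplicity and loses a factor 4 in the radius. A general \<open>f\<close> has no
  coefficients to cut, which is why frames pass through approximate expansions: the bound
  \<open>C\<close> must not depend on the approximation error, and that error is absorbed by the
  Bessel bound for the perturbed nodes. Separation of \<open>\<Lambda>\<close> is forced by the
  Bessel bound of the given system as soon as \<open>g\<close> is nonzero. Injectivity of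
  \<open>T\<close> identifies sums over the image set with sums over
  \<open>\<Lambda>\<close>.\<close>

lemma L2_measurable [measurable_dest]: "f \<in> L2 \<Longrightarrow> f \<in> borel_measurable lebesgue"
  by (simp add: L2_def)

lemma borel_measurable_cnj [measurable]:
  "f \<in> borel_measurable M \<Longrightarrow> (\<lambda>x. cnj (f x)) \<in> borel_measurable M"
  by (rule borel_measurable_continuous_on[OF continuous_on_cnj[OF continuous_on_id]])

lemma L2_inner_integrable:
  assumes "f \<in> L2" "h \<in> L2"
  shows "integrable lebesgue (\<lambda>t. f t * cnj (h t))"
proof (rule Bochner_Integration.integrable_bound)
  show "integrable lebesgue (\<lambda>t. (cmod (f t))\<^sup>2 + (cmod (h t))\<^sup>2)"
    using assms by (simp add: L2_def)
  show "(\<lambda>t. f t * cnj (h t)) \<in> borel_measurable lebesgue"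
    using L2_measurable[OF assms(1)] L2_measurable[OF assms(2)] by measurable
  have "a * b \<le> a\<^sup>2 + b\<^sup>2" for a b :: real
  proof -
    have "2 * a * b \<le> a\<^sup>2 + b\<^sup>2" by (rule sum_squares_bound)
    moreover have "- (2 * a * b) \<le> a\<^sup>2 + b\<^sup>2"
      using sum_squares_bound[of "-a" b] by simp
    ultimately show ?thesis
      using zero_le_power2[of a] zero_le_power2[of b] by linarith
  qed
  then show "AE t in lebesgue. norm (f t * cnj (h t)) \<le> norm ((cmod (f t))\<^sup>2 + (cmod (h t))\<^sup>2)"
    by (auto simp: norm_mult)
qed

lemma L2_zero [simp]: "(\<lambda>t. 0) \<in> L2"
  by (simp add: L2_def)

lemma L2_scale: "f \<in> L2 \<Longrightarrow> (\<lambda>t. c * f t) \<in> L2"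
  by (auto simp: L2_def norm_mult power_mult_distrib)

lemma L2_uminus: "f \<in> L2 \<Longrightarrow> (\<lambda>t. - f t) \<in> L2"
  using L2_scale[of f "-1"] by simp

lemma cmod_add_square_le: "(cmod (a + b))\<^sup>2 \<le> 2 * (cmod a)\<^sup>2 + 2 * (cmod b)\<^sup>2"
proof -
  have "(cmod (a + b))\<^sup>2 \<le> (cmod a + cmod b)\<^sup>2"
    by (simp add: norm_triangle_ineq power_mono)
  also have "\<dots> \<le> 2 * (cmod a)\<^sup>2 + 2 * (cmod b)\<^sup>2"
    using sum_squares_bound[of "cmod a" "cmod b"] by (simp add: power2_sum)
  finally show ?thesis .
qed

lemma L2_add:
  assumes "f \<in> L2" "h \<in> L2"
  shows "(\<lambda>t. f t + h t) \<in> L2"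
proof -
  have [measurable]: "f \<in> borel_measurable lebesgue" "h \<in> borel_measurable lebesgue"
    using assms by (auto simp: L2_def)
  have "integrable lebesgue (\<lambda>t. (cmod (f t + h t))\<^sup>2)"
  proof (rule Bochner_Integration.integrable_bound)
    show "integrable lebesgue (\<lambda>t. 2 * (cmod (f t))\<^sup>2 + 2 * (cmod (h t))\<^sup>2)"
      using assms by (simp add: L2_def)
    show "AE t in lebesgue. norm ((cmod (f t + h t))\<^sup>2)
        \<le> norm (2 * (cmod (f t))\<^sup>2 + 2 * (cmod (h t))\<^sup>2)"
      using cmod_add_square_le by auto
  qed measurable
  then show ?thesis by (simp add: L2_def)
qed

lemma L2_diff: "f \<in> L2 \<Longrightarrow> h \<in> L2 \<Longrightarrow> (\<lambda>t. f t - h t) \<in> L2"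
  using L2_add[of f "\<lambda>t. - h t"] L2_uminus[of h] by simp

lemma L2_sum: "(\<And>i. i \<in> I \<Longrightarrow> u i \<in> L2) \<Longrightarrow> (\<lambda>t. \<Sum>i\<in>I. u i t) \<in> L2"
  by (induction I rule: infinite_finite_induct) (auto intro: L2_add)

lemma L2_lincomb: "(\<And>i. i \<in> I \<Longrightarrow> u i \<in> L2) \<Longrightarrow> (\<lambda>t. \<Sum>i\<in>I. c i * u i t) \<in> L2"
  by (intro L2_sum L2_scale)

lemma L2_inner_add_left:
  "f \<in> L2 \<Longrightarrow> f' \<in> L2 \<Longrightarrow> h \<in> L2 \<Longrightarrow>
    L2_inner (\<lambda>t. f t + f' t) h = L2_inner f h + L2_inner f' h"
  using L2_inner_integrable[of f h] L2_inner_integrable[of f' h]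
  by (simp add: L2_inner_def distrib_right)

lemma L2_inner_scale_left: "L2_inner (\<lambda>t. c * f t) h = c * L2_inner f h"
  by (simp add: L2_inner_def mult.assoc)

lemma L2_inner_cnj: "cnj (L2_inner f h) = L2_inner h f"
proof -
  have "L2_inner h f = (LINT t|lebesgue. cnj (f t * cnj (h t)))"
    unfolding L2_inner_def by (simp add: mult.commute)
  also have "\<dots> = cnj (L2_inner f h)"
    unfolding L2_inner_def by (rule Bochner_Integration.integral_cnj)
  finally show ?thesis by simp
qed

lemma cmod_L2_inner_commute: "cmod (L2_inner f h) = cmod (L2_inner h f)"
  by (metis L2_inner_cnj complex_mod_cnj)

lemma L2_inner_zero_left [simp]: "L2_inner (\<lambda>t. 0) h = 0"
  by (simp add: L2_inner_def)

lemma L2_inner_sum_left: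
  fixes c :: "'i \<Rightarrow> complex" and u :: "'i \<Rightarrow> real^'d \<Rightarrow> complex"
  shows "(\<And>i. i \<in> I \<Longrightarrow> u i \<in> L2) \<Longrightarrow> h \<in> L2 \<Longrightarrow>
    L2_inner (\<lambda>t. \<Sum>i\<in>I. c i * u i t) h = (\<Sum>i\<in>I. c i * L2_inner (u i) h)"
proof (induction I rule: infinite_finite_induct)
  case (insert i I)
  then show ?case
    by (simp add: L2_inner_add_left L2_scale L2_lincomb L2_inner_scale_left)
qed auto

lemma L2_inner_sum_right:
  fixes c :: "'i \<Rightarrow> complex" and u :: "'i \<Rightarrow> real^'d \<Rightarrow> complex"
  assumes "\<And>i. i \<in> I \<Longrightarrow> u i \<in> L2" "h \<in> L2"
  shows "L2_inner h (\<lambda>t. \<Sum>i\<in>I. c i * u i t) = (\<Sum>i\<in>I. cnj (c i) * L2_inner h (u i))"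
  using arg_cong[where f=cnj, OF L2_inner_sum_left[where c=c and I=I and u=u, OF assms]] by (simp add: L2_inner_cnj)

lemma L2_inner_uminus_left: "L2_inner (\<lambda>t. - f t) h = - L2_inner f h"
  using L2_inner_scale_left[of "-1" f h] by simp

lemma L2_inner_diff_left:
  "f \<in> L2 \<Longrightarrow> f' \<in> L2 \<Longrightarrow> h \<in> L2 \<Longrightarrow>
    L2_inner (\<lambda>t. f t - f' t) h = L2_inner f h - L2_inner f' h"
  using L2_inner_add_left[of f "\<lambda>t. - f' t" h]
  by (simp add: L2_uminus L2_inner_uminus_left)

lemma L2_inner_add_right:
  "f \<in> L2 \<Longrightarrow> f' \<in> L2 \<Longrightarrow> h \<in> L2 \<Longrightarrow>
    L2_inner h (\<lambda>t. f t + f' t) = L2_inner h f + L2_inner h f'"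
  using arg_cong[OF L2_inner_add_left[of f f' h], of cnj] by (simp add: L2_inner_cnj)

lemma L2_inner_diff_right:
  "f \<in> L2 \<Longrightarrow> f' \<in> L2 \<Longrightarrow> h \<in> L2 \<Longrightarrow>
    L2_inner h (\<lambda>t. f t - f' t) = L2_inner h f - L2_inner h f'"
  using arg_cong[OF L2_inner_diff_left[of f f' h], of cnj] by (simp add: L2_inner_cnj)

lemma L2_inner_scale_right: "L2_inner h (\<lambda>t. c * f t) = cnj c * L2_inner h f"
  using arg_cong[OF L2_inner_scale_left[of c f h], of cnj] by (simp add: L2_inner_cnj)

lemma L2_norm_nonneg [simp]: "0 \<le> L2_norm f"
  by (simp add: L2_norm_def)

lemma L2_norm_square: "(L2_norm f)\<^sup>2 = (LINT t|lebesgue. (cmod (f t))\<^sup>2)"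
  by (simp add: L2_norm_def)

lemma L2_inner_self: "L2_inner f f = complex_of_real ((L2_norm f)\<^sup>2)"
  unfolding L2_norm_square L2_inner_def
  by (simp add: complex_norm_square[symmetric] flip: of_real_power)

lemma L2_Cauchy_Schwarz:
  assumes "f \<in> L2" "h \<in> L2"
  shows "cmod (L2_inner f h) \<le> L2_norm f * L2_norm h"
proof -
  have [measurable]: "f \<in> borel_measurable lebesgue" "h \<in> borel_measurable lebesgue"
    using assms by (auto simp: L2_def)
  have sq: "(\<integral>\<^sup>+ t. (ennreal (cmod (k t)))\<^sup>2 \<partial>lebesgue) = ennreal ((L2_norm k)\<^sup>2)"
    if "k \<in> L2" for k :: "real^'a \<Rightarrow> complex"
    using that by (simp add: L2_norm_square L2_def ennreal_power nn_integral_eq_integral)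
  have "ennreal (cmod (L2_inner f h)) \<le> (\<integral>\<^sup>+ t. ennreal (cmod (f t * cnj (h t))) \<partial>lebesgue)"
    unfolding L2_inner_def by (rule integral_norm_bound_ennreal[OF L2_inner_integrable[OF assms]])
  then have "(ennreal (cmod (L2_inner f h)))\<^sup>2 \<le> (\<integral>\<^sup>+ t. ennreal (cmod (f t)) * ennreal (cmod (h t)) \<partial>lebesgue)\<^sup>2"
    by (intro power_mono) (auto simp: norm_mult ennreal_mult)
  also have "\<dots> \<le> ennreal ((L2_norm f)\<^sup>2) * ennreal ((L2_norm h)\<^sup>2)"
    using Cauchy_Schwarz_nn_integral[of "\<lambda>t. ennreal (cmod (f t))" lebesgue "\<lambda>t. ennreal (cmod (h t))"]
    by (simp add: sq assms)
  finally have "(cmod (L2_inner f h))\<^sup>2 \<le> (L2_norm f * L2_norm h)\<^sup>2"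
    by (simp add: ennreal_power power_mult_distrib flip: ennreal_mult)
  then show ?thesis
    by (rule power2_le_imp_le) simp
qed

lemma L2_norm_square_add:
  assumes "f \<in> L2" "h \<in> L2"
  shows "(L2_norm (\<lambda>t. f t + h t))\<^sup>2 = (L2_norm f)\<^sup>2 + 2 * Re (L2_inner f h) + (L2_norm h)\<^sup>2"
proof -
  have "complex_of_real ((L2_norm (\<lambda>t. f t + h t))\<^sup>2)
      = L2_inner f f + L2_inner f h + L2_inner h f + L2_inner h h"
    using assms by (simp add: L2_inner_self[symmetric] L2_inner_add_left L2_inner_add_right L2_add
        del: of_real_power)
  then have "(L2_norm (\<lambda>t. f t + h t))\<^sup>2
      = Re (L2_inner f f + L2_inner f h + L2_inner h f + L2_inner h h)"
    by (metis Re_complex_of_real)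
  moreover have "Re (L2_inner h f) = Re (L2_inner f h)"
    using L2_inner_cnj[of f h, symmetric] by simp
  ultimately show ?thesis
    by (simp add: L2_inner_self)
qed

lemma L2_norm_triangle:
  assumes "f \<in> L2" "h \<in> L2"
  shows "L2_norm (\<lambda>t. f t + h t) \<le> L2_norm f + L2_norm h"
proof (rule power2_le_imp_le)
  have "Re (L2_inner f h) \<le> L2_norm f * L2_norm h"
    using L2_Cauchy_Schwarz[OF assms] complex_Re_le_cmod order_trans by blast
  then show "(L2_norm (\<lambda>t. f t + h t))\<^sup>2 \<le> (L2_norm f + L2_norm h)\<^sup>2"
    by (simp add: L2_norm_square_add assms power2_sum)
qed simp

lemma L2_norm_scale: "L2_norm (\<lambda>t. c * f t) = cmod c * L2_norm f"
  by (simp add: L2_norm_def norm_mult power_mult_distrib real_sqrt_mult)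

lemma L2_norm_uminus: "L2_norm (\<lambda>t. - f t) = L2_norm f"
  by (simp add: L2_norm_def)

lemma L2_norm_zero [simp]: "L2_norm (\<lambda>t. 0) = 0"
  by (simp add: L2_norm_def)

lemma L2_norm_commute: "L2_norm (\<lambda>t. f t - h t) = L2_norm (\<lambda>t. h t - f t)"
  by (simp add: L2_norm_def norm_minus_commute)

lemma L2_norm_triangle_diff:
  "f \<in> L2 \<Longrightarrow> h \<in> L2 \<Longrightarrow> L2_norm (\<lambda>t. f t - h t) \<le> L2_norm f + L2_norm h"
  using L2_norm_triangle[of f "\<lambda>t. - h t"] by (simp add: L2_uminus L2_norm_uminus)

lemma L2_norm_le_diff:
  "f \<in> L2 \<Longrightarrow> h \<in> L2 \<Longrightarrow> L2_norm f \<le> L2_norm h + L2_norm (\<lambda>t. f t - h t)"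
  using L2_norm_triangle[of h "\<lambda>t. f t - h t"] by (simp add: L2_diff)

lemma L2_norm_sum_le:
  "(\<And>i. i \<in> I \<Longrightarrow> u i \<in> L2) \<Longrightarrow> L2_norm (\<lambda>t. \<Sum>i\<in>I. u i t) \<le> (\<Sum>i\<in>I. L2_norm (u i))"
proof (induction I rule: infinite_finite_induct)
  case (insert i I)
  then show ?case
    using L2_norm_triangle[of "u i" "\<lambda>t. \<Sum>i\<in>I. u i t"] L2_sum[of I u] by fastforce
qed auto

lemma L2_norm_square_lincomb:
  assumes "\<And>i. i \<in> I \<Longrightarrow> u i \<in> L2"
  shows "complex_of_real ((L2_norm (\<lambda>t. \<Sum>i\<in>I. c i * u i t))\<^sup>2)
    = (\<Sum>i\<in>I. \<Sum>j\<in>I. c i * cnj (c j) * L2_inner (u i) (u j))"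
  using assms
  by (simp add: L2_inner_self[symmetric] L2_inner_sum_left L2_inner_sum_right L2_lincomb
      sum_distrib_left mult.assoc del: of_real_power)

lemma L2_cong_AE:
  assumes "AE t in lebesgue. f t = f' t" "f' \<in> borel_measurable lebesgue"
  shows "f \<in> L2 \<Longrightarrow> f' \<in> L2"
  unfolding L2_def using assms
  by (auto intro: integrable_cong_AE_imp elim: AE_mp)

lemma L2_inner_cong_AE:
  assumes "AE t in lebesgue. f t = f' t" "AE t in lebesgue. h t = h' t"
    and "f \<in> L2" "f' \<in> L2" "h \<in> L2" "h' \<in> L2"
  shows "L2_inner f h = L2_inner f' h'"
  unfolding L2_inner_def
proof (rule integral_cong_AE)
  show "AE t in lebesgue. f t * cnj (h t) = f' t * cnj (h' t)"
    using assms(1,2) by eventually_elim simp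
qed (use assms in \<open>auto simp: L2_def intro!: borel_measurable_times\<close>)

lemma L2_norm_cong_AE:
  assumes "AE t in lebesgue. f t = f' t" "f \<in> L2" "f' \<in> L2"
  shows "L2_norm f = L2_norm f'"
  using L2_inner_cong_AE[OF assms(1) assms(1) assms(2,3,2,3)]
  by (simp add: L2_inner_self flip: of_real_power)

text \<open>Borel representatives are wanted for Fubini: a Lebesgue measurable \<open>f\<close>
  composed with \<open>t - x\<close> need not be measurable for a product of Borel sigma-algebras,
  whereas a Borel one is. Real and imaginary parts are corrected separately on null sets.\<close>

lemma L2_ex_borel:
  fixes f :: "real^'d \<Rightarrow> complex"
  assumes "f \<in> L2"
  obtains f' where "f' \<in> L2" "f' \<in> borel_measurable borel" "AE t in lebesgue. f t = f' t"
proof -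
  have m: "f \<in> borel_measurable lebesgue" using assms by (simp add: L2_def)
  obtain r where r: "r \<in> borel_measurable lborel" "AE t in lborel. Re (f t) = r t"
    using completion_ex_borel_measurable_real[of "\<lambda>t. Re (f t)" lborel] m by auto
  obtain i where i: "i \<in> borel_measurable lborel" "AE t in lborel. Im (f t) = i t"
    using completion_ex_borel_measurable_real[of "\<lambda>t. Im (f t)" lborel] m by auto
  define f' where "f' t = Complex (r t) (i t)" for t
  have f'm: "f' \<in> borel_measurable borel"
    using r(1) i(1) unfolding f'_def Complex_eq by measurable
  have "AE t in lborel. f t = f' t"
    using r(2) i(2) by eventually_elim (simp add: f'_def complex_eq_iff)
  then have ae: "AE t in lebesgue. f t = f' t"
    by (rule AE_completion)
  moreover have "f' \<in> L2"
    by (rule L2_cong_AE[OF ae _ assms]) (use f'm in \<open>auto intro: measurable_completion\<close>)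
  ultimately show ?thesis using that f'm by blast
qed

subsection \<open>Time-frequency shifts\<close>

lemma time_part_add: "time_part (z + w) = time_part z + time_part w"
  by (simp add: time_part_def vec_eq_iff)

lemma freq_part_add: "freq_part (z + w) = freq_part z + freq_part w"
  by (simp add: freq_part_def vec_eq_iff)

lemma time_part_zero [simp]: "time_part 0 = 0"
  by (simp add: time_part_def vec_eq_iff)

lemma freq_part_zero [simp]: "freq_part 0 = 0"
  by (simp add: freq_part_def vec_eq_iff)

lemma tendsto_time_part: "(u \<longlongrightarrow> z) F \<Longrightarrow> ((\<lambda>n. time_part (u n)) \<longlongrightarrow> time_part z) F"
  unfolding time_part_def by (intro vec_tendstoI) (simp add: tendsto_vec_nth)

lemma tendsto_freq_part: "(u \<longlongrightarrow> z) F \<Longrightarrow> ((\<lambda>n. freq_part (u n)) \<longlongrightarrow> freq_part z) F"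
  unfolding freq_part_def by (intro vec_tendstoI) (simp add: tendsto_vec_nth)

lemma tf_shift_cis:
  "tf_shift z f t = cis (2 * pi * (freq_part z \<bullet> t)) * f (t - time_part z)"
  by (simp add: tf_shift_def cis_conv_exp algebra_simps)

lemma cmod_tf_shift: "cmod (tf_shift z f t) = cmod (f (t - time_part z))"
  by (simp add: tf_shift_cis norm_mult)

lemma tf_shift_zero [simp]: "tf_shift 0 f = f"
  by (simp add: tf_shift_cis fun_eq_iff)

text \<open>Time-frequency shifts form a projective representation: moving the modulation of
  \<open>w\<close> past the translation of \<open>z\<close> costs a unimodular factor, which
  disappears wherever only moduli or norms matter.\<close>

lemma tf_shift_add:
  "tf_shift (z + w) f
    = (\<lambda>t. cis (2 * pi * (freq_part w \<bullet> time_part z)) * tf_shift z (tf_shift w f) t)"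
proof
  fix t
  have "cis (2 * pi * (freq_part w \<bullet> time_part z))
      * (cis (2 * pi * (freq_part z \<bullet> t)) * cis (2 * pi * (freq_part w \<bullet> (t - time_part z))))
      = cis (2 * pi * (freq_part (z + w) \<bullet> t))"
    unfolding cis_mult by (simp add: freq_part_add inner_diff_right inner_add_left algebra_simps)
  then show "tf_shift (z + w) f t
      = cis (2 * pi * (freq_part w \<bullet> time_part z)) * tf_shift z (tf_shift w f) t"
    by (simp add: tf_shift_cis time_part_add diff_diff_eq mult.assoc)
qed

lemma tf_shift_scale: "tf_shift z (\<lambda>t. c * f t) = (\<lambda>t. c * tf_shift z f t)"
  by (simp add: tf_shift_cis fun_eq_iff)

lemma tf_shift_plus: "tf_shift z (\<lambda>t. f t + h t) = (\<lambda>t. tf_shift z f t + tf_shift z h t)"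
  by (simp add: tf_shift_cis fun_eq_iff algebra_simps)

lemma tf_shift_minus: "tf_shift z (\<lambda>t. f t - h t) = (\<lambda>t. tf_shift z f t - tf_shift z h t)"
  by (simp add: tf_shift_cis fun_eq_iff algebra_simps)

lemma tf_shift_sum:
  "tf_shift z (\<lambda>t. \<Sum>i\<in>I. c i * u i t) = (\<lambda>t. \<Sum>i\<in>I. c i * tf_shift z (u i) t)"
  by (simp add: tf_shift_cis fun_eq_iff sum_distrib_left mult.left_commute)

section \<open>Translation invariance and unitarity\<close>

lemma measurable_lebesgue_translation:
  "(\<lambda>t::'a::euclidean_space. t - a) \<in> lebesgue \<rightarrow>\<^sub>M lebesgue"
  using lebesgue_affine_measurable[of "\<lambda>_::'a. 1" "-a"] by (simp add: euclidean_representation)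

lemma distr_lebesgue_translation:
  "distr lebesgue lebesgue (\<lambda>t::'a::euclidean_space. t - a) = lebesgue"
  using lebesgue_affine_euclidean[of "\<lambda>_::'a. 1" "-a"]
  by (simp add: euclidean_representation density_1)

lemma lebesgue_integral_translation:
  fixes F :: "'a::euclidean_space \<Rightarrow> 'b::{banach, second_countable_topology}"
  assumes "F \<in> borel_measurable lebesgue"
  shows "(LINT t|lebesgue. F (t - a)) = (LINT t|lebesgue. F t)"
  using integral_distr[OF measurable_lebesgue_translation[of a], of F] assms
  by (simp add: distr_lebesgue_translation)

lemma lebesgue_integrable_translation:
  fixes F :: "'a::euclidean_space \<Rightarrow> 'b::{banach, second_countable_topology}"
  assumes "integrable lebesgue F"
  shows "integrable lebesgue (\<lambda>t. F (t - a))"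
  using integrable_distr[OF measurable_lebesgue_translation[of a], of F] assms
  by (simp add: distr_lebesgue_translation)

lemma borel_measurable_tf_shift:
  assumes "f \<in> borel_measurable borel"
  shows "tf_shift z f \<in> borel_measurable borel"
  unfolding tf_shift_def[abs_def] using assms by measurable

lemma L2_tf_shift:
  assumes "f \<in> L2"
  shows "tf_shift z f \<in> L2"
proof -
  have [measurable]: "f \<in> borel_measurable lebesgue" using assms by (simp add: L2_def)
  have [measurable]: "(\<lambda>t. f (t - time_part z)) \<in> borel_measurable lebesgue"
    by (rule measurable_compose[OF measurable_lebesgue_translation]) simp
  have [measurable]: "(\<lambda>t. exp (2 * complex_of_real pi * \<i> * complex_of_real (freq_part z \<bullet> t)))
      \<in> borel_measurable (lebesgue :: (real^'a) measure)"
    by (rule measurable_completion) simp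
  have "tf_shift z f \<in> borel_measurable lebesgue"
    unfolding tf_shift_def[abs_def] by measurable
  moreover have "integrable lebesgue (\<lambda>t. (cmod (tf_shift z f t))\<^sup>2)"
    unfolding cmod_tf_shift
    by (rule lebesgue_integrable_translation) (use assms in \<open>simp add: L2_def\<close>)
  ultimately show ?thesis by (simp add: L2_def)
qed

lemma L2_inner_tf_shift:
  assumes "f \<in> L2" "h \<in> L2"
  shows "L2_inner (tf_shift z f) (tf_shift z h) = L2_inner f h"
proof -
  have "L2_inner (tf_shift z f) (tf_shift z h)
      = (LINT t|lebesgue. f (t - time_part z) * cnj (h (t - time_part z)))"
    unfolding L2_inner_def
  proof (rule Bochner_Integration.integral_cong)
    fix t
    have "cis a * x * cnj (cis a * y) = x * cnj y" for a and x y :: complex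
    proof -
      have "cis a * x * cnj (cis a * y) = (cis a * cnj (cis a)) * (x * cnj y)" by simp
      then show ?thesis by (simp add: complex_norm_square[symmetric])
    qed
    then show "tf_shift z f t * cnj (tf_shift z h t)
        = f (t - time_part z) * cnj (h (t - time_part z))"
      unfolding tf_shift_cis .
  qed simp
  also have "\<dots> = L2_inner f h"
    unfolding L2_inner_def
    by (rule lebesgue_integral_translation) (use L2_inner_integrable[OF assms] in auto)
  finally show ?thesis .
qed

lemma L2_norm_tf_shift:
  assumes "f \<in> L2"
  shows "L2_norm (tf_shift z f) = L2_norm f"
  using L2_inner_tf_shift[OF assms assms, of z] by (simp add: L2_inner_self flip: of_real_power)

text \<open>The phase of \<open>tf_shift_add\<close> vanishes under the modulus, so Gram matrices
  are, entrywise in modulus, functions of the difference of two nodes. Every Schur estimate rests on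
  this.\<close>

lemma cmod_L2_inner_tf_shift:
  assumes "f \<in> L2" "h \<in> L2"
  shows "cmod (L2_inner (tf_shift z f) (tf_shift w h)) = cmod (L2_inner f (tf_shift (w - z) h))"
proof -
  have "tf_shift w h = tf_shift (z + (w - z)) h" by simp
  then show ?thesis
    unfolding tf_shift_add
    by (simp add: L2_inner_scale_right L2_inner_tf_shift L2_tf_shift assms norm_mult)
qed

lemma L2_norm_tf_shift_diff:
  assumes "f \<in> L2"
  shows "(L2_norm (\<lambda>t. tf_shift u f t - f t))\<^sup>2
    = 2 * (L2_norm f)\<^sup>2 - 2 * Re (L2_inner (tf_shift u f) f)"
  using L2_norm_square_add[OF L2_tf_shift[OF assms] L2_uminus[OF assms], of u]
  by (simp add: L2_norm_uminus L2_norm_tf_shift assms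
      L2_inner_scale_right[of _ "-1" f, simplified])

section \<open>Strong continuity of time-frequency shifts at the origin\<close>

lemma indicator_mem_L2: "S \<in> lmeasurable \<Longrightarrow> (\<lambda>t. indicator S t :: complex) \<in> L2"
proof -
  assume S: "S \<in> lmeasurable"
  have "(cmod (indicator S t))\<^sup>2 = indicat_real S t" for t
    by (simp add: indicator_def)
  then show ?thesis
    using S by (auto simp: L2_def fmeasurable_def intro!: borel_measurable_indicator integrable_real_indicator)
qed

text \<open>Sequential continuity at the origin, the form in which dominated convergence delivers
  it; \<open>tf_shift_continuous_at_zero\<close> converts it into a radius.\<close>

definition tf_continuous :: "(real^'d \<Rightarrow> complex) \<Rightarrow> bool" where
  "tf_continuous f \<longleftrightarrow>
    (\<forall>u. u \<longlonglongrightarrow> 0 \<longrightarrow> (\<lambda>n. L2_norm (\<lambda>t. tf_shift (u n) f t - f t)) \<longlonglongrightarrow> 0)"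

lemma tf_continuous_scale: "tf_continuous f \<Longrightarrow> tf_continuous (\<lambda>t. c * f t)"
proof -
  assume f: "tf_continuous f"
  have "(\<lambda>t. tf_shift v (\<lambda>t. c * f t) t - c * f t) = (\<lambda>t. c * (tf_shift v f t - f t))" for v
    by (simp add: tf_shift_scale algebra_simps)
  then show ?thesis
    using f unfolding tf_continuous_def by (auto simp: L2_norm_scale intro!: tendsto_mult_right_zero)
qed

lemma tf_continuous_add:
  assumes "f \<in> L2" "h \<in> L2" "tf_continuous f" "tf_continuous h"
  shows "tf_continuous (\<lambda>t. f t + h t)"
  unfolding tf_continuous_def
proof (intro allI impI)
  fix u :: "nat \<Rightarrow> real^('a + 'a)"
  assume u: "u \<longlonglongrightarrow> 0"
  have *: "L2_norm (\<lambda>t. tf_shift v (\<lambda>t. f t + h t) t - (f t + h t))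
      \<le> L2_norm (\<lambda>t. tf_shift v f t - f t) + L2_norm (\<lambda>t. tf_shift v h t - h t)" for v
    using L2_norm_triangle[of "\<lambda>t. tf_shift v f t - f t" "\<lambda>t. tf_shift v h t - h t"]
    by (simp add: L2_diff L2_tf_shift assms tf_shift_plus algebra_simps)
  have "(\<lambda>n. L2_norm (\<lambda>t. tf_shift (u n) f t - f t) + L2_norm (\<lambda>t. tf_shift (u n) h t - h t)) \<longlonglongrightarrow> 0 + 0"
    using assms u by (intro tendsto_add) (auto simp: tf_continuous_def)
  then have **: "(\<lambda>n. L2_norm (\<lambda>t. tf_shift (u n) f t - f t) + L2_norm (\<lambda>t. tf_shift (u n) h t - h t)) \<longlonglongrightarrow> 0"
    by simp
  show "(\<lambda>n. L2_norm (\<lambda>t. tf_shift (u n) (\<lambda>t. f t + h t) t - (f t + h t))) \<longlonglongrightarrow> 0"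
    by (rule tendsto_sandwich[OF _ _ tendsto_const **]) (auto intro: * always_eventually)
qed

lemma tf_continuous_sum:
  "(\<And>i. i \<in> I \<Longrightarrow> u i \<in> L2) \<Longrightarrow> (\<And>i. i \<in> I \<Longrightarrow> tf_continuous (u i)) \<Longrightarrow>
    tf_continuous (\<lambda>t. \<Sum>i\<in>I. u i t)"
proof (induction I rule: infinite_finite_induct)
  case (insert i I)
  then show ?case
    using tf_continuous_add[of "u i" "\<lambda>t. \<Sum>i\<in>I. u i t"] L2_sum[of I u] by simp
qed (simp_all add: tf_continuous_def tf_shift_cis)

text \<open>A three-epsilon argument: shifts are isometries, so the error \<open>f - h\<close>
  enters twice and uniformly in the shift.\<close>

lemma tf_continuous_approx:
  assumes f: "f \<in> L2"
    and approx: "\<And>e. 0 < e \<Longrightarrow> \<exists>h\<in>L2. tf_continuous h \<and> L2_norm (\<lambda>t. f t - h t) \<le> e"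
  shows "tf_continuous f"
  unfolding tf_continuous_def
proof (intro allI impI LIMSEQ_I)
  fix u :: "nat \<Rightarrow> real^('a + 'a)" and r :: real
  assume u: "u \<longlonglongrightarrow> 0" and r: "0 < r"
  obtain h where h: "h \<in> L2" "tf_continuous h" "L2_norm (\<lambda>t. f t - h t) \<le> r / 4"
    using approx[of "r / 4"] r by auto
  have "(\<lambda>n. L2_norm (\<lambda>t. tf_shift (u n) h t - h t)) \<longlonglongrightarrow> 0"
    using h(2) u by (simp add: tf_continuous_def)
  then obtain n0 where n0: "\<And>n. n \<ge> n0 \<Longrightarrow> L2_norm (\<lambda>t. tf_shift (u n) h t - h t) < r / 4"
    using LIMSEQ_D[of _ 0 "r / 4"] r by fastforce
  have "L2_norm (\<lambda>t. tf_shift (u n) f t - f t) < r" if "n \<ge> n0" for n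
  proof -
    let ?k = "\<lambda>t. f t - h t"
    have k: "?k \<in> L2" using f h by (intro L2_diff)
    have "(\<lambda>t. tf_shift (u n) f t - f t)
        = (\<lambda>t. (tf_shift (u n) ?k t - ?k t) + (tf_shift (u n) h t - h t))"
      by (simp add: tf_shift_minus algebra_simps)
    then have "L2_norm (\<lambda>t. tf_shift (u n) f t - f t)
        \<le> L2_norm (\<lambda>t. tf_shift (u n) ?k t - ?k t) + L2_norm (\<lambda>t. tf_shift (u n) h t - h t)"
      using L2_norm_triangle[of "\<lambda>t. tf_shift (u n) ?k t - ?k t" "\<lambda>t. tf_shift (u n) h t - h t"]
      by (simp add: L2_diff L2_tf_shift f h)
    moreover have "L2_norm (\<lambda>t. tf_shift (u n) ?k t - ?k t) \<le> L2_norm ?k + L2_norm ?k"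
      using L2_norm_triangle_diff[OF L2_tf_shift[OF k] k] by (simp add: L2_norm_tf_shift k)
    ultimately show ?thesis
      using n0[OF that] h(3) r by linarith
  qed
  then show "\<exists>no. \<forall>n\<ge>no. norm (L2_norm (\<lambda>t. tf_shift (u n) f t - f t) - 0) < r"
    by auto
qed

text \<open>By \<open>L2_norm_tf_shift_diff\<close> it suffices that the inner product with the
  unshifted indicator converges. Its integrand vanishes off \<open>U\<close>, and at a point of the
  open set \<open>U\<close> the translated indicator is eventually 1, so the boundary of
  \<open>U\<close> causes no trouble.\<close>

lemma tf_continuous_indicator_open:
  fixes U :: "(real^'d) set"
  assumes U: "open U" "U \<in> lmeasurable"
  shows "tf_continuous (\<lambda>t. indicator U t)"
  unfolding tf_continuous_def
proof (intro allI impI)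
  let ?i = "\<lambda>t. indicator U t :: complex"
  fix u :: "nat \<Rightarrow> real^('d + 'd)"
  assume u: "u \<longlonglongrightarrow> 0"
  have i: "?i \<in> L2" by (rule indicator_mem_L2[OF U(2)])
  have "(\<lambda>n. L2_inner (tf_shift (u n) ?i) ?i) \<longlonglongrightarrow> L2_inner ?i ?i"
    unfolding L2_inner_def
  proof (rule integral_dominated_convergence)
    show "integrable lebesgue (\<lambda>t. indicat_real U t)"
      using U(2) by (auto simp: fmeasurable_def intro!: integrable_real_indicator)
    show "AE t in lebesgue. (\<lambda>n. tf_shift (u n) ?i t * cnj (?i t)) \<longlonglongrightarrow> ?i t * cnj (?i t)"
    proof (rule AE_I2)
      fix t
      show "(\<lambda>n. tf_shift (u n) ?i t * cnj (?i t)) \<longlonglongrightarrow> ?i t * cnj (?i t)"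
      proof (cases "t \<in> U")
        case True
        have "(\<lambda>n. t - time_part (u n)) \<longlonglongrightarrow> t - time_part 0"
          by (intro tendsto_intros tendsto_time_part u)
        then have "\<forall>\<^sub>F n in sequentially. t - time_part (u n) \<in> U"
          using True U(1) topological_tendstoD by fastforce
        then have ev: "\<forall>\<^sub>F n in sequentially. cis (2 * pi * (freq_part (u n) \<bullet> t)) = tf_shift (u n) ?i t"
          by eventually_elim (simp add: tf_shift_cis)
        have "(\<lambda>n. cis (2 * pi * (freq_part (u n) \<bullet> t))) \<longlonglongrightarrow> cis (2 * pi * (freq_part 0 \<bullet> t))"
          unfolding cis_conv_exp by (intro tendsto_intros tendsto_freq_part u)
        then have "(\<lambda>n. tf_shift (u n) ?i t) \<longlonglongrightarrow> 1"
          using Lim_transform_eventually[OF _ ev] by simp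
        then show ?thesis using True by simp
      qed simp
    qed
    show "AE t in lebesgue. norm (tf_shift (u n) ?i t * cnj (?i t)) \<le> indicat_real U t" for n
      by (rule AE_I2) (auto simp: norm_mult cmod_tf_shift indicator_def)
  qed (use L2_inner_integrable[OF i i] L2_inner_integrable[OF L2_tf_shift[OF i] i] in auto)
  then have "(\<lambda>n. Re (L2_inner (tf_shift (u n) ?i) ?i)) \<longlonglongrightarrow> Re (L2_inner ?i ?i)"
    by (rule tendsto_Re)
  then have "(\<lambda>n. (L2_norm (\<lambda>t. tf_shift (u n) ?i t - ?i t))\<^sup>2) \<longlonglongrightarrow> 2 * (L2_norm ?i)\<^sup>2 - 2 * Re (L2_inner ?i ?i)"
    unfolding L2_norm_tf_shift_diff[OF i] by (intro tendsto_diff tendsto_mult tendsto_const)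
  moreover have "2 * (L2_norm ?i)\<^sup>2 - 2 * Re (L2_inner ?i ?i) = 0"
    by (simp add: L2_inner_self)
  ultimately have "(\<lambda>n. (L2_norm (\<lambda>t. tf_shift (u n) ?i t - ?i t))\<^sup>2) \<longlonglongrightarrow> 0"
    by (simp only:)
  then show "(\<lambda>n. L2_norm (\<lambda>t. tf_shift (u n) ?i t - ?i t)) \<longlonglongrightarrow> 0"
    using tendsto_real_sqrt by fastforce
qed

lemma tf_continuous_indicator:
  assumes S: "S \<in> lmeasurable"
  shows "tf_continuous (\<lambda>t. indicator S t)"
proof (rule tf_continuous_approx[OF indicator_mem_L2[OF S]])
  fix e :: real assume e: "0 < e"
  obtain U where U: "open U" "S \<subseteq> U" "U - S \<in> lmeasurable" "emeasure lebesgue (U - S) < ennreal (e\<^sup>2)"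
    using sets_lebesgue_outer_open[of S "e\<^sup>2"] S e by (auto simp: fmeasurable_def)
  have "U = S \<union> (U - S)" using U by auto
  then have Um: "U \<in> lmeasurable" using S U(3) by (metis fmeasurable.Un)
  have "(L2_norm (\<lambda>t. indicator S t - indicator U t))\<^sup>2 = (LINT t|lebesgue. indicat_real (U - S) t)"
    unfolding L2_norm_square
    by (rule Bochner_Integration.integral_cong) (use U(2) in \<open>auto simp: indicator_def\<close>)
  also have "\<dots> = measure lebesgue (U - S)" by simp
  also have "\<dots> \<le> e\<^sup>2"
    using U(3,4) by (simp add: emeasure_eq_measure2 fmeasurableD2 ennreal_less_iff)
  finally have "L2_norm (\<lambda>t. indicator S t - indicator U t) \<le> e"
    using e power2_le_imp_le by fastforce
  then show "\<exists>h\<in>L2. tf_continuous h \<and> L2_norm (\<lambda>t. indicator S t - h t) \<le> e"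
    using tf_continuous_indicator_open[OF U(1) Um] indicator_mem_L2[OF Um] by blast
qed

text \<open>Square integrability forces every level set of a nonzero value to have finite measure,
  as in Chebyshev's inequality; the level set of 0 is left out of the sum.\<close>

lemma simple_function_tf_continuous:
  assumes s: "simple_function lebesgue s" and sq: "s \<in> L2"
  shows "tf_continuous s"
proof -
  let ?Y = "s ` UNIV - {0}"
  have fin: "finite ?Y" using s by (simp add: simple_function_def)
  have m: "s -` {y} \<in> lmeasurable" if "y \<noteq> 0" for y
  proof -
    have ss: "s -` {y} \<in> sets lebesgue"
      using simple_functionD(2)[OF s, of "{y}"] by simp
    have "integrable lebesgue (\<lambda>t. indicat_real (s -` {y}) t)"
    proof (rule Bochner_Integration.integrable_bound)
      show "integrable lebesgue (\<lambda>t. (cmod (s t))\<^sup>2 / (cmod y)\<^sup>2)"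
        using sq by (simp add: L2_def)
      show "AE t in lebesgue. norm (indicat_real (s -` {y}) t) \<le> norm ((cmod (s t))\<^sup>2 / (cmod y)\<^sup>2)"
        using that by (auto simp: indicator_def)
    qed (rule borel_measurable_indicator[OF ss])
    then show ?thesis using ss by (simp add: fmeasurable_def integrable_indicator_iff)
  qed
  have "s t = (\<Sum>y\<in>?Y. y * indicator (s -` {y}) t)" for t
  proof -
    have "(\<Sum>y\<in>?Y. y * indicator (s -` {y}) t) = (\<Sum>y\<in>?Y. if y = s t then y else 0)"
      by (intro sum.cong) (auto simp: indicator_def)
    also have "\<dots> = (if s t \<in> ?Y then s t else 0)"
      by (rule sum.delta[OF fin])
    finally show ?thesis by auto
  qed
  then have eq: "s = (\<lambda>t. \<Sum>y\<in>?Y. y * indicator (s -` {y}) t)" by (rule ext)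
  have "tf_continuous (\<lambda>t. \<Sum>y\<in>?Y. y * indicator (s -` {y}) t)"
    by (intro tf_continuous_sum tf_continuous_scale tf_continuous_indicator L2_scale indicator_mem_L2)
      (auto intro: m)
  then show ?thesis by (rule ssubst[where P=tf_continuous, OF eq])
qed

text \<open>Density of simple functions. The approximants satisfy
  \<open>cmod (F i x) \<le> 2 * cmod (f x)\<close>, so the squared error is dominated by
  \<open>9 * (cmod (f t))\<^sup>2\<close>.\<close>

lemma L2_tf_continuous:
  fixes f :: "real^'d \<Rightarrow> complex"
  assumes f: "f \<in> L2"
  shows "tf_continuous f"
proof (rule tf_continuous_approx[OF f])
  fix e :: real assume e: "0 < e"
  have [measurable]: "f \<in> borel_measurable lebesgue" using f by (simp add: L2_def)
  obtain F where F: "\<And>i. simple_function lebesgue (F i)" "\<And>x. (\<lambda>i. F i x) \<longlonglongrightarrow> f x"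
      "\<And>i x. cmod (F i x) \<le> 2 * cmod (f x)"
    using borel_measurable_implies_sequence_metric[of f lebesgue 0] by auto
  have [measurable]: "F i \<in> borel_measurable lebesgue" for i
    using F(1) by (rule borel_measurable_simple_function)
  have sq: "integrable lebesgue (\<lambda>t. (cmod (f t))\<^sup>2)" using f by (simp add: L2_def)
  have FL2: "F i \<in> L2" for i
  proof -
    have "integrable lebesgue (\<lambda>t. (cmod (F i t))\<^sup>2)"
    proof (rule Bochner_Integration.integrable_bound)
      show "integrable lebesgue (\<lambda>t. 4 * (cmod (f t))\<^sup>2)" using sq by simp
      have "(cmod (F i t))\<^sup>2 \<le> (2 * cmod (f t))\<^sup>2" for t
        using F(3) by (intro power_mono) auto
      then show "AE t in lebesgue. norm ((cmod (F i t))\<^sup>2) \<le> norm (4 * (cmod (f t))\<^sup>2)"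
        by (auto simp: power_mult_distrib)
    qed simp
    then show ?thesis by (simp add: L2_def)
  qed
  have "(\<lambda>i. LINT t|lebesgue. (cmod (f t - F i t))\<^sup>2) \<longlonglongrightarrow> (LINT t|(lebesgue::(real^'d) measure). 0)"
  proof (rule integral_dominated_convergence)
    show "integrable lebesgue (\<lambda>t. 9 * (cmod (f t))\<^sup>2)" using sq by simp
    show "AE t in lebesgue. (\<lambda>i. (cmod (f t - F i t))\<^sup>2) \<longlonglongrightarrow> 0"
    proof (rule AE_I2)
      fix t
      have "(\<lambda>i. (cmod (f t - F i t))\<^sup>2) \<longlonglongrightarrow> (cmod (f t - f t))\<^sup>2"
        by (intro tendsto_intros F)
      then show "(\<lambda>i. (cmod (f t - F i t))\<^sup>2) \<longlonglongrightarrow> 0" by simp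
    qed
    have "(cmod (f t - F i t))\<^sup>2 \<le> (3 * cmod (f t))\<^sup>2" for t i
      using F(3)[of i t] norm_triangle_ineq4[of "f t" "F i t"] by (intro power_mono) auto
    then show "AE t in lebesgue. norm ((cmod (f t - F i t))\<^sup>2) \<le> 9 * (cmod (f t))\<^sup>2" for i
      by (auto simp: power_mult_distrib)
  qed auto
  then have "(\<lambda>i. (L2_norm (\<lambda>t. f t - F i t))\<^sup>2) \<longlonglongrightarrow> 0"
    by (simp add: L2_norm_square)
  then have "(\<lambda>i. L2_norm (\<lambda>t. f t - F i t)) \<longlonglongrightarrow> 0"
    using tendsto_real_sqrt by fastforce
  then obtain i where "L2_norm (\<lambda>t. f t - F i t) < e"
    using LIMSEQ_D[of _ 0 e] e by fastforce
  then show "\<exists>h\<in>L2. tf_continuous h \<and> L2_norm (\<lambda>t. f t - h t) \<le> e"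
    using FL2 simple_function_tf_continuous[OF F(1) FL2] by (intro bexI[of _ "F i"]) auto
qed

lemma tf_shift_continuous_at_zero:
  fixes f :: "real^'d \<Rightarrow> complex"
  assumes "f \<in> L2" "0 < e"
  obtains d where "0 < d" "\<And>u. norm u < d \<Longrightarrow> L2_norm (\<lambda>t. tf_shift u f t - f t) < e"
proof -
  have "\<forall>\<^sub>F u in nhds (0::real^('d + 'd)). L2_norm (\<lambda>t. tf_shift u f t - f t) < e"
  proof (rule sequentially_imp_eventually_nhds_within[where s=UNIV, simplified])
    show "\<forall>u. u \<longlonglongrightarrow> 0 \<longrightarrow> (\<forall>\<^sub>F n in sequentially. L2_norm (\<lambda>t. tf_shift (u n) f t - f t) < e)"
      using L2_tf_continuous[OF assms(1)] assms(2) order_tendstoD(2)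
      unfolding tf_continuous_def by blast
  qed
  then show ?thesis
    using that unfolding eventually_nhds_metric by auto
qed

subsection \<open>Completeness\<close>

text \<open>The Riesz-Fischer argument: monotone convergence bounds the sum of the moduli of the
  increments in square mean, so the sequence converges almost everywhere, and Fatou's lemma carries
  the distances to the limit. The factor 2 is the sum of the geometric series.\<close>

lemma L2_Cauchy_limit:
  fixes u :: "nat \<Rightarrow> real^'d \<Rightarrow> complex"
  assumes u: "\<And>n. u n \<in> L2"
    and cauchy: "\<And>n. L2_norm (\<lambda>t. u (Suc n) t - u n t) \<le> (1/2)^n"
  obtains F where "F \<in> L2" "\<And>n. L2_norm (\<lambda>t. u n t - F t) \<le> 2 * (1/2)^n"
proof -
  have [measurable]: "u n \<in> borel_measurable lebesgue" for n using u by (simp add: L2_def)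
  define d where "d n t = cmod (u (Suc n) t - u n t)" for n t
  define S where "S N t = (\<Sum>n<N. d n t)" for N t
  have dL2: "(\<lambda>t. complex_of_real (d n t)) \<in> L2" for n
    using L2_diff[OF u u, of "Suc n" n] by (auto simp: d_def L2_def)
  have d_norm: "L2_norm (\<lambda>t. complex_of_real (d n t)) \<le> (1/2)^n" for n
    using cauchy[of n] by (simp add: L2_norm_def d_def)
  have geo: "(\<Sum>n<N. (1/2::real)^n) \<le> 2" for N
    by (induction N) (auto simp: sum_gp_strict)
  have S_norm: "L2_norm (\<lambda>t. complex_of_real (S N t)) \<le> 2" for N
  proof -
    have "L2_norm (\<lambda>t. complex_of_real (S N t)) \<le> (\<Sum>n<N. L2_norm (\<lambda>t. complex_of_real (d n t)))"
      using L2_norm_sum_le[of "{..<N}" "\<lambda>n t. complex_of_real (d n t)"] dL2 by (simp add: S_def)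
    also have "\<dots> \<le> (\<Sum>n<N. (1/2)^n)" by (intro sum_mono d_norm)
    finally show ?thesis using geo[of N] by linarith
  qed
  have SL2: "(\<lambda>t. complex_of_real (S N t)) \<in> L2" for N
    using L2_sum[of "{..<N}" "\<lambda>n t. complex_of_real (d n t)"] dL2 by (simp add: S_def)
  have [measurable]: "S N \<in> borel_measurable lebesgue" for N
    unfolding S_def[abs_def] d_def by measurable
  have S_nonneg: "0 \<le> S N t" for N t by (auto simp: S_def d_def intro: sum_nonneg)
  have S_int: "(\<integral>\<^sup>+ t. ennreal ((S N t)\<^sup>2) \<partial>lebesgue) \<le> 4" for N
  proof -
    have "(\<integral>\<^sup>+ t. ennreal ((S N t)\<^sup>2) \<partial>lebesgue) = ennreal ((L2_norm (\<lambda>t. complex_of_real (S N t)))\<^sup>2)"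
      using SL2[of N] by (simp add: L2_norm_square L2_def nn_integral_eq_integral)
    also have "\<dots> \<le> ennreal (2\<^sup>2)"
      by (intro ennreal_leI power_mono S_norm) simp
    finally show ?thesis by simp
  qed
  have inc: "incseq (\<lambda>N t. ennreal ((S N t)\<^sup>2))"
    by (intro monoI le_funI ennreal_leI power_mono S_nonneg)
      (auto simp: S_def d_def intro!: sum_mono2)
  have "(\<integral>\<^sup>+ t. (SUP N. ennreal ((S N t)\<^sup>2)) \<partial>lebesgue) = (SUP N. \<integral>\<^sup>+ t. ennreal ((S N t)\<^sup>2) \<partial>lebesgue)"
    by (rule nn_integral_monotone_convergence_SUP[OF inc]) measurable
  also have "\<dots> \<le> 4" by (intro SUP_least S_int)
  finally have "(\<integral>\<^sup>+ t. (SUP N. ennreal ((S N t)\<^sup>2)) \<partial>lebesgue) \<noteq> \<infinity>"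
    by (auto simp: top_unique)
  then have fin: "AE t in lebesgue. (SUP N. ennreal ((S N t)\<^sup>2)) \<noteq> \<infinity>"
    by (intro nn_integral_PInf_AE) measurable
  \<comment> \<open>\<open>lim\<close> is total, so \<open>F\<close> is measurable as it stands and
    equals the pointwise limit almost everywhere.\<close>
  define F where "F t = lim (\<lambda>n. u n t)" for t
  have conv: "AE t in lebesgue. (\<lambda>n. u n t) \<longlonglongrightarrow> F t"
    using fin
  proof eventually_elim
    case (elim t)
    then obtain b where b: "b \<ge> 0" "(SUP N. ennreal ((S N t)\<^sup>2)) = ennreal b"
      by (cases "SUP N. ennreal ((S N t)\<^sup>2)") auto
    have "(S N t)\<^sup>2 \<le> b" for N
      using SUP_upper[of N UNIV "\<lambda>N. ennreal ((S N t)\<^sup>2)"] b by simp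
    then have bd: "S N t \<le> sqrt b" for N by (simp add: real_le_rsqrt)
    have "(\<Sum>k\<le>n. d k t) \<le> sqrt b" for n
      using bd[of "Suc n"] by (simp only: S_def lessThan_Suc_atMost)
    then have "summable (\<lambda>n. d n t)"
      by (intro bounded_imp_summable[where B="sqrt b"]) (auto simp: d_def)
    then have "summable (\<lambda>n. u (Suc n) t - u n t)"
      unfolding d_def by (rule summable_norm_cancel)
    then have "convergent (\<lambda>N. \<Sum>n<N. u (Suc n) t - u n t)"
      by (simp add: summable_iff_convergent)
    then have "convergent (\<lambda>N. u N t - u 0 t)"
      by (simp add: sum_lessThan_telescope[of "\<lambda>n. u n t"])
    then have "convergent (\<lambda>N. u N t)"
      using convergent_add[OF _ convergent_const[of "u 0 t"]] by fastforce
    then show ?case by (simp add: F_def convergent_LIMSEQ_iff)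
  qed
  have Fm [measurable]: "F \<in> borel_measurable lebesgue"
    unfolding F_def[abs_def] by measurable
  have dist: "L2_norm (\<lambda>t. u n t - u (n + k) t) \<le> 2 * (1/2)^n" for n k
  proof -
    have "(\<lambda>t. u (n + k) t - u n t) = (\<lambda>t. \<Sum>j<k. u (Suc (n + j)) t - u (n + j) t)"
      using sum_lessThan_telescope[of "\<lambda>j. u (n + j) _" k] by simp
    then have "L2_norm (\<lambda>t. u (n + k) t - u n t) \<le> (\<Sum>j<k. L2_norm (\<lambda>t. u (Suc (n + j)) t - u (n + j) t))"
      using L2_norm_sum_le[of "{..<k}" "\<lambda>j t. u (Suc (n + j)) t - u (n + j) t"] L2_diff[OF u u]
      by simp
    also have "\<dots> \<le> (\<Sum>j<k. (1/2)^n * (1/2)^j)"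
      using cauchy by (intro sum_mono) (simp flip: power_add)
    also have "\<dots> \<le> (1/2)^n * 2"
      unfolding sum_distrib_left[symmetric] by (intro mult_left_mono geo) simp
    finally show ?thesis by (simp add: L2_norm_commute mult.commute)
  qed
  have bound: "(\<integral>\<^sup>+ t. ennreal ((cmod (u n t - F t))\<^sup>2) \<partial>lebesgue) \<le> ennreal ((2 * (1/2)^n)\<^sup>2)" for n
  proof -
    have "AE t in lebesgue. ennreal ((cmod (u n t - F t))\<^sup>2)
        = liminf (\<lambda>k. ennreal ((cmod (u n t - u (n + k) t))\<^sup>2))"
      using conv
    proof eventually_elim
      case (elim t)
      have "(\<lambda>k. u (n + k) t) \<longlonglongrightarrow> F t"
        using LIMSEQ_ignore_initial_segment[OF elim, of n] by (simp add: add.commute)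
      then have "(\<lambda>k. ennreal ((cmod (u n t - u (n + k) t))\<^sup>2)) \<longlonglongrightarrow> ennreal ((cmod (u n t - F t))\<^sup>2)"
        by (intro tendsto_intros)
      then show ?case by (rule lim_imp_Liminf[OF sequentially_bot, symmetric])
    qed
    then have "(\<integral>\<^sup>+ t. ennreal ((cmod (u n t - F t))\<^sup>2) \<partial>lebesgue)
        = (\<integral>\<^sup>+ t. liminf (\<lambda>k. ennreal ((cmod (u n t - u (n + k) t))\<^sup>2)) \<partial>lebesgue)"
      by (rule nn_integral_cong_AE)
    also have "\<dots> \<le> liminf (\<lambda>k. \<integral>\<^sup>+ t. ennreal ((cmod (u n t - u (n + k) t))\<^sup>2) \<partial>lebesgue)"
      by (rule nn_integral_liminf) measurable
    also have "\<dots> \<le> liminf (\<lambda>k::nat. ennreal ((2 * (1/2)^n)\<^sup>2))"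
    proof (intro Liminf_mono always_eventually allI)
      fix k
      have "(\<integral>\<^sup>+ t. ennreal ((cmod (u n t - u (n + k) t))\<^sup>2) \<partial>lebesgue)
          = ennreal ((L2_norm (\<lambda>t. u n t - u (n + k) t))\<^sup>2)"
        using L2_diff[OF u u, of n "n + k"] by (simp add: L2_norm_square L2_def nn_integral_eq_integral)
      also have "\<dots> \<le> ennreal ((2 * (1/2)^n)\<^sup>2)"
        by (intro ennreal_leI power_mono dist) simp
      finally show "(\<integral>\<^sup>+ t. ennreal ((cmod (u n t - u (n + k) t))\<^sup>2) \<partial>lebesgue)
          \<le> ennreal ((2 * (1/2)^n)\<^sup>2)" .
    qed
    also have "\<dots> = ennreal ((2 * (1/2)^n)\<^sup>2)" by (simp add: Liminf_const)
    finally show ?thesis .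
  qed
  have dF: "(\<lambda>t. u n t - F t) \<in> L2" for n
    unfolding L2_def mem_Collect_eq
  proof (intro conjI integrableI_bounded)
    have "(\<integral>\<^sup>+ t. ennreal (norm ((cmod (u n t - F t))\<^sup>2)) \<partial>lebesgue) \<le> ennreal ((2 * (1/2)^n)\<^sup>2)"
      using bound[of n] by simp
    then show "(\<integral>\<^sup>+ t. ennreal (norm ((cmod (u n t - F t))\<^sup>2)) \<partial>lebesgue) < \<infinity>"
      by (simp add: order_le_less_trans)
  qed measurable
  have "F \<in> L2"
    using L2_diff[OF u[of 0] dF[of 0]] by simp
  moreover have "L2_norm (\<lambda>t. u n t - F t) \<le> 2 * (1/2)^n" for n
  proof (rule power2_le_imp_le)
    have "ennreal ((L2_norm (\<lambda>t. u n t - F t))\<^sup>2) \<le> ennreal ((2 * (1/2)^n)\<^sup>2)"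
      using bound[of n] dF[of n] by (simp add: L2_norm_square L2_def nn_integral_eq_integral)
    then show "(L2_norm (\<lambda>t. u n t - F t))\<^sup>2 \<le> (2 * (1/2)^n)\<^sup>2" by simp
  qed simp
  ultimately show ?thesis using that by blast
qed

subsection \<open>Gaussians\<close>

lemma borel_measurable_cis [measurable]:
  "f \<in> borel_measurable M \<Longrightarrow> (\<lambda>x. cis (f x)) \<in> borel_measurable M"
  unfolding cis_conv_exp by measurable

text \<open>This normalisation has integral 1 and is its own Fourier transform under the characters
  \<open>cis (2 * pi * (u \<bullet> x))\<close>.\<close>

definition gaussian :: "'a::euclidean_space \<Rightarrow> real" where
  "gaussian x = exp (- pi * (norm x)\<^sup>2)"

lemma gaussian_nonneg [simp]: "0 \<le> gaussian x"
  by (simp add: gaussian_def)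

lemma gaussian_le_1: "gaussian x \<le> 1"
  by (simp add: gaussian_def)

lemma gaussian_uminus [simp]: "gaussian (- x) = gaussian x"
  by (simp add: gaussian_def)

lemma borel_measurable_gaussian [measurable]: "gaussian \<in> borel_measurable borel"
  unfolding gaussian_def[abs_def] by measurable

lemma norm_square_Basis: "(norm (x::'a::euclidean_space))\<^sup>2 = (\<Sum>b\<in>Basis. (x \<bullet> b)\<^sup>2)"
  unfolding power2_norm_eq_inner by (subst euclidean_inner) (simp add: power2_eq_square)

lemma gaussian_prod: "gaussian x = (\<Prod>b\<in>Basis. gaussian (x \<bullet> b))"
  by (simp only: gaussian_def norm_square_Basis[of x] sum_distrib_left exp_sum[OF finite_Basis]
      real_norm_def power2_abs)

text \<open>Rescaling by \<open>sqrt (2 * pi)\<close> turns the integral into the characteristic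
  function of the standard normal distribution.\<close>

lemma gaussian_fourier_real:
  fixes u :: real
  shows "integrable lborel (\<lambda>x::real. cis (2 * pi * (u * x)) * complex_of_real (gaussian x))"
    and "(\<integral>x. cis (2 * pi * (u * x)) * complex_of_real (gaussian x) \<partial>lborel) = complex_of_real (gaussian u)"
proof -
  let ?c = "sqrt (2 * pi)"
  let ?F = "\<lambda>x::real. complex_of_real (std_normal_density x) * cis (?c * u * x)"
  have c: "?c \<noteq> 0" "?c > 0" "?c * ?c = 2 * pi" by auto
  have intF: "integrable lborel ?F"
    by (rule Bochner_Integration.integrable_bound[OF integrable_std_normal_moment[of 0]])
       (auto simp: norm_mult)
  have "char std_normal_distribution (?c * u) = (\<integral>x. ?F x \<partial>lborel)"
    unfolding char_def
    by (subst integral_density) (auto simp: scaleR_conv_of_real cis_conv_exp mult.commute)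
  then have intval: "(\<integral>x. ?F x \<partial>lborel) = complex_of_real (exp (- (?c * u)\<^sup>2 / 2))"
    by (simp add: char_std_normal_distribution)
  have eq: "complex_of_real ?c * ?F (0 + ?c * x) = cis (2 * pi * (u * x)) * complex_of_real (gaussian x)" for x
  proof -
    have "?c * u * (0 + ?c * x) = (?c * ?c) * (u * x)" by (simp only: add_0 mult_ac)
    then have 1: "?c * u * (0 + ?c * x) = 2 * pi * (u * x)" by (simp only: c(3))
    have 2: "?c * std_normal_density (0 + ?c * x) = gaussian x"
      by (simp add: normal_density_def gaussian_def power_mult_distrib)
    have "complex_of_real ?c * ?F (0 + ?c * x)
        = complex_of_real (?c * std_normal_density (0 + ?c * x)) * cis (?c * u * (0 + ?c * x))"
      by (simp only: of_real_mult mult.assoc)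
    then show ?thesis unfolding 1 2 by (simp only: mult.commute)
  qed
  have "integrable lborel (\<lambda>x. complex_of_real ?c * ?F (0 + ?c * x))"
    using lborel_integrable_real_affine[OF intF c(1), of 0] by (rule integrable_mult_right)
  then show "integrable lborel (\<lambda>x::real. cis (2 * pi * (u * x)) * complex_of_real (gaussian x))"
    unfolding eq .
  have "(\<integral>x. ?F x \<partial>lborel) = ?c *\<^sub>R (\<integral>x. ?F (0 + ?c * x) \<partial>lborel)"
    using lborel_integral_real_affine[OF c(1), of ?F 0] c(2) by simp
  also have "\<dots> = (\<integral>x. complex_of_real ?c * ?F (0 + ?c * x) \<partial>lborel)"
    by (simp add: scaleR_conv_of_real)
  finally have "(\<integral>x. cis (2 * pi * (u * x)) * complex_of_real (gaussian x) \<partial>lborel)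
      = complex_of_real (exp (- (?c * u)\<^sup>2 / 2))"
    unfolding eq intval by simp
  moreover have "- (?c * u)\<^sup>2 / 2 = - pi * (norm u)\<^sup>2"
    by (simp add: power_mult_distrib)
  ultimately show "(\<integral>x. cis (2 * pi * (u * x)) * complex_of_real (gaussian x) \<partial>lborel) = complex_of_real (gaussian u)"
    by (simp only: gaussian_def)
qed

text \<open>\<open>lborel\<close> is the image of the product measure indexed by
  \<open>Basis\<close>, so a product of functions of single coordinates integrates factor by
  factor.\<close>

lemma integral_lborel_prod:
  fixes f :: "'a::euclidean_space \<Rightarrow> real \<Rightarrow> complex"
  assumes int: "\<And>b. b \<in> Basis \<Longrightarrow> integrable lborel (f b)"
  shows "(\<integral>x. (\<Prod>b\<in>Basis. f b (x \<bullet> b)) \<partial>lborel) = (\<Prod>b\<in>Basis. \<integral>x. f b x \<partial>lborel)"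
    and "integrable lborel (\<lambda>x::'a. \<Prod>b\<in>Basis. f b (x \<bullet> b))"
proof -
  interpret P: product_sigma_finite "\<lambda>_::'a. lborel :: real measure" ..
  have [measurable]: "\<And>b. b \<in> Basis \<Longrightarrow> f b \<in> borel_measurable borel" using int by auto
  have meas: "(\<lambda>f. \<Sum>b\<in>Basis. f b *\<^sub>R b) \<in> (\<Pi>\<^sub>M b\<in>(Basis::'a set). (lborel::real measure)) \<rightarrow>\<^sub>M borel"
    by measurable
  have meas2: "(\<lambda>x::'a. \<Prod>b\<in>Basis. f b (x \<bullet> b)) \<in> borel_measurable borel"
    by measurable
  have coord: "(\<Sum>b\<in>Basis. v b *\<^sub>R b) \<bullet> b' = v b'" if "b' \<in> Basis" for v and b' :: 'a
    using that by (simp add: inner_sum_left_Basis)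
  show "(\<integral>x. (\<Prod>b\<in>Basis. f b (x \<bullet> b)) \<partial>lborel) = (\<Prod>b\<in>Basis. \<integral>x. f b x \<partial>lborel)"
    unfolding lborel_eq[where 'a='a]
    by (subst integral_distr[OF meas]) (auto simp: coord meas2 int intro!: P.product_integral_prod)
  show "integrable lborel (\<lambda>x::'a. \<Prod>b\<in>Basis. f b (x \<bullet> b))"
    unfolding lborel_eq[where 'a='a]
    by (subst integrable_distr_eq[OF meas]) (auto simp: coord meas2 int intro!: P.product_integrable_prod)
qed

lemma gaussian_fourier:
  fixes u :: "'a::euclidean_space"
  shows "integrable lborel (\<lambda>x. cis (2 * pi * (u \<bullet> x)) * complex_of_real (gaussian x))"
    and "(\<integral>x. cis (2 * pi * (u \<bullet> x)) * complex_of_real (gaussian x) \<partial>lborel) = complex_of_real (gaussian u)"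
proof -
  let ?f = "\<lambda>b x. cis (2 * pi * ((u \<bullet> b) * x)) * complex_of_real (gaussian (x::real))"
  have cis_prod: "cis (sum v S) = (\<Prod>b\<in>S. cis (v b))" for v and S :: "'a set"
    by (induction S rule: infinite_finite_induct) (auto simp: cis_mult[symmetric])
  have eq: "cis (2 * pi * (u \<bullet> x)) * complex_of_real (gaussian x) = (\<Prod>b\<in>Basis. ?f b (x \<bullet> b))" for x
    by (subst euclidean_inner, subst gaussian_prod) (simp add: sum_distrib_left cis_prod prod.distrib)
  show "integrable lborel (\<lambda>x. cis (2 * pi * (u \<bullet> x)) * complex_of_real (gaussian x))"
    unfolding eq by (intro integral_lborel_prod gaussian_fourier_real)
  have "(\<integral>x. cis (2 * pi * (u \<bullet> x)) * complex_of_real (gaussian x) \<partial>lborel) = (\<Prod>b\<in>Basis. complex_of_real (gaussian (u \<bullet> b)))"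
    unfolding eq
    by (subst integral_lborel_prod) (simp_all only: gaussian_fourier_real)
  then show "(\<integral>x. cis (2 * pi * (u \<bullet> x)) * complex_of_real (gaussian x) \<partial>lborel) = complex_of_real (gaussian u)"
    by (simp add: gaussian_prod[of u])
qed

lemma gaussian_integrable: "integrable lborel (gaussian :: 'a::euclidean_space \<Rightarrow> real)"
proof -
  have "integrable lborel (\<lambda>x::'a. complex_of_real (gaussian x))"
    using gaussian_fourier(1)[of 0] by simp
  then show ?thesis by (simp only: complex_of_real_integrable_eq)
qed

lemma gaussian_integral: "(\<integral>x. gaussian (x::'a::euclidean_space) \<partial>lborel) = 1"
proof -
  have "complex_of_real (\<integral>x. gaussian (x::'a) \<partial>lborel) = 1"
    using gaussian_fourier(2)[of "0::'a"] by (simp add: gaussian_def)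
  then show ?thesis by (simp only: of_real_eq_1_iff)
qed

lemma lborel_integral_affine:
  fixes F :: "'a::euclidean_space \<Rightarrow> 'b::{banach, second_countable_topology}"
  assumes c: "c \<noteq> 0" and F[measurable]: "F \<in> borel_measurable borel"
  shows "(\<integral>x. F x \<partial>lborel) = \<bar>c\<bar> ^ DIM('a) *\<^sub>R (\<integral>x. F (t + c *\<^sub>R x) \<partial>lborel)"
  by (subst lborel_affine[OF c, of t]) (simp add: integral_density integral_distr)

lemma lborel_nn_integral_affine:
  fixes F :: "'a::euclidean_space \<Rightarrow> ennreal"
  assumes c: "c \<noteq> 0" and F[measurable]: "F \<in> borel_measurable borel"
  shows "(\<integral>\<^sup>+x. F x \<partial>lborel) = ennreal (\<bar>c\<bar> ^ DIM('a)) * (\<integral>\<^sup>+x. F (t + c *\<^sub>R x) \<partial>lborel)"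
  by (subst lborel_affine[OF c, of t])
    (simp add: nn_integral_density nn_integral_distr nn_integral_cmult)

lemma lborel_integral_reflect:
  fixes F :: "'a::euclidean_space \<Rightarrow> 'b::{banach, second_countable_topology}"
  assumes "F \<in> borel_measurable borel"
  shows "(\<integral>x. F (t - x) \<partial>lborel) = (\<integral>x. F x \<partial>lborel)"
  using lborel_integral_affine[OF _ assms, of "-1" t] by simp

lemma lborel_nn_integral_reflect:
  fixes F :: "'a::euclidean_space \<Rightarrow> ennreal"
  assumes "F \<in> borel_measurable borel"
  shows "(\<integral>\<^sup>+x. F (t - x) \<partial>lborel) = (\<integral>\<^sup>+x. F x \<partial>lborel)"
  using lborel_nn_integral_affine[OF _ assms, of "-1" t] by simp

text \<open>The family serves as a regulariser: as \<open>s\<close> tends to 0 the weight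
  \<open>gaussian (s *\<^sub>R x)\<close> tends to 1, while its transform concentrates at the origin
  with total mass 1.\<close>

lemma gaussian_fourier_scaled:
  fixes u :: "'a::euclidean_space"
  assumes s: "0 < s"
  shows "integrable lborel (\<lambda>x::'a. gaussian (s *\<^sub>R x))"
    and "(\<integral>x. cis (2 * pi * (u \<bullet> x)) * complex_of_real (gaussian (s *\<^sub>R x)) \<partial>lborel)
      = complex_of_real (gaussian (u /\<^sub>R s) / s ^ DIM('a))"
proof -
  have "(\<integral>\<^sup>+x. ennreal (gaussian (x::'a)) \<partial>lborel)
      = ennreal (\<bar>s\<bar> ^ DIM('a)) * (\<integral>\<^sup>+x. ennreal (gaussian (0 + s *\<^sub>R (x::'a))) \<partial>lborel)"
    by (rule lborel_nn_integral_affine) (use s in auto)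
  moreover have "(\<integral>\<^sup>+x. ennreal (gaussian (x::'a)) \<partial>lborel) < \<infinity>"
    using gaussian_integrable[where 'a='a] by (simp add: nn_integral_eq_integral)
  ultimately have "(\<integral>\<^sup>+x. ennreal (gaussian (s *\<^sub>R (x::'a))) \<partial>lborel) < \<infinity>"
    using s by (auto simp: ennreal_mult_less_top ennreal_mult_eq_top_iff top.not_eq_extremum[symmetric])
  then show "integrable lborel (\<lambda>x::'a. gaussian (s *\<^sub>R x))"
    by (intro integrableI_bounded) auto
  have "complex_of_real (gaussian (u /\<^sub>R s))
      = (\<integral>x. cis (2 * pi * ((u /\<^sub>R s) \<bullet> x)) * complex_of_real (gaussian x) \<partial>lborel)"
    by (rule gaussian_fourier(2)[symmetric])
  also have "\<dots> = \<bar>s\<bar> ^ DIM('a) *\<^sub>R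
      (\<integral>x. cis (2 * pi * ((u /\<^sub>R s) \<bullet> (0 + s *\<^sub>R x))) * complex_of_real (gaussian (0 + s *\<^sub>R x)) \<partial>lborel)"
    by (rule lborel_integral_affine) (use s in \<open>auto simp: cis_conv_exp\<close>)
  also have "\<dots> = s ^ DIM('a) *\<^sub>R
      (\<integral>x. cis (2 * pi * (u \<bullet> x)) * complex_of_real (gaussian (s *\<^sub>R x)) \<partial>lborel)"
    using s by (simp add: mult.assoc[symmetric])
  finally show "(\<integral>x. cis (2 * pi * (u \<bullet> x)) * complex_of_real (gaussian (s *\<^sub>R x)) \<partial>lborel)
      = complex_of_real (gaussian (u /\<^sub>R s) / s ^ DIM('a))"
    using s by (simp add: scaleR_conv_of_real field_simps)
qed

subsection \<open>The orthogonality relations as an inequality\<close>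

definition tf_join :: "real^'d \<Rightarrow> real^'d \<Rightarrow> real^('d + 'd)" where
  "tf_join x \<xi> = (\<chi> i. case i of Inl j \<Rightarrow> x $ j | Inr j \<Rightarrow> \<xi> $ j)"

lemma time_part_tf_join [simp]: "time_part (tf_join x \<xi>) = x"
  and freq_part_tf_join [simp]: "freq_part (tf_join x \<xi>) = \<xi>"
  by (simp_all add: time_part_def freq_part_def tf_join_def vec_eq_iff)

lemma borel_measurable_vec_lambda:
  fixes f :: "'a \<Rightarrow> 'n::finite \<Rightarrow> real"
  assumes "\<And>i. (\<lambda>x. f x i) \<in> borel_measurable M"
  shows "(\<lambda>x. \<chi> i. f x i) \<in> borel_measurable M"
proof (subst borel_measurable_euclidean_space, intro ballI)
  fix b :: "real^'n" assume "b \<in> Basis"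
  then obtain i where "b = axis i 1" by (auto simp: Basis_vec_def)
  then show "(\<lambda>x. (\<chi> i. f x i) \<bullet> b) \<in> borel_measurable M"
    using assms[of i] by (simp add: inner_axis)
qed

lemma measurable_vec_nth [measurable]: "(\<lambda>x::real^'n. x $ i) \<in> borel_measurable borel"
  by (intro borel_measurable_continuous_onI continuous_intros)

lemma measurable_tf_join [measurable]:
  "(\<lambda>(x :: real^'d, \<xi>). tf_join x \<xi>) \<in> borel \<Otimes>\<^sub>M borel \<rightarrow>\<^sub>M borel"
  unfolding tf_join_def split_beta
proof (rule borel_measurable_vec_lambda)
  fix i :: "'d + 'd"
  show "(\<lambda>p::(real^'d) \<times> (real^'d). case i of Inl j \<Rightarrow> fst p $ j | Inr j \<Rightarrow> snd p $ j) \<in> borel_measurable (borel \<Otimes>\<^sub>M borel)"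
  proof (cases i)
    case (Inl j)
    show ?thesis
      unfolding Inl sum.case by (rule measurable_compose[OF measurable_fst measurable_vec_nth])
  next
    case (Inr j)
    show ?thesis
      unfolding Inr sum.case by (rule measurable_compose[OF measurable_snd measurable_vec_nth])
  qed
qed

lemma measurable_time_part [measurable]: "time_part \<in> borel_measurable borel"
  unfolding time_part_def[abs_def] by (rule borel_measurable_vec_lambda) measurable

lemma measurable_freq_part [measurable]: "freq_part \<in> borel_measurable borel"
  unfolding freq_part_def[abs_def] by (rule borel_measurable_vec_lambda) measurable

lemma prod_Basis_vec: "(\<Prod>b\<in>(Basis::(real^'n) set). f b) = (\<Prod>i\<in>UNIV. f (axis i 1))"
proof -
  have eq: "Basis = range (\<lambda>i::'n. axis i (1::real))" by (auto simp: Basis_vec_def)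
  have inj: "inj (\<lambda>i::'n. axis i (1::real))" by (auto simp: inj_on_def axis_eq_axis)
  show ?thesis by (subst eq, subst prod.reindex[OF inj]) simp
qed

lemma prod_UNIV_sum: "(\<Prod>i\<in>(UNIV :: ('a::finite + 'b::finite) set). f i) = (\<Prod>j\<in>UNIV. f (Inl j)) * (\<Prod>j\<in>UNIV. f (Inr j))"
  by (subst UNIV_Plus_UNIV[symmetric], subst prod.Plus) auto

text \<open>\<open>lborel\<close> is determined by its values on boxes, and a box in phase space is
  the product of its time box and its frequency box.\<close>

lemma distr_tf_join:
  "distr (lborel \<Otimes>\<^sub>M lborel) borel (\<lambda>(x, \<xi>). tf_join x \<xi>) = (lborel :: (real^('d::finite + 'd)) measure)"
proof (rule lborel_eqI[symmetric])
  fix l u :: "real^('d + 'd)"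
  assume le: "\<And>b. b \<in> Basis \<Longrightarrow> l \<bullet> b \<le> u \<bullet> b"
  have le': "l $ i \<le> u $ i" for i
    using le[of "axis i 1"] by (simp add: inner_axis axis_in_Basis_iff)
  have vim: "(\<lambda>(x, \<xi>). tf_join x \<xi>) -` box l u \<inter> space (lborel \<Otimes>\<^sub>M lborel)
      = box (time_part l) (time_part u) \<times> box (freq_part l) (freq_part u)"
    by (auto simp: mem_box_cart tf_join_def time_part_def freq_part_def space_pair_measure
        split: sum.splits)
  have "emeasure (distr (lborel \<Otimes>\<^sub>M lborel) borel (\<lambda>(x, \<xi>). tf_join x \<xi>)) (box l u)
      = emeasure lborel (box (time_part l) (time_part u)) * emeasure lborel (box (freq_part l) (freq_part u))"
    by (subst emeasure_distr) (auto simp: vim lborel.emeasure_pair_measure_Times)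
  also have "emeasure lborel (box (time_part l) (time_part u)) = (\<Prod>i\<in>UNIV. u $ Inl i - l $ Inl i)"
    by (subst emeasure_lborel_box, force simp: Basis_vec_def inner_axis time_part_def le')
      (simp add: prod_Basis_vec inner_axis time_part_def)
  also have "emeasure lborel (box (freq_part l) (freq_part u)) = (\<Prod>i\<in>UNIV. u $ Inr i - l $ Inr i)"
    by (subst emeasure_lborel_box, force simp: Basis_vec_def inner_axis freq_part_def le')
      (simp add: prod_Basis_vec inner_axis freq_part_def)
  also have "ennreal (\<Prod>i\<in>UNIV. u $ Inl i - l $ Inl i) * ennreal (\<Prod>i\<in>UNIV. u $ Inr i - l $ Inr i)
      = ennreal (\<Prod>b\<in>Basis. (u - l) \<bullet> b)"
    by (simp add: prod_Basis_vec prod_UNIV_sum inner_axis prod_nonneg le' flip: ennreal_mult)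
  finally show "emeasure (distr (lborel \<Otimes>\<^sub>M lborel) borel (\<lambda>(x, \<xi>). tf_join x \<xi>)) (box l u)
      = ennreal (\<Prod>b\<in>Basis. (u - l) \<bullet> b)" .
qed simp

lemma nn_integral_tf_join:
  fixes F :: "real^('d::finite + 'd) \<Rightarrow> ennreal"
  assumes [measurable]: "F \<in> borel_measurable borel"
  shows "(\<integral>\<^sup>+z. F z \<partial>lborel) = (\<integral>\<^sup>+x. \<integral>\<^sup>+\<xi>. F (tf_join x \<xi>) \<partial>lborel \<partial>lborel)"
proof -
  have "(\<integral>\<^sup>+z. F z \<partial>lborel) = (\<integral>\<^sup>+p. F (case p of (x, \<xi>) \<Rightarrow> tf_join x \<xi>) \<partial>(lborel \<Otimes>\<^sub>M lborel))"
    by (subst distr_tf_join[symmetric], subst nn_integral_distr) auto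
  also have "\<dots> = (\<integral>\<^sup>+x. \<integral>\<^sup>+\<xi>. F (tf_join x \<xi>) \<partial>lborel \<partial>lborel)"
    by (subst lborel.nn_integral_fst[symmetric]) auto
  finally show ?thesis .
qed

lemma L2_inner_lborel:
  assumes [measurable]: "f \<in> borel_measurable borel" "h \<in> borel_measurable borel"
  shows "L2_inner f h = (\<integral>t. f t * cnj (h t) \<partial>lborel)"
  unfolding L2_inner_def by (intro integral_completion) measurable

lemma L2_inner_integrable_lborel:
  assumes "f \<in> L2" "h \<in> L2" and [measurable]: "f \<in> borel_measurable borel" "h \<in> borel_measurable borel"
  shows "integrable lborel (\<lambda>t. f t * cnj (h t))"
  using L2_inner_integrable[OF assms(1,2)] by (subst (asm) integrable_completion) auto

lemma nn_integral_mult_le_L2_norm: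
  assumes fh: "f \<in> L2" "h \<in> L2"
    and [measurable]: "f \<in> borel_measurable borel" "h \<in> borel_measurable borel"
  shows "(\<integral>\<^sup>+t. ennreal (cmod (f t) * cmod (h t)) \<partial>lborel) \<le> ennreal (L2_norm f * L2_norm h)"
proof -
  have abs: "(\<lambda>t. complex_of_real (cmod (k t))) \<in> L2" "L2_norm (\<lambda>t. complex_of_real (cmod (k t))) = L2_norm k"
    if "k \<in> L2" for k :: "real^'a \<Rightarrow> complex"
    using that by (auto simp: L2_def L2_norm_def)
  have "integrable lebesgue (\<lambda>t. complex_of_real (cmod (f t)) * cnj (complex_of_real (cmod (h t))))"
    using L2_inner_integrable[OF abs(1)[OF fh(1)] abs(1)[OF fh(2)]] .
  then have int: "integrable lebesgue (\<lambda>t. cmod (f t) * cmod (h t))"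
    by (simp only: complex_cnj_complex_of_real flip: of_real_mult) (simp only: complex_of_real_integrable_eq)
  have "(\<integral>\<^sup>+t. ennreal (cmod (f t) * cmod (h t)) \<partial>lborel)
      = (\<integral>\<^sup>+t. ennreal (cmod (f t) * cmod (h t)) \<partial>lebesgue)"
    by (rule nn_integral_completion[symmetric])
  also have "\<dots> = ennreal (LINT t|lebesgue. cmod (f t) * cmod (h t))"
    using int by (rule nn_integral_eq_integral) auto
  also have "(LINT t|lebesgue. cmod (f t) * cmod (h t))
      = cmod (L2_inner (\<lambda>t. complex_of_real (cmod (f t))) (\<lambda>t. complex_of_real (cmod (h t))))"
    by (simp add: L2_inner_def flip: of_real_mult)
  also have "\<dots> \<le> L2_norm f * L2_norm h"
    using L2_Cauchy_Schwarz[OF abs(1)[OF fh(1)] abs(1)[OF fh(2)]] by (simp add: abs(2) fh)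
  finally show ?thesis by (simp add: ennreal_leI)
qed

section \<open>A regularised Plancherel inequality\<close>

lemma pair_integrable_mult:
  fixes k :: "'a::euclidean_space \<Rightarrow> complex" and l :: "'b::euclidean_space \<Rightarrow> complex"
  assumes k: "integrable lborel k" and l: "integrable lborel l"
  shows "integrable (lborel \<Otimes>\<^sub>M lborel) (\<lambda>(t, y). k t * l y)"
    and "(\<integral>p. k (fst p) * l (snd p) \<partial>(lborel \<Otimes>\<^sub>M lborel)) = (\<integral>t. k t \<partial>lborel) * (\<integral>y. l y \<partial>lborel)"
proof -
  have [measurable]: "k \<in> borel_measurable borel" "l \<in> borel_measurable borel" using k l by auto
  show int: "integrable (lborel \<Otimes>\<^sub>M lborel) (\<lambda>(t, y). k t * l y)"
  proof (rule lborel_pair.Fubini_integrable)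
    show "integrable lborel (\<lambda>x. \<integral>y. norm (case (x, y) of (t, y) \<Rightarrow> k t * l y) \<partial>lborel)"
      using k by (simp add: norm_mult)
    show "AE x in lborel. integrable lborel (\<lambda>y. case (x, y) of (t, y) \<Rightarrow> k t * l y)"
      using l by simp
  qed measurable
  show "(\<integral>p. k (fst p) * l (snd p) \<partial>(lborel \<Otimes>\<^sub>M lborel)) = (\<integral>t. k t \<partial>lborel) * (\<integral>y. l y \<partial>lborel)"
    using lborel_pair.integral_fst[OF int] by (simp add: case_prod_beta')
qed

text \<open>For merely integrable \<open>k\<close> and \<open>l\<close> the product of the
  transforms need not be integrable; the Gaussian \<open>G\<close> makes the integral over both
  positions and \<open>\<xi>\<close> absolutely convergent. Integrating over \<open>\<xi>\<close>
  first gives the kernel in \<open>fst p - snd p\<close>, integrating over \<open>p\<close> first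
  gives the product of transforms, and \<open>G \<le> 1\<close> then removes the weight.\<close>

lemma fourier_product_bound:
  fixes k l :: "'a::euclidean_space \<Rightarrow> complex"
  assumes k: "integrable lborel k" and l: "integrable lborel l" and s: "0 < s"
  defines "K \<equiv> \<lambda>\<xi>. \<integral>t. k t * cis (- (2 * pi * (\<xi> \<bullet> t))) \<partial>lborel"
    and "L \<equiv> \<lambda>\<xi>. \<integral>t. l t * cis (- (2 * pi * (\<xi> \<bullet> t))) \<partial>lborel"
  shows "ennreal (cmod (\<integral>p. k (fst p) * cnj (l (snd p)) *
        complex_of_real (gaussian ((fst p - snd p) /\<^sub>R s) / s ^ DIM('a)) \<partial>(lborel \<Otimes>\<^sub>M lborel)))
    \<le> (\<integral>\<^sup>+\<xi>. ennreal (cmod (K \<xi>) * cmod (L \<xi>)) \<partial>lborel)"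
proof -
  have [measurable]: "k \<in> borel_measurable borel" "l \<in> borel_measurable borel" using k l by auto
  interpret Q: pair_sigma_finite "lborel \<Otimes>\<^sub>M lborel :: ('a \<times> 'a) measure" "lborel :: 'a measure"
    by (intro pair_sigma_finite.intro lborel_pair.sigma_finite_measure_axioms sigma_finite_pair_measure sigma_finite_lborel)
  define G where "G \<xi> = gaussian (s *\<^sub>R \<xi>)" for \<xi> :: 'a
  have G: "integrable lborel G" unfolding G_def by (rule gaussian_fourier_scaled(1)[OF s])
  have [measurable]: "G \<in> borel_measurable borel" using G by auto
  define P where "P p \<xi> = k (fst p) * cnj (l (snd p)) *
      (cis (2 * pi * ((snd p - fst p) \<bullet> \<xi>)) * complex_of_real (G \<xi>))" for p \<xi>
  have kl: "integrable (lborel \<Otimes>\<^sub>M lborel) (\<lambda>(t, y). k t * cnj (l y))"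
    using l by (intro pair_integrable_mult k) simp
  have intP: "integrable ((lborel \<Otimes>\<^sub>M lborel) \<Otimes>\<^sub>M lborel) (case_prod P)"
  proof (rule Q.Fubini_integrable)
    show "case_prod P \<in> borel_measurable ((lborel \<Otimes>\<^sub>M lborel) \<Otimes>\<^sub>M lborel)"
      unfolding P_def by measurable
    have "(\<integral>\<xi>. norm (case (p, \<xi>) of (p, \<xi>) \<Rightarrow> P p \<xi>) \<partial>lborel)
        = norm (case p of (t, y) \<Rightarrow> k t * cnj (l y)) * (\<integral>\<xi>. G \<xi> \<partial>lborel)" for p
      by (simp add: P_def norm_mult G_def case_prod_beta)
    then show "integrable (lborel \<Otimes>\<^sub>M lborel) (\<lambda>p. \<integral>\<xi>. norm (case (p, \<xi>) of (p, \<xi>) \<Rightarrow> P p \<xi>) \<partial>lborel)"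
      using kl by simp
    have "integrable lborel (\<lambda>\<xi>. P p \<xi>)" for p
      unfolding P_def
      by (rule integrable_mult_right, rule Bochner_Integration.integrable_bound[OF G]) (auto simp: norm_mult)
    then show "AE p in lborel \<Otimes>\<^sub>M lborel. integrable lborel (\<lambda>\<xi>. case (p, \<xi>) of (p, \<xi>) \<Rightarrow> P p \<xi>)"
      by simp
  qed
  have in1: "(\<integral>\<xi>. P p \<xi> \<partial>lborel) = k (fst p) * cnj (l (snd p)) *
      complex_of_real (gaussian ((fst p - snd p) /\<^sub>R s) / s ^ DIM('a))" for p
  proof -
    have "gaussian ((snd p - fst p) /\<^sub>R s) = gaussian ((fst p - snd p) /\<^sub>R s)"
      using gaussian_uminus[of "(fst p - snd p) /\<^sub>R s"] by (simp add: scaleR_diff_right)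
    then show ?thesis
      unfolding P_def G_def using gaussian_fourier_scaled(2)[OF s, of "snd p - fst p"] by simp
  qed
  have in2: "(\<integral>p. P p \<xi> \<partial>(lborel \<Otimes>\<^sub>M lborel)) = K \<xi> * cnj (L \<xi>) * complex_of_real (G \<xi>)" for \<xi>
  proof -
    let ?e = "\<lambda>t. cis (- (2 * pi * (\<xi> \<bullet> t)))"
    have i1: "integrable lborel (\<lambda>t. k t * ?e t)"
      by (rule Bochner_Integration.integrable_bound[OF k]) (auto simp: norm_mult)
    have i2: "integrable lborel (\<lambda>t. l t * ?e t)"
      by (rule Bochner_Integration.integrable_bound[OF l]) (auto simp: norm_mult)
    have ee: "cis (2 * pi * ((y - t) \<bullet> \<xi>)) = ?e t * cnj (?e y)" for t y
      by (simp add: cis_cnj cis_mult inner_diff_left inner_commute algebra_simps)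
    have "(\<integral>p. P p \<xi> \<partial>(lborel \<Otimes>\<^sub>M lborel))
        = (\<integral>p. ((k (fst p) * ?e (fst p)) * cnj (l (snd p) * ?e (snd p))) * complex_of_real (G \<xi>) \<partial>(lborel \<Otimes>\<^sub>M lborel))"
      unfolding P_def ee by (rule Bochner_Integration.integral_cong) (simp_all only: complex_cnj_mult mult_ac)
    also have "\<dots> = (\<integral>t. k t * ?e t \<partial>lborel) * (\<integral>y. cnj (l y * ?e y) \<partial>lborel) * complex_of_real (G \<xi>)"
      by (subst integral_mult_left_zero, subst pair_integrable_mult(2)[OF i1 integrable_cnj[OF i2]]) simp
    also have "(\<integral>y. cnj (l y * ?e y) \<partial>lborel) = cnj (L \<xi>)"
      unfolding L_def by (rule Bochner_Integration.integral_cnj)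
    finally show ?thesis by (simp add: K_def)
  qed
  have "(\<integral>p. k (fst p) * cnj (l (snd p)) *
        complex_of_real (gaussian ((fst p - snd p) /\<^sub>R s) / s ^ DIM('a)) \<partial>(lborel \<Otimes>\<^sub>M lborel))
      = (\<integral>\<xi>. K \<xi> * cnj (L \<xi>) * complex_of_real (G \<xi>) \<partial>lborel)"
    using Q.Fubini_integral[OF intP] by (simp only: in1 in2)
  moreover have "ennreal (cmod (\<integral>\<xi>. K \<xi> * cnj (L \<xi>) * complex_of_real (G \<xi>) \<partial>lborel))
      \<le> (\<integral>\<^sup>+\<xi>. ennreal (cmod (K \<xi>) * cmod (L \<xi>)) \<partial>lborel)"
  proof -
    have "integrable lborel (\<lambda>\<xi>. K \<xi> * cnj (L \<xi>) * complex_of_real (G \<xi>))"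
      using Q.integrable_snd[OF intP] by (simp only: in2)
    then have "ennreal (cmod (\<integral>\<xi>. K \<xi> * cnj (L \<xi>) * complex_of_real (G \<xi>) \<partial>lborel))
        \<le> (\<integral>\<^sup>+\<xi>. ennreal (cmod (K \<xi> * cnj (L \<xi>) * complex_of_real (G \<xi>))) \<partial>lborel)"
      by (rule integral_norm_bound_ennreal)
    also have "\<dots> \<le> (\<integral>\<^sup>+\<xi>. ennreal (cmod (K \<xi>) * cmod (L \<xi>)) \<partial>lborel)"
    proof (intro nn_integral_mono ennreal_leI)
      fix \<xi>
      have "cmod (K \<xi>) * cmod (L \<xi>) * G \<xi> \<le> cmod (K \<xi>) * cmod (L \<xi>) * 1"
        unfolding G_def by (intro mult_left_mono gaussian_le_1) auto
      then show "cmod (K \<xi> * cnj (L \<xi>) * complex_of_real (G \<xi>)) \<le> cmod (K \<xi>) * cmod (L \<xi>)"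
        by (simp add: norm_mult G_def)
    qed
    finally show ?thesis .
  qed
  ultimately show ?thesis by simp
qed

section \<open>The Moyal inequality\<close>

lemma tf_shift_join_zero: "tf_shift (tf_join u 0) f = (\<lambda>t. f (t - u))"
  by (simp add: tf_shift_cis fun_eq_iff)

lemma L2_translate: "f \<in> L2 \<Longrightarrow> (\<lambda>t. f (t - u)) \<in> L2"
  using L2_tf_shift[of f "tf_join u 0"] by (simp add: tf_shift_join_zero)

lemma L2_norm_translate: "f \<in> L2 \<Longrightarrow> L2_norm (\<lambda>t. f (t - u)) = L2_norm f"
  using L2_norm_tf_shift[of f "tf_join u 0"] by (simp add: tf_shift_join_zero)

lemma L2_inner_translate_tendsto:
  assumes f: "f \<in> L2" and h: "h \<in> L2" and u: "u \<longlonglongrightarrow> 0"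
  shows "(\<lambda>n. L2_inner f (\<lambda>t. h (t - u n))) \<longlonglongrightarrow> L2_inner f h"
proof -
  have "(\<lambda>n. tf_join (u n) 0) \<longlonglongrightarrow> 0"
  proof (rule vec_tendstoI)
    fix i :: "'a + 'a"
    show "(\<lambda>n. tf_join (u n) 0 $ i) \<longlonglongrightarrow> 0 $ i"
      using tendsto_vec_nth[OF u] by (cases i) (auto simp: tf_join_def)
  qed
  then have "(\<lambda>n. L2_norm (\<lambda>t. tf_shift (tf_join (u n) 0) h t - h t)) \<longlonglongrightarrow> 0"
    using L2_tf_continuous[OF h] by (simp add: tf_continuous_def)
  then have lim: "(\<lambda>n. L2_norm f * L2_norm (\<lambda>t. h (t - u n) - h t)) \<longlonglongrightarrow> 0"
    unfolding tf_shift_join_zero by (rule tendsto_mult_right_zero)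
  have "(\<lambda>n. L2_inner f (\<lambda>t. h (t - u n)) - L2_inner f h) \<longlonglongrightarrow> 0"
  proof (rule Lim_null_comparison[OF _ lim], rule always_eventually, rule allI)
    fix n
    have "L2_inner f (\<lambda>t. h (t - u n)) - L2_inner f h = L2_inner f (\<lambda>t. h (t - u n) - h t)"
      by (simp add: L2_inner_diff_right f h L2_translate)
    then show "norm (L2_inner f (\<lambda>t. h (t - u n)) - L2_inner f h)
        \<le> L2_norm f * L2_norm (\<lambda>t. h (t - u n) - h t)"
      using L2_Cauchy_Schwarz[OF f L2_diff[OF L2_translate[OF h] h]] by simp
  qed
  then show ?thesis by (simp add: LIM_zero_iff)
qed

text \<open>Moyal's identity with absolute values inside the integral. For fixed \<open>x\<close>
  the inner products are the Fourier transforms of \<open>k x\<close> and \<open>l x\<close> in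
  \<open>\<xi>\<close>; the regularised Plancherel inequality, integrated over \<open>x\<close>,
  bounds the Gaussian mean of \<open>A (s *\<^sub>R v) * B (s *\<^sub>R v)\<close> for every
  \<open>s > 0\<close>, and letting \<open>s\<close> tend to 0 leaves \<open>A 0 * B 0\<close>,
  whose modulus is the left side.\<close>

lemma Moyal_inequality_borel:
  fixes f h a b :: "real^'d \<Rightarrow> complex"
  assumes L2: "f \<in> L2" "h \<in> L2" "a \<in> L2" "b \<in> L2"
    and [measurable]: "f \<in> borel_measurable borel" "h \<in> borel_measurable borel"
      "a \<in> borel_measurable borel" "b \<in> borel_measurable borel"
  shows "ennreal (cmod (L2_inner f h) * cmod (L2_inner b a))
    \<le> (\<integral>\<^sup>+x. \<integral>\<^sup>+\<xi>. ennreal (cmod (L2_inner f (tf_shift (tf_join x \<xi>) a)) *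
          cmod (L2_inner h (tf_shift (tf_join x \<xi>) b))) \<partial>lborel \<partial>lborel)"
    (is "_ \<le> ?M")
proof -
  interpret Q: pair_sigma_finite "lborel \<Otimes>\<^sub>M lborel :: ((real^'d) \<times> (real^'d)) measure" "lborel :: (real^'d) measure"
    by (intro pair_sigma_finite.intro lborel_pair.sigma_finite_measure_axioms sigma_finite_pair_measure sigma_finite_lborel)
  define A where "A u = L2_inner f (\<lambda>t. h (t - u))" for u
  define B where "B u = L2_inner (\<lambda>t. b (t - u)) a" for u
  have A_eq: "A u = (\<integral>t. f t * cnj (h (t - u)) \<partial>lborel)" for u
    unfolding A_def by (rule L2_inner_lborel) measurable
  have B_eq: "B u = (\<integral>t. b (t - u) * cnj (a t) \<partial>lborel)" for u
    unfolding B_def by (rule L2_inner_lborel) measurable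
  have [measurable]: "A \<in> borel_measurable borel" "B \<in> borel_measurable borel"
    unfolding A_eq[abs_def] B_eq[abs_def] by measurable
  have A_le: "cmod (A u) \<le> L2_norm f * L2_norm h" for u
    using L2_Cauchy_Schwarz[OF L2(1) L2_translate[OF L2(2), of u]]
    by (simp add: A_def L2_norm_translate L2)
  have B_le: "cmod (B u) \<le> L2_norm b * L2_norm a" for u
    using L2_Cauchy_Schwarz[OF L2_translate[OF L2(4), of u] L2(3)]
    by (simp add: B_def L2_norm_translate L2)
  define k where "k x t = f t * cnj (a (t - x))" for x t
  define l where "l x t = h t * cnj (b (t - x))" for x t
  have k: "integrable lborel (k x)" for x
    unfolding k_def by (rule L2_inner_integrable_lborel) (auto intro: L2 L2_translate)
  have l: "integrable lborel (l x)" for x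
    unfolding l_def by (rule L2_inner_integrable_lborel) (auto intro: L2 L2_translate)

  have step: "ennreal (cmod (\<integral>v. complex_of_real (gaussian v) * (A (s *\<^sub>R v) * B (s *\<^sub>R v)) \<partial>lborel)) \<le> ?M"
    if s: "0 < s" for s
  proof -
    \<comment> \<open>An approximate identity of width \<open>s\<close>; it is the kernel produced
      by \<open>fourier_product_bound\<close>.\<close>
    define W where "W u = gaussian (u /\<^sub>R s) / s ^ CARD('d)" for u :: "real^'d"
    have [measurable]: "W \<in> borel_measurable borel" unfolding W_def by measurable
    have W_nonneg: "0 \<le> W u" for u using s by (simp add: W_def)
    have W_subst: "(\<integral>y. F y * complex_of_real (W (t - y)) \<partial>lborel)
        = (\<integral>v. F (t - s *\<^sub>R v) * complex_of_real (gaussian v) \<partial>lborel)"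
      if [measurable]: "F \<in> borel_measurable borel" for F and t :: "real^'d"
    proof -
      have W_s: "s ^ CARD('d) * W (t - (t + (- s) *\<^sub>R v)) = gaussian v" for v
        using s by (simp add: W_def)
      have "(\<integral>y. F y * complex_of_real (W (t - y)) \<partial>lborel)
          = \<bar>- s\<bar> ^ DIM(real^'d) *\<^sub>R (\<integral>v. F (t + (- s) *\<^sub>R v) * complex_of_real (W (t - (t + (- s) *\<^sub>R v))) \<partial>lborel)"
        by (rule lborel_integral_affine) (use s in auto)
      also have "\<dots> = (\<integral>v. s ^ CARD('d) *\<^sub>R (F (t + (- s) *\<^sub>R v) * complex_of_real (W (t - (t + (- s) *\<^sub>R v)))) \<partial>lborel)"
        using s by simp
      also have "\<dots> = (\<integral>v. F (t - s *\<^sub>R v) * complex_of_real (gaussian v) \<partial>lborel)"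
      proof (rule Bochner_Integration.integral_cong)
        fix v
        have "s ^ CARD('d) *\<^sub>R (F (t + (- s) *\<^sub>R v) * complex_of_real (W (t - (t + (- s) *\<^sub>R v))))
            = F (t + (- s) *\<^sub>R v) * complex_of_real (s ^ CARD('d) * W (t - (t + (- s) *\<^sub>R v)))"
          by (simp add: scaleR_conv_of_real)
        then show "s ^ CARD('d) *\<^sub>R (F (t + (- s) *\<^sub>R v) * complex_of_real (W (t - (t + (- s) *\<^sub>R v))))
            = F (t - s *\<^sub>R v) * complex_of_real (gaussian v)"
          unfolding W_s by simp
      qed simp
      finally show ?thesis .
    qed
    have W_nn_subst: "(\<integral>\<^sup>+y. F y * ennreal (W (t - y)) \<partial>lborel)
        = (\<integral>\<^sup>+v. F (t - s *\<^sub>R v) * ennreal (gaussian v) \<partial>lborel)"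
      if [measurable]: "F \<in> borel_measurable borel" for F :: "real^'d \<Rightarrow> ennreal" and t :: "real^'d"
    proof -
      have "ennreal (s ^ CARD('d)) * ennreal (gaussian v / s ^ CARD('d)) = ennreal (gaussian v)" for v :: "real^'d"
        using s by (simp flip: ennreal_mult)
      then have "ennreal (s ^ CARD('d)) * (F (t - s *\<^sub>R v) * ennreal (gaussian v / s ^ CARD('d)))
          = F (t - s *\<^sub>R v) * ennreal (gaussian v)" for v
        by (metis mult.left_commute)
      then show ?thesis
        using s by (subst lborel_nn_integral_affine[of "- s" _ t])
          (auto simp: W_def simp flip: nn_integral_cmult)
    qed
    define P where "P p x = k x (fst p) * cnj (l x (snd p)) * complex_of_real (W (fst p - snd p))" for p x
    have P_meas [measurable]: "case_prod P \<in> borel_measurable ((lborel \<Otimes>\<^sub>M lborel) \<Otimes>\<^sub>M lborel)"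
      unfolding P_def k_def l_def by measurable
    \<comment> \<open>Cauchy-Schwarz in \<open>x\<close> alone: the integral of the modulus of
      \<open>a\<close> against a translate of that of \<open>b\<close> is at most the product of the
      norms, uniformly in \<open>p\<close>.\<close>
    have P_x: "(\<integral>\<^sup>+x. ennreal (cmod (P p x)) \<partial>lborel)
        \<le> ennreal (cmod (f (fst p)) * cmod (h (snd p))) * ennreal (W (fst p - snd p)) * ennreal (L2_norm a * L2_norm b)" for p
    proof -
      obtain t y where p: "p = (t, y)" by (cases p)
      have "(\<integral>\<^sup>+x. ennreal (cmod (P p x)) \<partial>lborel)
          = (\<integral>\<^sup>+x. ennreal (cmod (f t) * cmod (h y)) * ennreal (W (t - y)) * ennreal (cmod (a (t - x)) * cmod (b (y - x))) \<partial>lborel)"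
        using W_nonneg by (intro nn_integral_cong) (simp add: p P_def k_def l_def norm_mult mult_ac flip: ennreal_mult)
      also have "\<dots> = ennreal (cmod (f t) * cmod (h y)) * ennreal (W (t - y)) * (\<integral>\<^sup>+x. ennreal (cmod (a (t - x)) * cmod (b (y - x))) \<partial>lborel)"
        by (rule nn_integral_cmult) measurable
      also have "(\<integral>\<^sup>+x. ennreal (cmod (a (t - x)) * cmod (b (y - x))) \<partial>lborel)
          = (\<integral>\<^sup>+x. ennreal (cmod (a x) * cmod (b (x - (t - y)))) \<partial>lborel)"
        using lborel_nn_integral_reflect[of "\<lambda>x. ennreal (cmod (a x) * cmod (b (x - (t - y))))" t]
        by (simp add: algebra_simps)
      also have "\<dots> \<le> ennreal (L2_norm a * L2_norm b)"
        using nn_integral_mult_le_L2_norm[of a "\<lambda>x. b (x - (t - y))"] L2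
        by (simp add: L2_translate L2_norm_translate)
      finally show ?thesis by (simp add: p mult_left_mono)
    qed
    have fhW: "(\<integral>\<^sup>+p. ennreal (cmod (f (fst p)) * cmod (h (snd p))) * ennreal (W (fst p - snd p)) \<partial>(lborel \<Otimes>\<^sub>M lborel))
        \<le> ennreal (L2_norm f * L2_norm h)"
    proof -
      have "(\<integral>\<^sup>+p. ennreal (cmod (f (fst p)) * cmod (h (snd p))) * ennreal (W (fst p - snd p)) \<partial>(lborel \<Otimes>\<^sub>M lborel))
          = (\<integral>\<^sup>+t. \<integral>\<^sup>+y. ennreal (cmod (f t) * cmod (h y)) * ennreal (W (t - y)) \<partial>lborel \<partial>lborel)"
        by (subst lborel.nn_integral_fst[symmetric]) auto
      also have "\<dots> = (\<integral>\<^sup>+t. \<integral>\<^sup>+v. ennreal (cmod (f t) * cmod (h (t - s *\<^sub>R v))) * ennreal (gaussian v) \<partial>lborel \<partial>lborel)"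
        by (subst W_nn_subst) auto
      also have "\<dots> = (\<integral>\<^sup>+v. \<integral>\<^sup>+t. ennreal (cmod (f t) * cmod (h (t - s *\<^sub>R v))) * ennreal (gaussian v) \<partial>lborel \<partial>lborel)"
        by (rule lborel_pair.Fubini') measurable
      also have "\<dots> = (\<integral>\<^sup>+v. (\<integral>\<^sup>+t. ennreal (cmod (f t) * cmod (h (t - s *\<^sub>R v))) \<partial>lborel) * ennreal (gaussian v) \<partial>lborel)"
        by (subst nn_integral_multc) auto
      also have "\<dots> \<le> (\<integral>\<^sup>+v. ennreal (L2_norm f * L2_norm h) * ennreal (gaussian (v :: real^'d)) \<partial>lborel)"
        using nn_integral_mult_le_L2_norm[of f "\<lambda>t. h (t - s *\<^sub>R _)"] L2
        by (intro nn_integral_mono mult_right_mono) (auto simp: L2_translate L2_norm_translate)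
      also have "\<dots> = ennreal (L2_norm f * L2_norm h) * ennreal (\<integral>v. gaussian (v::real^'d) \<partial>lborel)"
        by (subst nn_integral_cmult) (auto intro!: arg_cong2[where f="(*)"] nn_integral_eq_integral gaussian_integrable)
      finally show ?thesis by (simp add: gaussian_integral)
    qed
    have fhW_fin: "(\<integral>\<^sup>+p. ennreal (cmod (f (fst p)) * cmod (h (snd p))) * ennreal (W (fst p - snd p)) \<partial>(lborel \<Otimes>\<^sub>M lborel)) < \<infinity>"
      using fhW by (rule order_le_less_trans) simp
    have intP: "integrable ((lborel \<Otimes>\<^sub>M lborel) \<Otimes>\<^sub>M lborel) (case_prod P)"
    proof (rule integrableI_bounded)
      have "(\<integral>\<^sup>+q. ennreal (norm (case_prod P q)) \<partial>((lborel \<Otimes>\<^sub>M lborel) \<Otimes>\<^sub>M lborel))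
          = (\<integral>\<^sup>+p. \<integral>\<^sup>+x. ennreal (cmod (P p x)) \<partial>lborel \<partial>(lborel \<Otimes>\<^sub>M lborel))"
        by (subst lborel.nn_integral_fst[symmetric]) auto
      also have "\<dots> \<le> (\<integral>\<^sup>+p. ennreal (cmod (f (fst p)) * cmod (h (snd p))) * ennreal (W (fst p - snd p)) * ennreal (L2_norm a * L2_norm b) \<partial>(lborel \<Otimes>\<^sub>M lborel))"
        by (intro nn_integral_mono P_x)
      also have "\<dots> = (\<integral>\<^sup>+p. ennreal (cmod (f (fst p)) * cmod (h (snd p))) * ennreal (W (fst p - snd p)) \<partial>(lborel \<Otimes>\<^sub>M lborel)) * ennreal (L2_norm a * L2_norm b)"
        by (rule nn_integral_multc) measurable
      also have "\<dots> < \<infinity>" using fhW_fin by (simp add: ennreal_mult_less_top)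
      finally show "(\<integral>\<^sup>+q. ennreal (norm (case_prod P q)) \<partial>((lborel \<Otimes>\<^sub>M lborel) \<Otimes>\<^sub>M lborel)) < \<infinity>" .
    qed measurable
    define F2 where "F2 t y = f t * cnj (h y) * B (t - y) * complex_of_real (W (t - y))" for t y
    have [measurable]: "case_prod F2 \<in> borel_measurable (lborel \<Otimes>\<^sub>M lborel)"
      unfolding F2_def by measurable
    have in1: "(\<integral>x. P p x \<partial>lborel) = case_prod F2 p" for p
    proof -
      obtain t y where p: "p = (t, y)" by (cases p)
      have "(\<integral>x. P p x \<partial>lborel)
          = (\<integral>x. (f t * cnj (h y) * complex_of_real (W (t - y))) * (b (y - x) * cnj (a (t - x))) \<partial>lborel)"
        by (rule Bochner_Integration.integral_cong) (simp_all add: p P_def k_def l_def mult_ac)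
      also have "\<dots> = (f t * cnj (h y) * complex_of_real (W (t - y))) * (\<integral>x. b (y - x) * cnj (a (t - x)) \<partial>lborel)"
        by (rule integral_mult_right_zero)
      also have "(\<integral>x. b (y - x) * cnj (a (t - x)) \<partial>lborel) = B (t - y)"
        unfolding B_eq using lborel_integral_reflect[of "\<lambda>x. b (x - (t - y)) * cnj (a x)" t]
        by (simp add: algebra_simps)
      finally show ?thesis by (simp add: p F2_def mult_ac)
    qed
    have int2: "integrable (lborel \<Otimes>\<^sub>M lborel) (case_prod F2)"
      using Q.integrable_fst[OF intP] by (simp only: in1)
    define F3 where "F3 t v = f t * cnj (h (t - s *\<^sub>R v)) * B (s *\<^sub>R v) * complex_of_real (gaussian v)" for t v
    have [measurable]: "case_prod F3 \<in> borel_measurable (lborel \<Otimes>\<^sub>M lborel)"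
      unfolding F3_def by measurable
    have F2_F3: "(\<integral>y. F2 t y \<partial>lborel) = (\<integral>v. F3 t v \<partial>lborel)" for t
      unfolding F2_def F3_def by (subst W_subst) auto
    \<comment> \<open>The substitution acts in the inner variable only, so joint integrability of
      \<open>F3\<close> is obtained by repeating it on the iterated integrals of the norms.\<close>
    have int3: "integrable (lborel \<Otimes>\<^sub>M lborel) (case_prod F3)"
    proof (rule integrableI_bounded)
      have "(\<integral>\<^sup>+q. ennreal (norm (case_prod F3 q)) \<partial>(lborel \<Otimes>\<^sub>M lborel))
          = (\<integral>\<^sup>+t. \<integral>\<^sup>+v. ennreal (cmod (F3 t v)) \<partial>lborel \<partial>lborel)"
        by (subst lborel.nn_integral_fst[symmetric]) auto
      also have "\<dots> = (\<integral>\<^sup>+t. \<integral>\<^sup>+v. ennreal (cmod (f t) * cmod (h (t - s *\<^sub>R v)) * cmod (B (s *\<^sub>R v))) * ennreal (gaussian v) \<partial>lborel \<partial>lborel)"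
        by (simp add: F3_def norm_mult ennreal_mult)
      also have "\<dots> = (\<integral>\<^sup>+t. \<integral>\<^sup>+y. ennreal (cmod (f t) * cmod (h y) * cmod (B (t - y))) * ennreal (W (t - y)) \<partial>lborel \<partial>lborel)"
        by (subst W_nn_subst) auto
      also have "\<dots> = (\<integral>\<^sup>+q. ennreal (norm (case_prod F2 q)) \<partial>(lborel \<Otimes>\<^sub>M lborel))"
        using W_nonneg by (subst lborel.nn_integral_fst[symmetric]) (auto simp: F2_def norm_mult ennreal_mult)
      also have "\<dots> < \<infinity>" using int2 by (simp add: integrable_iff_bounded)
      finally show "(\<integral>\<^sup>+q. ennreal (norm (case_prod F3 q)) \<partial>(lborel \<Otimes>\<^sub>M lborel)) < \<infinity>" .
    qed measurable
    have "(\<integral>x. (\<integral>p. P p x \<partial>(lborel \<Otimes>\<^sub>M lborel)) \<partial>lborel) = (\<integral>p. case_prod F2 p \<partial>(lborel \<Otimes>\<^sub>M lborel))"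
      using Q.Fubini_integral[OF intP] by (simp only: in1)
    also have "\<dots> = (\<integral>t. \<integral>y. F2 t y \<partial>lborel \<partial>lborel)"
      by (rule lborel_pair.integral_fst[OF int2, symmetric])
    also have "\<dots> = (\<integral>t. \<integral>v. F3 t v \<partial>lborel \<partial>lborel)" by (simp only: F2_F3)
    also have "\<dots> = (\<integral>v. \<integral>t. F3 t v \<partial>lborel \<partial>lborel)"
      by (rule lborel_pair.Fubini_integral[OF int3, symmetric])
    also have "\<dots> = (\<integral>v. complex_of_real (gaussian v) * (A (s *\<^sub>R v) * B (s *\<^sub>R v)) \<partial>lborel)"
    proof (rule Bochner_Integration.integral_cong)
      fix v
      have "(\<integral>t. F3 t v \<partial>lborel) = (\<integral>t. f t * cnj (h (t - s *\<^sub>R v)) \<partial>lborel) * (B (s *\<^sub>R v) * complex_of_real (gaussian v))"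
        unfolding F3_def mult.assoc[of "_ * _"] by (rule integral_mult_left_zero)
      then show "(\<integral>t. F3 t v \<partial>lborel) = complex_of_real (gaussian v) * (A (s *\<^sub>R v) * B (s *\<^sub>R v))"
        by (simp add: A_eq mult_ac)
    qed simp
    finally have eq: "(\<integral>v. complex_of_real (gaussian v) * (A (s *\<^sub>R v) * B (s *\<^sub>R v)) \<partial>lborel)
        = (\<integral>x. (\<integral>p. P p x \<partial>(lborel \<Otimes>\<^sub>M lborel)) \<partial>lborel)" by simp
    have "ennreal (cmod (\<integral>x. (\<integral>p. P p x \<partial>(lborel \<Otimes>\<^sub>M lborel)) \<partial>lborel))
        \<le> (\<integral>\<^sup>+x. ennreal (cmod (\<integral>p. P p x \<partial>(lborel \<Otimes>\<^sub>M lborel))) \<partial>lborel)"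
      by (rule integral_norm_bound_ennreal[OF Q.integrable_snd[OF intP]])
    also have "\<dots> \<le> ?M"
    proof (rule nn_integral_mono)
      fix x
      have V: "L2_inner q (tf_shift (tf_join x \<xi>) w) = (\<integral>t. (q t * cnj (w (t - x))) * cis (- (2 * pi * (\<xi> \<bullet> t))) \<partial>lborel)"
        if [measurable]: "q \<in> borel_measurable borel" "w \<in> borel_measurable borel" for q w and \<xi> :: "real^'d"
        by (subst L2_inner_lborel) (auto simp: borel_measurable_tf_shift tf_shift_cis cis_cnj mult_ac)
      show "ennreal (cmod (\<integral>p. P p x \<partial>(lborel \<Otimes>\<^sub>M lborel)))
          \<le> (\<integral>\<^sup>+\<xi>. ennreal (cmod (L2_inner f (tf_shift (tf_join x \<xi>) a)) *
              cmod (L2_inner h (tf_shift (tf_join x \<xi>) b))) \<partial>lborel)"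
        using fourier_product_bound[OF k[of x] l[of x] s] by (simp add: P_def W_def V k_def l_def)
    qed
    finally show ?thesis unfolding eq .
  qed

  define s where "s n = inverse (real (Suc n))" for n
  have s_pos: "0 < s n" for n by (simp add: s_def)
  have s_lim: "s \<longlonglongrightarrow> 0" unfolding s_def by (rule LIMSEQ_inverse_real_of_nat)
  \<comment> \<open>Translation is continuous in \<open>L2\<close>, so \<open>A\<close> and
    \<open>B\<close> converge along \<open>s n *\<^sub>R v\<close> to their values at 0. Both are
    bounded by products of norms, which leaves a multiple of the Gaussian as integrable
    majorant.\<close>
  have "(\<lambda>n. \<integral>v. complex_of_real (gaussian v) * (A (s n *\<^sub>R v) * B (s n *\<^sub>R v)) \<partial>lborel)
      \<longlonglongrightarrow> (\<integral>v. complex_of_real (gaussian (v::real^'d)) * (L2_inner f h * L2_inner b a) \<partial>lborel)"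
  proof (rule integral_dominated_convergence)
    show "integrable lborel (\<lambda>v::real^'d. gaussian v * ((L2_norm f * L2_norm h) * (L2_norm b * L2_norm a)))"
      by (intro integrable_mult_left gaussian_integrable)
    show "AE v in lborel. (\<lambda>n. complex_of_real (gaussian v) * (A (s n *\<^sub>R v) * B (s n *\<^sub>R v)))
        \<longlonglongrightarrow> complex_of_real (gaussian v) * (L2_inner f h * L2_inner b a)"
    proof (rule AE_I2)
      fix v :: "real^'d"
      have lim: "(\<lambda>n. s n *\<^sub>R v) \<longlonglongrightarrow> 0"
        using tendsto_scaleR[OF s_lim tendsto_const[of v]] by simp
      have "(\<lambda>n. A (s n *\<^sub>R v)) \<longlonglongrightarrow> L2_inner f h"
        unfolding A_def by (rule L2_inner_translate_tendsto[OF L2(1,2) lim])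
      moreover have "(\<lambda>n. cnj (L2_inner a (\<lambda>t. b (t - s n *\<^sub>R v)))) \<longlonglongrightarrow> cnj (L2_inner a b)"
        by (intro tendsto_cnj L2_inner_translate_tendsto[OF L2(3,4) lim])
      then have "(\<lambda>n. B (s n *\<^sub>R v)) \<longlonglongrightarrow> L2_inner b a"
        unfolding B_def L2_inner_cnj .
      ultimately show "(\<lambda>n. complex_of_real (gaussian v) * (A (s n *\<^sub>R v) * B (s n *\<^sub>R v)))
        \<longlonglongrightarrow> complex_of_real (gaussian v) * (L2_inner f h * L2_inner b a)"
        by (intro tendsto_intros)
    qed
    show "AE v in lborel. norm (complex_of_real (gaussian v) * (A (s n *\<^sub>R v) * B (s n *\<^sub>R v)))
        \<le> gaussian v * ((L2_norm f * L2_norm h) * (L2_norm b * L2_norm a))" for n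
      by (rule AE_I2) (auto simp: norm_mult intro!: mult_left_mono mult_mono A_le B_le)
  qed measurable
  also have "(\<integral>v. complex_of_real (gaussian (v::real^'d)) * (L2_inner f h * L2_inner b a) \<partial>lborel)
      = L2_inner f h * L2_inner b a"
    using gaussian_integral[where 'a="real^'d"] by simp
  finally have "(\<lambda>n. ennreal (cmod (\<integral>v. complex_of_real (gaussian v) * (A (s n *\<^sub>R v) * B (s n *\<^sub>R v)) \<partial>lborel)))
      \<longlonglongrightarrow> ennreal (cmod (L2_inner f h * L2_inner b a))"
    by (intro tendsto_intros)
  then have "ennreal (cmod (L2_inner f h * L2_inner b a)) \<le> ?M"
    by (rule LIMSEQ_le_const2) (use step s_pos in blast)
  then show ?thesis by (simp add: norm_mult)
qed

section \<open>From Borel representatives to all of \<open>L2\<close>\<close>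

lemma L2_inner_right_zero:
  assumes "f \<in> L2" "h \<in> L2" "h' \<in> L2" "L2_norm (\<lambda>t. h t - h' t) = 0"
  shows "L2_inner f (tf_shift z h) = L2_inner f (tf_shift z h')"
proof -
  have "L2_inner f (tf_shift z h) - L2_inner f (tf_shift z h') = L2_inner f (tf_shift z (\<lambda>t. h t - h' t))"
    using assms by (simp add: tf_shift_minus L2_inner_diff_right L2_tf_shift)
  also have "cmod \<dots> \<le> L2_norm f * L2_norm (tf_shift z (\<lambda>t. h t - h' t))"
    using assms by (intro L2_Cauchy_Schwarz L2_tf_shift L2_diff)
  finally show ?thesis
    using assms by (simp add: L2_norm_tf_shift L2_diff)
qed

text \<open>A single representative is right for every shift \<open>z\<close> simultaneously,
  because shifts preserve the vanishing norm of the difference.\<close>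

lemma L2_ex_borel_inner:
  fixes f :: "real^'d \<Rightarrow> complex"
  assumes f: "f \<in> L2"
  obtains f' where "f' \<in> L2" "f' \<in> borel_measurable borel"
    "\<And>h. h \<in> L2 \<Longrightarrow> L2_inner h f = L2_inner h f'" "\<And>h. h \<in> L2 \<Longrightarrow> L2_inner f h = L2_inner f' h"
    "\<And>h z. h \<in> L2 \<Longrightarrow> L2_inner h (tf_shift z f) = L2_inner h (tf_shift z f')"
proof -
  obtain f' where f': "f' \<in> L2" "f' \<in> borel_measurable borel" "AE t in lebesgue. f t = f' t"
    using L2_ex_borel[OF f] by blast
  have "L2_norm (\<lambda>t. f t - f' t) = L2_norm (\<lambda>t::real^'d. 0)"
    by (rule L2_norm_cong_AE) (use f' in \<open>auto intro!: L2_diff f\<close>)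
  then have z: "L2_norm (\<lambda>t. f t - f' t) = 0" by simp
  have r: "L2_inner h (tf_shift z f) = L2_inner h (tf_shift z f')" if "h \<in> L2" for h z
    using L2_inner_right_zero[OF that f f'(1) z] .
  have r0: "L2_inner h f = L2_inner h f'" if "h \<in> L2" for h
    using r[OF that, of 0] by simp
  then have "L2_inner f h = L2_inner f' h" if "h \<in> L2" for h
    using that by (metis L2_inner_cnj)
  then show ?thesis using that f' r r0 by blast
qed

lemma borel_measurable_L2_inner_tf_shift:
  fixes f a :: "real^'d \<Rightarrow> complex"
  assumes f: "f \<in> L2" and a: "a \<in> L2"
  shows "(\<lambda>z. L2_inner f (tf_shift z a)) \<in> borel_measurable borel"
proof -
  obtain f' where f': "f' \<in> L2" "f' \<in> borel_measurable borel" "\<And>h. h \<in> L2 \<Longrightarrow> L2_inner f h = L2_inner f' h"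
    using L2_ex_borel_inner[OF f] by metis
  obtain a' where a': "a' \<in> L2" "a' \<in> borel_measurable borel"
      "\<And>h z. h \<in> L2 \<Longrightarrow> L2_inner h (tf_shift z a) = L2_inner h (tf_shift z a')"
    using L2_ex_borel_inner[OF a] by metis
  note [measurable] = f'(2) a'(2)
  have "L2_inner f (tf_shift z a)
      = (\<integral>t. f' t * cnj (cis (2 * pi * (freq_part z \<bullet> t)) * a' (t - time_part z)) \<partial>lborel)" for z
    using f' a' L2_inner_lborel[OF f'(2) borel_measurable_tf_shift[OF a'(2)], of z]
    by (simp add: L2_tf_shift a tf_shift_cis)
  then show ?thesis by simp
qed

lemma Moyal_inequality:
  fixes f h a b :: "real^'d \<Rightarrow> complex"
  assumes L2: "f \<in> L2" "h \<in> L2" "a \<in> L2" "b \<in> L2"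
  shows "ennreal (cmod (L2_inner f h) * cmod (L2_inner b a))
    \<le> (\<integral>\<^sup>+z. ennreal (cmod (L2_inner f (tf_shift z a))) * ennreal (cmod (L2_inner h (tf_shift z b))) \<partial>lborel)"
proof -
  have rep: "\<exists>f'\<in>L2. f' \<in> borel_measurable borel \<and> (\<forall>k\<in>L2. L2_inner k f = L2_inner k f' \<and>
      L2_inner f k = L2_inner f' k \<and> (\<forall>z. L2_inner k (tf_shift z f) = L2_inner k (tf_shift z f')))"
    if "f \<in> L2" for f :: "real^'d \<Rightarrow> complex"
    using L2_ex_borel_inner[OF that] by metis
  have meas: "(\<lambda>z. ennreal (cmod (L2_inner q (tf_shift z w)))) \<in> borel_measurable borel"
    if "q \<in> L2" "w \<in> L2" for q w :: "real^'d \<Rightarrow> complex"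
  proof -
    note [measurable] = borel_measurable_L2_inner_tf_shift[OF that]
    show ?thesis by measurable
  qed
  obtain f' where f': "f' \<in> L2" "f' \<in> borel_measurable borel" "\<And>k. k \<in> L2 \<Longrightarrow> L2_inner f k = L2_inner f' k"
    using rep[OF L2(1)] by blast
  obtain h' where h': "h' \<in> L2" "h' \<in> borel_measurable borel" "\<And>k. k \<in> L2 \<Longrightarrow> L2_inner k h = L2_inner k h'"
      "\<And>k. k \<in> L2 \<Longrightarrow> L2_inner h k = L2_inner h' k"
    using rep[OF L2(2)] by blast
  obtain a' where a': "a' \<in> L2" "a' \<in> borel_measurable borel" "\<And>k. k \<in> L2 \<Longrightarrow> L2_inner k a = L2_inner k a'"
      "\<And>k z. k \<in> L2 \<Longrightarrow> L2_inner k (tf_shift z a) = L2_inner k (tf_shift z a')"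
    using rep[OF L2(3)] by blast
  obtain b' where b': "b' \<in> L2" "b' \<in> borel_measurable borel" "\<And>k. k \<in> L2 \<Longrightarrow> L2_inner b k = L2_inner b' k"
      "\<And>k z. k \<in> L2 \<Longrightarrow> L2_inner k (tf_shift z b) = L2_inner k (tf_shift z b')"
    using rep[OF L2(4)] by blast
  have ef: "L2_inner f' (tf_shift z a') = L2_inner f (tf_shift z a)" for z
    using f'(3)[OF L2_tf_shift[OF L2(3)]] a'(4)[OF f'(1)] by metis
  have eh: "L2_inner h' (tf_shift z b') = L2_inner h (tf_shift z b)" for z
    using h'(4)[OF L2_tf_shift[OF L2(4)]] b'(4)[OF h'(1)] by metis
  have "ennreal (cmod (L2_inner f h) * cmod (L2_inner b a)) = ennreal (cmod (L2_inner f' h') * cmod (L2_inner b' a'))"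
    using f' h' a' b' L2 by simp
  also have "\<dots> \<le> (\<integral>\<^sup>+x. \<integral>\<^sup>+\<xi>. ennreal (cmod (L2_inner f' (tf_shift (tf_join x \<xi>) a')) *
          cmod (L2_inner h' (tf_shift (tf_join x \<xi>) b'))) \<partial>lborel \<partial>lborel)"
    by (rule Moyal_inequality_borel) (use f' h' a' b' in auto)
  also have "\<dots> = (\<integral>\<^sup>+x. \<integral>\<^sup>+\<xi>. ennreal (cmod (L2_inner f (tf_shift (tf_join x \<xi>) a))) *
          ennreal (cmod (L2_inner h (tf_shift (tf_join x \<xi>) b))) \<partial>lborel \<partial>lborel)"
    by (simp only: ef eh ennreal_mult[OF norm_ge_zero norm_ge_zero])
  also have "\<dots> = (\<integral>\<^sup>+z. ennreal (cmod (L2_inner f (tf_shift z a))) * ennreal (cmod (L2_inner h (tf_shift z b))) \<partial>lborel)"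
    by (intro nn_integral_tf_join[symmetric] borel_measurable_times_ennreal meas L2)
  finally show ?thesis .
qed

subsection \<open>The integrable envelope of an M1 window\<close>

lemma norm_square_vec: "(norm (z::real^'n))\<^sup>2 = (\<Sum>i\<in>UNIV. (z $ i)\<^sup>2)"
  unfolding power2_norm_eq_inner inner_vec_def by (simp add: power2_eq_square)

lemma norm_square_parts: "(norm z)\<^sup>2 = (norm (time_part z))\<^sup>2 + (norm (freq_part z))\<^sup>2"
proof -
  have "(norm z)\<^sup>2 = (\<Sum>i\<in>UNIV. (z $ i)\<^sup>2)"
    by (rule norm_square_vec)
  also have "\<dots> = (\<Sum>i\<in>UNIV. (z $ Inl i)\<^sup>2) + (\<Sum>i\<in>UNIV. (z $ Inr i)\<^sup>2)"
    by (subst UNIV_Plus_UNIV[symmetric], subst sum.Plus) auto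
  finally show ?thesis
    by (simp add: norm_square_vec time_part_def freq_part_def)
qed

definition gauss_window :: "real^'d \<Rightarrow> complex" where
  "gauss_window t = complex_of_real (gaussian t)"

text \<open>Completing the square: |t|^2 + |t - x|^2 = |x|^2 / 2 + 2 |t - x/2|^2. The product splits
  into a factor in \<open>x\<close> and a Gaussian centred at the midpoint.\<close>

lemma gaussian_mult: "gaussian t * gaussian (t - x)
    = gaussian ((1 / sqrt 2) *\<^sub>R x) * gaussian (sqrt 2 *\<^sub>R (t - (1/2) *\<^sub>R x))"
proof -
  have "(norm t)\<^sup>2 + (norm (t - x))\<^sup>2 = (norm ((1 / sqrt 2) *\<^sub>R x))\<^sup>2 + (norm (sqrt 2 *\<^sub>R (t - (1/2) *\<^sub>R x)))\<^sup>2"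
    by (simp add: power_mult_distrib power_divide)
      (simp add: power2_norm_eq_inner inner_diff_left inner_diff_right inner_commute algebra_simps)
  then show ?thesis
    unfolding gaussian_def exp_add[symmetric] distrib_left[symmetric] by simp
qed

lemma gauss_window_L2: "gauss_window \<in> (L2 :: (real^'d \<Rightarrow> complex) set)"
proof -
  have "gaussian t * gaussian (t::real^'d) = gaussian (sqrt 2 *\<^sub>R t)" for t
    using gaussian_mult[of t 0] by (simp add: gaussian_def)
  then have "integrable lborel (\<lambda>t::real^'d. gaussian t * gaussian t)"
    using gaussian_fourier_scaled(1)[of "sqrt 2", where 'a="real^'d"] by simp
  then have "integrable lborel (\<lambda>t::real^'d. (cmod (gauss_window t))\<^sup>2)"
    by (simp add: gauss_window_def power2_eq_square)
  moreover have "(gauss_window :: real^'d \<Rightarrow> complex) \<in> borel_measurable borel"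
    unfolding gauss_window_def[abs_def] by measurable
  ultimately show ?thesis
    by (auto simp: L2_def integrable_completion intro: measurable_completion)
qed

lemma borel_measurable_gauss_window [measurable]: "gauss_window \<in> borel_measurable borel"
  unfolding gauss_window_def[abs_def] by measurable

text \<open>The ambiguity function of a Gaussian is, in modulus, a Gaussian on phase space:
  completing the square moves the integral to the midpoint, and the Fourier transform supplies the
  decay in frequency. A power of \<open>sqrt 2\<close> in the denominator is discarded.\<close>

lemma gauss_window_inner_le:
  "cmod (L2_inner gauss_window (tf_shift z gauss_window)) \<le> gaussian ((1 / sqrt 2) *\<^sub>R z)"
proof -
  let ?x = "time_part z" and ?\<xi> = "freq_part z"
  let ?s = "sqrt 2 :: real"
  let ?c = "(1/2) *\<^sub>R ?x"
  let ?G = "\<lambda>t. cis (2 * pi * ((- ?\<xi>) \<bullet> t)) * complex_of_real (gaussian (?s *\<^sub>R t))"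
  have "L2_inner gauss_window (tf_shift z gauss_window)
      = (\<integral>t. gauss_window t * cnj (tf_shift z gauss_window t) \<partial>lborel)"
    by (intro L2_inner_lborel borel_measurable_tf_shift) measurable
  also have "\<dots> = (\<integral>t. complex_of_real (gaussian ((1 / ?s) *\<^sub>R ?x)) * cis (2 * pi * ((- ?\<xi>) \<bullet> ?c)) * ?G (t - ?c) \<partial>lborel)"
  proof (rule Bochner_Integration.integral_cong)
    fix t
    have ph: "cis (2 * pi * ((- ?\<xi>) \<bullet> ?c)) * cis (2 * pi * ((- ?\<xi>) \<bullet> (t - ?c))) = cnj (cis (2 * pi * (?\<xi> \<bullet> t)))"
      by (simp add: cis_mult cis_cnj inner_diff_right algebra_simps)
    have "gauss_window t * cnj (tf_shift z gauss_window t)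
        = complex_of_real (gaussian t * gaussian (t - ?x)) * cnj (cis (2 * pi * (?\<xi> \<bullet> t)))"
      by (simp add: gauss_window_def tf_shift_cis)
    then show "gauss_window t * cnj (tf_shift z gauss_window t)
        = complex_of_real (gaussian ((1 / ?s) *\<^sub>R ?x)) * cis (2 * pi * ((- ?\<xi>) \<bullet> ?c)) * ?G (t - ?c)"
      unfolding gaussian_mult ph[symmetric] by (simp only: of_real_mult mult_ac)
  qed simp
  also have "\<dots> = complex_of_real (gaussian ((1 / ?s) *\<^sub>R ?x)) * cis (2 * pi * ((- ?\<xi>) \<bullet> ?c)) * (\<integral>t. ?G (t - ?c) \<partial>lborel)"
    by (rule integral_mult_right_zero)
  also have "(\<integral>t. ?G (t - ?c) \<partial>lborel) = (\<integral>t. ?G t \<partial>lborel)"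
    using lborel_integral_affine[of 1 ?G "- ?c"] by simp
  also have "\<dots> = complex_of_real (gaussian ((- ?\<xi>) /\<^sub>R ?s) / ?s ^ DIM(real^'a))"
    by (rule gaussian_fourier_scaled(2)) simp
  finally have "cmod (L2_inner gauss_window (tf_shift z gauss_window))
      = gaussian ((1 / ?s) *\<^sub>R ?x) * (gaussian ((- ?\<xi>) /\<^sub>R ?s) / ?s ^ CARD('a))"
    by (simp add: norm_mult norm_divide norm_power)
  also have "\<dots> \<le> gaussian ((1 / ?s) *\<^sub>R ?x) * gaussian ((- ?\<xi>) /\<^sub>R ?s)"
  proof (rule mult_left_mono)
    have "1 \<le> ?s ^ CARD('a)" by (rule one_le_power) simp
    then have "gaussian ((- ?\<xi>) /\<^sub>R ?s) / ?s ^ CARD('a) \<le> gaussian ((- ?\<xi>) /\<^sub>R ?s) / 1"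
      by (intro divide_left_mono) auto
    then show "gaussian ((- ?\<xi>) /\<^sub>R ?s) / ?s ^ CARD('a) \<le> gaussian ((- ?\<xi>) /\<^sub>R ?s)" by simp
  qed simp
  also have "\<dots> = gaussian ((1 / ?s) *\<^sub>R z)"
  proof -
    have half: "gaussian ((1 / ?s) *\<^sub>R v) = exp (- pi * ((norm v)\<^sup>2 / 2))" for v :: "'v::euclidean_space"
    proof -
      have "(norm ((1 / ?s) *\<^sub>R v))\<^sup>2 = (norm v)\<^sup>2 / 2"
        by (simp add: power_divide)
      then show ?thesis by (simp only: gaussian_def)
    qed
    have "(- ?\<xi>) /\<^sub>R ?s = (1 / ?s) *\<^sub>R (- ?\<xi>)" by (simp add: divide_inverse)
    then have "gaussian ((1 / ?s) *\<^sub>R ?x) * gaussian ((- ?\<xi>) /\<^sub>R ?s)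
        = exp (- pi * ((norm ?x)\<^sup>2 / 2) + - pi * ((norm (- ?\<xi>))\<^sup>2 / 2))"
      by (simp only: half exp_add)
    also have "- pi * ((norm ?x)\<^sup>2 / 2) + - pi * ((norm (- ?\<xi>))\<^sup>2 / 2) = - pi * ((norm z)\<^sup>2 / 2)"
      unfolding norm_square_parts[of z] norm_minus_cancel by (simp add: algebra_simps add_divide_distrib)
    finally show ?thesis by (simp only: half)
  qed
  finally show ?thesis .
qed

text \<open>Tonelli and reflection; this makes the convolution-type envelopes below
  integrable.\<close>

lemma nn_integral_correlation:
  fixes p q :: "'a::euclidean_space \<Rightarrow> ennreal"
  assumes [measurable]: "p \<in> borel_measurable borel" "q \<in> borel_measurable borel"
  shows "(\<integral>\<^sup>+z. \<integral>\<^sup>+w. p w * q (w - z) \<partial>lborel \<partial>lborel) = (\<integral>\<^sup>+w. p w \<partial>lborel) * (\<integral>\<^sup>+w. q w \<partial>lborel)"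
proof -
  have "(\<integral>\<^sup>+z. \<integral>\<^sup>+w. p w * q (w - z) \<partial>lborel \<partial>lborel) = (\<integral>\<^sup>+w. \<integral>\<^sup>+z. p w * q (w - z) \<partial>lborel \<partial>lborel)"
    by (rule lborel_pair.Fubini') measurable
  also have "\<dots> = (\<integral>\<^sup>+w. p w * (\<integral>\<^sup>+z. q (w - z) \<partial>lborel) \<partial>lborel)"
    by (intro nn_integral_cong nn_integral_cmult) measurable
  also have "\<dots> = (\<integral>\<^sup>+w. p w * (\<integral>\<^sup>+z. q z \<partial>lborel) \<partial>lborel)"
    by (simp only: lborel_nn_integral_reflect[OF assms(2)])
  also have "\<dots> = (\<integral>\<^sup>+w. p w \<partial>lborel) * (\<integral>\<^sup>+w. q w \<partial>lborel)"
    by (rule nn_integral_multc) measurable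
  finally show ?thesis .
qed

text \<open>Local suprema of a Gaussian are dominated by a wider Gaussian: |v|^2 is at most 2 |v +
  u|^2 + 2, which turns the scale \<open>1 / sqrt 2\<close> into \<open>1 / 2\<close> and costs the
  factor \<open>exp (pi / 2)\<close>.\<close>

lemma gaussian_shift_le:
  assumes "norm u \<le> 1"
  shows "gaussian ((1 / sqrt 2) *\<^sub>R (v + u)) \<le> exp (pi / 2) * gaussian ((1 / 2) *\<^sub>R v)"
proof -
  have "(norm v)\<^sup>2 \<le> (norm (v + u) + norm u)\<^sup>2"
    using norm_triangle_ineq4[of "v + u" u] by (intro power_mono) auto
  also have "\<dots> \<le> 2 * (norm (v + u))\<^sup>2 + 2 * (norm u)\<^sup>2"
    using sum_squares_bound[of "norm (v + u)" "norm u"] by (simp add: power2_sum)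
  also have "(norm u)\<^sup>2 \<le> 1" using assms by (simp add: power_le_one)
  finally have "(norm v)\<^sup>2 / 4 \<le> (norm (v + u))\<^sup>2 / 2 + 1 / 2" by linarith
  then have "pi * ((norm v)\<^sup>2 / 4) \<le> pi * ((norm (v + u))\<^sup>2 / 2 + 1 / 2)"
    by (rule mult_left_mono) simp
  then have "- (pi * ((norm (v + u))\<^sup>2 / 2)) \<le> pi / 2 + - (pi * ((norm v)\<^sup>2 / 4))"
    by (simp add: distrib_left)
  then have "exp (- (pi * ((norm (v + u))\<^sup>2 / 2))) \<le> exp (pi / 2) * exp (- (pi * ((norm v)\<^sup>2 / 4)))"
    by (simp flip: exp_add)
  moreover have "gaussian ((1 / sqrt 2) *\<^sub>R (v + u)) = exp (- (pi * ((norm (v + u))\<^sup>2 / 2)))"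
    by (simp add: gaussian_def power_divide)
  moreover have "gaussian ((1 / 2) *\<^sub>R v) = exp (- (pi * ((norm v)\<^sup>2 / 4)))"
    by (simp add: gaussian_def power_divide)
  ultimately show ?thesis by simp
qed

lemma gauss_window_norm_pos: "0 < L2_norm (gauss_window :: real^'d \<Rightarrow> complex)"
proof -
  have "gaussian t * gaussian t = gaussian (sqrt 2 *\<^sub>R t)" for t :: "real^'d"
    using gaussian_mult[of t 0] by (simp add: gaussian_def)
  then have "complex_of_real ((L2_norm (gauss_window :: real^'d \<Rightarrow> complex))\<^sup>2)
      = (\<integral>t. complex_of_real (gaussian (sqrt 2 *\<^sub>R (t::real^'d))) \<partial>lborel)"
    unfolding L2_inner_self[symmetric]
    by (subst L2_inner_lborel) (auto simp: gauss_window_def simp flip: of_real_mult)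
  also have "\<dots> = complex_of_real (1 / sqrt 2 ^ CARD('d))"
    using gaussian_fourier_scaled(2)[of "sqrt 2" "0::real^'d"] by (simp add: gaussian_def)
  finally have "(L2_norm (gauss_window :: real^'d \<Rightarrow> complex))\<^sup>2 = 1 / sqrt 2 ^ CARD('d)"
    by (simp only: of_real_eq_iff)
  then have "(L2_norm (gauss_window :: real^'d \<Rightarrow> complex))\<^sup>2 \<noteq> 0" by simp
  then show ?thesis
    using L2_norm_nonneg[of "gauss_window :: real^'d \<Rightarrow> complex"] by (simp add: less_le)
qed

lemma ennreal_mult_le_imp_le_divide:
  assumes "0 < c" "ennreal c * x \<le> y"
  shows "x \<le> y * ennreal (1 / c)"
proof -
  have "x = ennreal (1 / c) * (ennreal c * x)"
    using assms(1) by (simp add: mult.assoc[symmetric] flip: ennreal_mult)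
  also have "\<dots> \<le> ennreal (1 / c) * y"
    by (intro mult_left_mono assms(2)) simp
  finally show ?thesis by (simp add: mult.commute)
qed

text \<open>Expresses that the ambiguity function of \<open>g\<close> lies in a Wiener amalgam
  space, locally bounded and globally integrable. A measurable majorant on unit balls stands in for
  the local supremum; it may take infinite values.\<close>

definition tf_envelope :: "(real^'d \<Rightarrow> complex) \<Rightarrow> (real^('d + 'd) \<Rightarrow> ennreal) \<Rightarrow> bool" where
  "tf_envelope g E \<longleftrightarrow> E \<in> borel_measurable borel \<and> (\<integral>\<^sup>+z. E z \<partial>lborel) < \<infinity> \<and>
    (\<forall>z u. norm u \<le> 1 \<longrightarrow> ennreal (cmod (L2_inner g (tf_shift (z + u) g))) \<le> E z)"

text \<open>Conjugating one time-frequency shift by another changes it by a phase only, so moving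
  the Gaussian to \<open>w0\<close> leaves its ambiguity function unchanged in modulus.\<close>

lemma gauss_window_shifted_inner_le:
  "cmod (L2_inner (tf_shift w0 gauss_window) (tf_shift v (tf_shift w0 gauss_window)))
    \<le> gaussian ((1 / sqrt 2) *\<^sub>R v)"
proof -
  have "cmod (L2_inner (tf_shift w0 gauss_window) (tf_shift v (tf_shift w0 gauss_window)))
      = cmod (L2_inner (tf_shift w0 gauss_window) (tf_shift (v + w0) gauss_window))"
    unfolding tf_shift_add by (simp add: L2_inner_scale_right norm_mult)
  also have "\<dots> = cmod (L2_inner gauss_window (tf_shift v gauss_window))"
    by (simp add: cmod_L2_inner_tf_shift gauss_window_L2)
  finally show ?thesis using gauss_window_inner_le by simp
qed

text \<open>If all these inner products vanished, the Moyal inequality with \<open>f = h = g\<close>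
  and Gaussian windows would bound a product of nonzero squared norms by 0.\<close>

lemma gauss_window_inner_nonzero:
  assumes g: "g \<in> L2" and "L2_norm g \<noteq> 0"
  obtains w0 where "L2_inner g (tf_shift w0 gauss_window) \<noteq> 0"
proof (rule ccontr)
  assume "\<not> thesis"
  then have z: "L2_inner g (tf_shift w gauss_window) = 0" for w using that by blast
  have "ennreal (cmod (L2_inner g g) * cmod (L2_inner gauss_window (gauss_window :: real^'a \<Rightarrow> complex))) \<le> 0"
    using Moyal_inequality[OF g g gauss_window_L2 gauss_window_L2] by (simp add: z)
  then have "cmod (L2_inner g g) * cmod (L2_inner gauss_window (gauss_window :: real^'a \<Rightarrow> complex)) \<le> 0"
    by (simp add: ennreal_eq_0_iff)
  moreover have "cmod (L2_inner g g) * cmod (L2_inner gauss_window (gauss_window :: real^'a \<Rightarrow> complex))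
      = (L2_norm g)\<^sup>2 * (L2_norm (gauss_window :: real^'a \<Rightarrow> complex))\<^sup>2"
    by (simp add: L2_inner_self norm_power)
  moreover have "\<dots> > 0"
    using assms(2) gauss_window_norm_pos[where 'd='a] by simp
  ultimately show False by simp
qed

text \<open>
  With \<open>\<phi>\<close> a Gaussian not orthogonal to \<open>g\<close>, the Moyal inequality bounds \<open>|V\<^sub>\<phi> g|\<close> by
  \<open>|V\<^sub>g g| * |V\<^sub>\<phi> \<phi>|\<close> and then \<open>|V\<^sub>g g|\<close> by \<open>|V\<^sub>\<phi> g| * |V\<^sub>\<phi> g|\<close>; local suprema pass through each
  convolution because those of \<open>|V\<^sub>\<phi> \<phi>|\<close> are again dominated by a Gaussian.
\<close>

lemma M1_tf_envelope:
  fixes g :: "real^'d \<Rightarrow> complex"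
  assumes g: "g \<in> M1"
  obtains E where "tf_envelope g E"
proof (cases "L2_norm g = 0")
  case True
  have gL2: "g \<in> L2" using g by (simp add: M1_def)
  have "cmod (L2_inner g (tf_shift z g)) \<le> 0" for z
    using L2_Cauchy_Schwarz[OF gL2 L2_tf_shift[OF gL2], of z] True by simp
  then have "tf_envelope g (\<lambda>_. 0)" by (simp add: tf_envelope_def)
  then show ?thesis by (rule that)
next
  case False
  have gL2: "g \<in> L2" using g by (simp add: M1_def)
  obtain w0 where w0: "L2_inner g (tf_shift w0 gauss_window) \<noteq> 0"
    using gauss_window_inner_nonzero[OF gL2 False] by blast
  define \<phi> where "\<phi> = tf_shift w0 gauss_window"
  have \<phi>: "\<phi> \<in> L2" unfolding \<phi>_def by (intro L2_tf_shift gauss_window_L2)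
  define c where "c = cmod (L2_inner \<phi> g)"
  have c: "0 < c" using w0 by (simp add: c_def \<phi>_def cmod_L2_inner_commute[of _ g])
  define n where "n = (L2_norm \<phi>)\<^sup>2"
  have n: "0 < n"
    using gauss_window_norm_pos[where 'd='d] by (simp add: n_def \<phi>_def L2_norm_tf_shift gauss_window_L2)
  define \<Phi> where "\<Phi> w = ennreal (cmod (L2_inner g (tf_shift w g)))" for w
  have [measurable]: "\<Phi> \<in> borel_measurable borel"
    using borel_measurable_L2_inner_tf_shift[OF gL2 gL2] unfolding \<Phi>_def[abs_def] by measurable
  have \<Phi>_fin: "(\<integral>\<^sup>+w. \<Phi> w \<partial>lborel) < \<infinity>"
    using g nn_integral_completion[of lborel \<Phi>] by (simp add: M1_def \<Phi>_def[abs_def])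
  define q where "q v = ennreal (exp (pi / 2) * gaussian ((1 / 2) *\<^sub>R v))" for v :: "real^('d + 'd)"
  have [measurable]: "q \<in> borel_measurable borel" unfolding q_def[abs_def] by measurable
  have q_fin: "(\<integral>\<^sup>+v. q v \<partial>lborel) < \<infinity>"
  proof -
    have "integrable lborel (\<lambda>v::real^('d + 'd). exp (pi / 2) * gaussian ((1 / 2) *\<^sub>R v))"
      by (intro integrable_mult_right gaussian_fourier_scaled(1)) simp
    then show ?thesis unfolding q_def by (subst nn_integral_eq_integral) auto
  qed
  \<comment> \<open>The Moyal inequality is used with windows \<open>a = g\<close> and
    \<open>b = \<phi>\<close>: the displacement \<open>u\<close> then falls on the Gaussian pair,
    where \<open>q\<close> absorbs it, and \<open>c\<close> is the factor to divide by.\<close>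
  define E1 where "E1 z = (\<integral>\<^sup>+w. \<Phi> w * q (w - z) \<partial>lborel) * ennreal (1 / c)" for z
  have [measurable]: "E1 \<in> borel_measurable borel"
    unfolding E1_def by measurable
  have E1_fin: "(\<integral>\<^sup>+z. E1 z \<partial>lborel) < \<infinity>"
    unfolding E1_def using \<Phi>_fin q_fin
    by (subst nn_integral_multc) (auto simp: nn_integral_correlation ennreal_mult_less_top)
  have E1: "ennreal (cmod (L2_inner g (tf_shift (z + u) \<phi>))) \<le> E1 z" if u: "norm u \<le> 1" for z u
    unfolding E1_def
  proof (rule ennreal_mult_le_imp_le_divide[OF c])
    have "ennreal c * ennreal (cmod (L2_inner g (tf_shift (z + u) \<phi>)))
        = ennreal (cmod (L2_inner g (tf_shift (z + u) \<phi>)) * cmod (L2_inner \<phi> g))"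
      by (simp add: c_def ennreal_mult mult.commute)
    also have "\<dots> \<le> (\<integral>\<^sup>+w. ennreal (cmod (L2_inner g (tf_shift w g))) *
        ennreal (cmod (L2_inner (tf_shift (z + u) \<phi>) (tf_shift w \<phi>))) \<partial>lborel)"
      by (intro Moyal_inequality gL2 \<phi> L2_tf_shift)
    also have "\<dots> \<le> (\<integral>\<^sup>+w. \<Phi> w * q (w - z) \<partial>lborel)"
    proof (intro nn_integral_mono)
      fix w
      have "cmod (L2_inner (tf_shift (z + u) \<phi>) (tf_shift w \<phi>)) = cmod (L2_inner \<phi> (tf_shift ((w - z) + (- u)) \<phi>))"
        by (simp add: cmod_L2_inner_tf_shift \<phi> algebra_simps)
      also have "\<dots> \<le> gaussian ((1 / sqrt 2) *\<^sub>R ((w - z) + (- u)))"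
        unfolding \<phi>_def by (rule gauss_window_shifted_inner_le)
      also have "\<dots> \<le> exp (pi / 2) * gaussian ((1 / 2) *\<^sub>R (w - z))"
        by (rule gaussian_shift_le) (use u in simp)
      finally show "ennreal (cmod (L2_inner g (tf_shift w g))) *
          ennreal (cmod (L2_inner (tf_shift (z + u) \<phi>) (tf_shift w \<phi>))) \<le> \<Phi> w * q (w - z)"
        unfolding \<Phi>_def q_def by (intro mult_left_mono ennreal_leI) auto
    qed
    finally show "ennreal c * ennreal (cmod (L2_inner g (tf_shift (z + u) \<phi>)))
        \<le> (\<integral>\<^sup>+w. \<Phi> w * q (w - z) \<partial>lborel)" .
  qed
  \<comment> \<open>Both windows are now \<open>\<phi>\<close>, so the divisor is its squared norm;
    \<open>u\<close> affects one factor only, and the bound by \<open>E1\<close> already allows for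
    it.\<close>
  define E where "E z = (\<integral>\<^sup>+w. E1 w * E1 (w - z) \<partial>lborel) * ennreal (1 / n)" for z
  have E_meas: "E \<in> borel_measurable borel"
    unfolding E_def by measurable
  have E_fin: "(\<integral>\<^sup>+z. E z \<partial>lborel) < \<infinity>"
    unfolding E_def using E1_fin
    by (subst nn_integral_multc) (auto simp: nn_integral_correlation ennreal_mult_less_top)
  have E: "ennreal (cmod (L2_inner g (tf_shift (z + u) g))) \<le> E z" if u: "norm u \<le> 1" for z u
    unfolding E_def
  proof (rule ennreal_mult_le_imp_le_divide[OF n])
    have "ennreal n * ennreal (cmod (L2_inner g (tf_shift (z + u) g)))
        = ennreal (cmod (L2_inner g (tf_shift (z + u) g)) * cmod (L2_inner \<phi> \<phi>))"
      by (simp add: n_def L2_inner_self norm_power ennreal_mult mult.commute)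
    also have "\<dots> \<le> (\<integral>\<^sup>+w. ennreal (cmod (L2_inner g (tf_shift w \<phi>))) *
        ennreal (cmod (L2_inner (tf_shift (z + u) g) (tf_shift w \<phi>))) \<partial>lborel)"
      by (intro Moyal_inequality gL2 \<phi> L2_tf_shift)
    also have "\<dots> \<le> (\<integral>\<^sup>+w. E1 w * E1 (w - z) \<partial>lborel)"
    proof (intro nn_integral_mono mult_mono)
      fix w
      show "ennreal (cmod (L2_inner g (tf_shift w \<phi>))) \<le> E1 w"
        using E1[of 0 w] by simp
      have "cmod (L2_inner (tf_shift (z + u) g) (tf_shift w \<phi>)) = cmod (L2_inner g (tf_shift ((w - z) + (- u)) \<phi>))"
        by (simp add: cmod_L2_inner_tf_shift gL2 \<phi> algebra_simps)
      then show "ennreal (cmod (L2_inner (tf_shift (z + u) g) (tf_shift w \<phi>))) \<le> E1 (w - z)"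
        using E1[of "- u" "w - z"] u by simp
    qed auto
    finally show "ennreal n * ennreal (cmod (L2_inner g (tf_shift (z + u) g)))
        \<le> (\<integral>\<^sup>+w. E1 w * E1 (w - z) \<partial>lborel)" .
  qed
  have "tf_envelope g E"
    using E_meas E_fin E by (auto simp: tf_envelope_def)
  then show ?thesis by (rule that)
qed

subsection \<open>Sums over relatively separated families\<close>

definition ambiguity :: "(real^'d \<Rightarrow> complex) \<Rightarrow> real^('d + 'd) \<Rightarrow> real" where
  "ambiguity g v = cmod (L2_inner g (tf_shift v g))"

lemma ambiguity_nonneg [simp]: "0 \<le> ambiguity g v"
  by (simp add: ambiguity_def)

lemma cmod_L2_inner_ambiguity:
  "g \<in> L2 \<Longrightarrow> cmod (L2_inner (tf_shift z g) (tf_shift w g)) = ambiguity g (w - z)"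
  by (simp add: ambiguity_def cmod_L2_inner_tf_shift)

lemma ambiguity_uminus: "g \<in> L2 \<Longrightarrow> ambiguity g (- v) = ambiguity g v"
  using cmod_L2_inner_ambiguity[of g v 0]
  by (simp add: ambiguity_def cmod_L2_inner_commute)

lemma ambiguity_diff_commute: "g \<in> L2 \<Longrightarrow> ambiguity g (v - w) = ambiguity g (w - v)"
  using ambiguity_uminus[of g "v - w"] by simp

text \<open>An indexed family, so that multiplicities count and the same node set can be paired with
  the identity or with \<open>T\<close>.\<close>

definition separated_family :: "'i set \<Rightarrow> ('i \<Rightarrow> 'a::metric_space) \<Rightarrow> real \<Rightarrow> nat \<Rightarrow> bool" where
  "separated_family I p r N \<longleftrightarrow>
    (\<forall>z. finite {i \<in> I. dist (p i) z < r} \<and> card {i \<in> I. dist (p i) z < r} \<le> N)"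

lemma separated_family_card:
  assumes "separated_family I p r N" "S \<subseteq> I"
  shows "card {i \<in> S. dist (p i) z < r} \<le> N"
proof -
  have "{i \<in> S. dist (p i) z < r} \<subseteq> {i \<in> I. dist (p i) z < r}" using assms(2) by auto
  then show ?thesis
    using assms(1) card_mono[of "{i \<in> I. dist (p i) z < r}" "{i \<in> S. dist (p i) z < r}"]
    by (auto simp: separated_family_def intro: le_trans)
qed

text \<open>The value at \<open>p i - z\<close> is at most \<open>E\<close> on the whole ball of
  radius \<open>r\<close> about that point, so it is replaced by an average of \<open>E\<close>;
  these balls overlap at most \<open>N\<close> times. The cutoff \<open>\<rho> - 1\<close> allows
  for their radius, which is at most 1.\<close>

lemma envelope_sum_le:
  fixes p :: "'i \<Rightarrow> real^('d::finite + 'd)"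
  assumes E: "tf_envelope g E" and r: "0 < r" "r \<le> 1" and sep: "separated_family I p r N"
    and S: "finite S" "S \<subseteq> I" and far: "\<And>i. i \<in> S \<Longrightarrow> \<rho> \<le> norm (p i - z)"
  shows "ennreal (\<Sum>i\<in>S. ambiguity g (p i - z)) * emeasure lborel (ball (0::real^('d + 'd)) r)
    \<le> of_nat N * (\<integral>\<^sup>+v. E v * indicator {v. \<rho> - 1 < norm v} v \<partial>lborel)"
proof -
  have [measurable]: "E \<in> borel_measurable borel" using E by (simp add: tf_envelope_def)
  have [measurable]: "{v :: real^('d + 'd). \<rho> - 1 < norm v} \<in> sets borel" by measurable
  have [measurable]: "ball c r \<in> sets borel" for c :: "real^('d + 'd)" by simp
  have ball: "emeasure lborel (ball (p i - z) r) = emeasure lborel (ball (0::real^('d + 'd)) r)" for i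
    using r by (simp add: emeasure_ball)
  have single: "ennreal (ambiguity g (p i - z)) * emeasure lborel (ball (0::real^('d + 'd)) r)
      \<le> (\<integral>\<^sup>+v. E v * indicator {v. \<rho> - 1 < norm v} v * indicator (ball (p i - z) r) v \<partial>lborel)"
    if i: "i \<in> S" for i
  proof -
    have "ennreal (ambiguity g (p i - z)) * emeasure lborel (ball (0::real^('d + 'd)) r)
        = (\<integral>\<^sup>+v. ennreal (ambiguity g (p i - z)) * indicator (ball (p i - z) r) v \<partial>lborel)"
      by (subst nn_integral_cmult_indicator) (auto simp: ball)
    also have "\<dots> \<le> (\<integral>\<^sup>+v. E v * indicator {v. \<rho> - 1 < norm v} v * indicator (ball (p i - z) r) v \<partial>lborel)"
    proof (intro nn_integral_mono)
      fix v
      show "ennreal (ambiguity g (p i - z)) * indicator (ball (p i - z) r) v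
          \<le> E v * indicator {v. \<rho> - 1 < norm v} v * indicator (ball (p i - z) r) v"
      proof (cases "v \<in> ball (p i - z) r")
        case True
        then have d: "norm (p i - z - v) < r" by (simp add: dist_norm)
        have "ennreal (cmod (L2_inner g (tf_shift (v + (p i - z - v)) g))) \<le> E v"
          using E d r unfolding tf_envelope_def by (metis less_le_trans less_imp_le)
        then have "ennreal (ambiguity g (p i - z)) \<le> E v" by (simp add: ambiguity_def)
        moreover have "norm (p i - z) \<le> norm v + norm (p i - z - v)"
          using norm_triangle_ineq[of v "p i - z - v"] by simp
        then have "\<rho> - 1 < norm v" using far[OF i] d r by linarith
        ultimately show ?thesis using True by simp
      qed simp
    qed
    finally show ?thesis .
  qed
  have "ennreal (\<Sum>i\<in>S. ambiguity g (p i - z)) * emeasure lborel (ball (0::real^('d + 'd)) r)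
      = (\<Sum>i\<in>S. ennreal (ambiguity g (p i - z)) * emeasure lborel (ball (0::real^('d + 'd)) r))"
    by (simp add: sum_distrib_right flip: sum_ennreal)
  also have "\<dots> \<le> (\<Sum>i\<in>S. \<integral>\<^sup>+v. E v * indicator {v. \<rho> - 1 < norm v} v * indicator (ball (p i - z) r) v \<partial>lborel)"
    by (intro sum_mono single)
  also have "\<dots> = (\<integral>\<^sup>+v. (\<Sum>i\<in>S. E v * indicator {v. \<rho> - 1 < norm v} v * indicator (ball (p i - z) r) v) \<partial>lborel)"
    by (rule nn_integral_sum[symmetric]) measurable
  also have "\<dots> \<le> (\<integral>\<^sup>+v. of_nat N * (E v * indicator {v. \<rho> - 1 < norm v} v) \<partial>lborel)"
  proof (intro nn_integral_mono)
    fix v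
    have "(\<Sum>i\<in>S. indicator (ball (p i - z) r) v :: ennreal) = (\<Sum>i\<in>S. if dist (p i) (z + v) < r then 1 else 0)"
    proof (rule sum.cong)
      fix i
      have "dist (p i - z) v = dist (p i) (z + v)" by (simp add: dist_norm algebra_simps)
      then show "(indicator (ball (p i - z) r) v :: ennreal) = (if dist (p i) (z + v) < r then 1 else 0)"
        by (simp add: indicator_def)
    qed simp
    also have "\<dots> = of_nat (card {i \<in> S. dist (p i) (z + v) < r})"
      using S(1) by (simp add: sum.If_cases Int_def)
    also have "\<dots> \<le> of_nat N" using separated_family_card[OF sep S(2)] by simp
    finally have "(\<Sum>i\<in>S. indicator (ball (p i - z) r) v) \<le> (of_nat N :: ennreal)" .
    then show "(\<Sum>i\<in>S. E v * indicator {v. \<rho> - 1 < norm v} v * indicator (ball (p i - z) r) v)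
        \<le> of_nat N * (E v * indicator {v. \<rho> - 1 < norm v} v)"
      unfolding sum_distrib_left[symmetric] mult.commute[of "of_nat N"] by (rule mult_left_mono) simp
  qed
  also have "\<dots> = of_nat N * (\<integral>\<^sup>+v. E v * indicator {v. \<rho> - 1 < norm v} v \<partial>lborel)"
    by (rule nn_integral_cmult) measurable
  finally show ?thesis .
qed

lemma emeasure_ball_bounds:
  assumes "0 < r"
  shows "emeasure lborel (ball (0::'a::euclidean_space) r) = ennreal (measure lborel (ball (0::'a) r))"
    and "0 < measure lborel (ball (0::'a) r)"
  using assms by (auto simp: emeasure_eq_ennreal_measure emeasure_ball content_ball)

text \<open>\<open>K\<close> is chosen before the family: only \<open>g\<close>, \<open>r\<close>
  and \<open>N\<close> enter. This uniformity lets one constant serve \<open>\<Lambda>\<close> and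
  all its perturbations.\<close>

lemma ambiguity_sum_bounded:
  fixes g :: "real^'d \<Rightarrow> complex"
  assumes g: "g \<in> M1" and r: "0 < r" "r \<le> 1"
  obtains K where "0 < K"
    "\<And>(I::'i set) p S z. separated_family I p r N \<Longrightarrow> finite S \<Longrightarrow> S \<subseteq> I \<Longrightarrow>
      (\<Sum>i\<in>S. ambiguity g (p i - z)) \<le> K"
proof -
  obtain E where E: "tf_envelope g E" using M1_tf_envelope[OF g] .
  let ?V = "measure lborel (ball (0::real^('d + 'd)) r)"
  obtain e where e: "0 \<le> e" "(\<integral>\<^sup>+v. E v \<partial>lborel) = ennreal e"
    using E by (cases "\<integral>\<^sup>+v. E v \<partial>lborel") (auto simp: tf_envelope_def)
  have V: "0 < ?V" "emeasure lborel (ball (0::real^('d + 'd)) r) = ennreal ?V"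
    using emeasure_ball_bounds[OF r(1), where 'a="real^('d + 'd)"] by auto
  \<comment> \<open>The added 1 keeps the constant positive when \<open>N\<close> or
    \<open>e\<close> is 0.\<close>
  have "(\<Sum>i\<in>S. ambiguity g (p i - z)) \<le> real N * e / ?V + 1"
    if "separated_family I p r N" "finite S" "S \<subseteq> I" for I :: "'i set" and p S z
  proof -
    \<comment> \<open>With \<open>\<rho> = 0\<close> the cutoff \<open>0 - 1 < norm v\<close> holds
      everywhere.\<close>
    have "ennreal (\<Sum>i\<in>S. ambiguity g (p i - z)) * ennreal ?V
        \<le> of_nat N * (\<integral>\<^sup>+v. E v * indicator {v. 0 - 1 < norm v} v \<partial>lborel)"
      using envelope_sum_le[OF E r that, of 0 z] V by simp
    also have "\<dots> = ennreal (real N * e)"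
      by (simp add: indicator_def e order_less_le_trans[of "-1" 0] ennreal_mult ennreal_of_nat_eq_real_of_nat)
    finally have "(\<Sum>i\<in>S. ambiguity g (p i - z)) * ?V \<le> real N * e"
      using V(1) e(1) by (simp add: sum_nonneg flip: ennreal_mult)
    then have "(\<Sum>i\<in>S. ambiguity g (p i - z)) \<le> real N * e / ?V"
      using V(1) by (simp add: pos_le_divide_eq)
    then show ?thesis by simp
  qed
  moreover have "0 < real N * e / ?V + 1" using V e by (intro add_nonneg_pos divide_nonneg_pos) auto
  ultimately show ?thesis using that by blast
qed

text \<open>Dominated convergence for \<open>E\<close> restricted to the outside of growing balls.
  The radius again depends on the family only through \<open>r\<close> and \<open>N\<close>.\<close>

lemma ambiguity_sum_tail:
  fixes g :: "real^'d \<Rightarrow> complex"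
  assumes g: "g \<in> M1" and r: "0 < r" "r \<le> 1" and e: "0 < e"
  obtains \<rho> where "0 < \<rho>"
    "\<And>(I::'i set) p S z. separated_family I p r N \<Longrightarrow> finite S \<Longrightarrow> S \<subseteq> I \<Longrightarrow>
      (\<And>i. i \<in> S \<Longrightarrow> \<rho> \<le> norm (p i - z)) \<Longrightarrow> (\<Sum>i\<in>S. ambiguity g (p i - z)) \<le> e"
proof -
  obtain E where E: "tf_envelope g E" using M1_tf_envelope[OF g] .
  have [measurable]: "E \<in> borel_measurable borel" and fin: "(\<integral>\<^sup>+v. E v \<partial>lborel) < \<infinity>"
    using E by (auto simp: tf_envelope_def)
  let ?V = "measure lborel (ball (0::real^('d + 'd)) r)"
  let ?T = "\<lambda>n::nat. \<integral>\<^sup>+v. E v * indicator {v. real n < norm v} v \<partial>lborel"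
  have V: "0 < ?V" "emeasure lborel (ball (0::real^('d + 'd)) r) = ennreal ?V"
    using emeasure_ball_bounds[OF r(1), where 'a="real^('d + 'd)"] by auto
  have "?T \<longlonglongrightarrow> (\<integral>\<^sup>+v. 0 \<partial>(lborel :: (real^('d + 'd)) measure))"
  proof (rule nn_integral_dominated_convergence[where w=E])
    show "AE v in lborel. (\<lambda>n. E v * indicator {v. real n < norm v} v) \<longlonglongrightarrow> 0"
    proof (rule AE_I2)
      fix v :: "real^('d + 'd)"
      obtain n0 :: nat where "norm v \<le> real n0" using real_arch_simple by blast
      then have "\<forall>\<^sub>F n in sequentially. E v * indicator {v. real n < norm v} v = 0"
        by (intro eventually_sequentiallyI[of n0]) (auto simp: indicator_def)
      then show "(\<lambda>n. E v * indicator {v. real n < norm v} v) \<longlonglongrightarrow> 0"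
        by (rule tendsto_eventually)
    qed
  qed (use fin in \<open>auto simp: indicator_def\<close>)
  then have lim: "?T \<longlonglongrightarrow> 0" by simp
  \<comment> \<open>The denominator \<open>real N + 1\<close> covers \<open>N = 0\<close>.\<close>
  have "(0::ennreal) < ennreal (e * ?V / (real N + 1))" using e V by simp
  then have "\<forall>\<^sub>F n in sequentially. ?T n < ennreal (e * ?V / (real N + 1))"
    by (rule order_tendstoD(2)[OF lim])
  then obtain n where n: "?T n < ennreal (e * ?V / (real N + 1))"
    by (auto simp: eventually_sequentially)
  have "(\<Sum>i\<in>S. ambiguity g (p i - z)) \<le> e"
    if "separated_family I p r N" "finite S" "S \<subseteq> I" "\<And>i. i \<in> S \<Longrightarrow> real n + 1 \<le> norm (p i - z)"
    for I :: "'i set" and p S z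
  proof -
    have "ennreal (\<Sum>i\<in>S. ambiguity g (p i - z)) * ennreal ?V \<le> of_nat N * ?T n"
      using envelope_sum_le[OF E r that(1-3), of "real n + 1" z] that(4) V by simp
    also have "\<dots> \<le> ennreal (real N) * ennreal (e * ?V / (real N + 1))"
      using n by (intro mult_mono) (auto simp: ennreal_of_nat_eq_real_of_nat)
    also have "\<dots> = ennreal (real N * (e * ?V / (real N + 1)))"
      by (rule ennreal_mult[symmetric]) (use e V in auto)
    finally have "(\<Sum>i\<in>S. ambiguity g (p i - z)) * ?V \<le> real N * (e * ?V / (real N + 1))"
      using V(1) e by (simp add: sum_nonneg flip: ennreal_mult)
    also have "\<dots> \<le> e * ?V"
      using e V by (simp add: field_simps)
    finally show ?thesis using V(1) by simp
  qed
  then show ?thesis using that[of "real n + 1"] by simp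
qed

subsection \<open>Overlaps of large balls\<close>

text \<open>The autocorrelation of the indicator of a ball, normalised to 1 on the diagonal. It
  appears because the two cutoffs in an entry of a quadratic form are averaged together over the
  centre.\<close>

definition overlap :: "real \<Rightarrow> 'a::euclidean_space \<Rightarrow> 'a \<Rightarrow> real" where
  "overlap R p q = measure lborel (ball p R \<inter> ball q R) / measure lborel (ball (0::'a) R)"

lemma measure_ball_translate: "measure lborel (ball (p::'a::euclidean_space) R) = measure lborel (ball (0::'a) R)"
proof (cases "0 \<le> R")
  case False
  then have "ball p R = {}" "ball (0::'a) R = {}" by auto
  then show ?thesis by (simp only:)
qed (simp add: content_ball)

lemma overlap_bounds:
  assumes "0 < R"
  shows "0 \<le> overlap R p q" "overlap R p q \<le> 1"
proof -
  have "measure lborel (ball p R \<inter> ball q R) \<le> measure lborel (ball p R)"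
    by (intro measure_mono_fmeasurable) (auto simp: fmeasurable_def emeasure_ball assms less_imp_le)
  then show "overlap R p q \<le> 1"
    using emeasure_ball_bounds(2)[OF assms, where 'a='a] by (simp add: overlap_def measure_ball_translate[of p])
qed (simp add: overlap_def)

lemma overlap_commute: "overlap R p q = overlap R q p"
  by (simp add: overlap_def Int_commute)

lemma overlap_self: "0 < R \<Longrightarrow> overlap R p p = 1"
  using emeasure_ball_bounds(2)[of R, where 'a='a] by (simp add: overlap_def measure_ball_translate[of p])

text \<open>Both balls contain the ball about \<open>p\<close> of radius \<open>R - D\<close>, whose
  share of the volume is \<open>(1 - D / R) ^ DIM('a)\<close>.\<close>

lemma overlap_near_one:
  assumes "0 < e" "0 \<le> D"
  obtains R0 where "0 < R0" "\<And>R (p::'a::euclidean_space) q. R0 \<le> R \<Longrightarrow> dist p q \<le> D \<Longrightarrow> 1 - overlap R p q \<le> e"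
proof -
  have "((\<lambda>R::real. (1 - D / R) ^ DIM('a)) \<longlongrightarrow> (1 - 0) ^ DIM('a)) at_top"
    by (intro tendsto_intros tendsto_divide_0[OF tendsto_const] filterlim_at_top_imp_at_infinity filterlim_ident)
  then have "((\<lambda>R::real. (1 - D / R) ^ DIM('a)) \<longlongrightarrow> 1) at_top" by simp
  then have "\<forall>\<^sub>F R::real in at_top. 1 - e < (1 - D / R) ^ DIM('a)"
    using assms(1) by (intro order_tendstoD(1)) auto
  then obtain R1 :: real where R1: "\<And>R. R1 \<le> R \<Longrightarrow> 1 - e < (1 - D / R) ^ DIM('a)"
    by (auto simp: eventually_at_top_linorder)
  have "1 - overlap R p q \<le> e" if R: "max R1 (D + 1) \<le> R" and d: "dist p q \<le> D" for R and p q :: 'a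
  proof -
    have R': "0 < R" "D < R" "R1 \<le> R" using R assms by auto
    have sub: "ball p (R - D) \<subseteq> ball p R \<inter> ball q R"
    proof
      fix x assume "x \<in> ball p (R - D)"
      then show "x \<in> ball p R \<inter> ball q R"
        using d assms(2) dist_triangle[of q x p] by (auto simp: dist_commute)
    qed
    have "measure lborel (ball p (R - D)) \<le> measure lborel (ball p R \<inter> ball q R)"
      by (intro measure_mono_fmeasurable sub fmeasurable_Int_fmeasurable)
        (auto simp: fmeasurable_def emeasure_ball R' less_imp_le)
    then have "measure lborel (ball (0::'a) (R - D)) / measure lborel (ball (0::'a) R) \<le> overlap R p q"
      unfolding overlap_def measure_ball_translate[of p] by (intro divide_right_mono) auto
    moreover have "measure lborel (ball (0::'a) (R - D)) / measure lborel (ball (0::'a) R) = ((R - D) / R) ^ DIM('a)"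
    proof -
      have "unit_ball_vol (real DIM('a)) \<noteq> 0"
        using unit_ball_vol_pos[of "real DIM('a)", OF of_nat_0_le_iff] by (metis less_irrefl)
      then show ?thesis using R' by (simp add: content_ball power_divide)
    qed
    moreover have "(R - D) / R = 1 - D / R" using R' by (simp add: field_simps)
    ultimately show ?thesis using R1[OF R'(3)] by simp
  qed
  then show ?thesis using that[of "max R1 (D + 1)"] assms(2) by auto
qed

text \<open>For nodes within \<open>\<rho>\<close> of \<open>z\<close> the overlap defect is small
  once the radius is large; beyond \<open>\<rho>\<close> the ambiguity sums have small tails. Each
  part contributes at most \<open>e / 2\<close>.\<close>

lemma ambiguity_overlap_sum:
  fixes g :: "real^'d \<Rightarrow> complex"
  assumes g: "g \<in> M1" and r: "0 < r" "r \<le> 1" and e: "0 < e"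
  obtains R0 where "0 < R0"
    "\<And>(I::'i set) p S z R. R0 \<le> R \<Longrightarrow> separated_family I p r N \<Longrightarrow> finite S \<Longrightarrow> S \<subseteq> I \<Longrightarrow>
      (\<Sum>i\<in>S. ambiguity g (p i - z) * (1 - overlap R (p i) z)) \<le> e"
proof -
  obtain K where K: "0 < K" "\<And>(I::'i set) p S z. separated_family I p r N \<Longrightarrow> finite S \<Longrightarrow> S \<subseteq> I \<Longrightarrow>
      (\<Sum>i\<in>S. ambiguity g (p i - z)) \<le> K"
    using ambiguity_sum_bounded[OF g r] by metis
  obtain \<rho> where \<rho>: "0 < \<rho>" "\<And>(I::'i set) p S z. separated_family I p r N \<Longrightarrow> finite S \<Longrightarrow> S \<subseteq> I \<Longrightarrow>
      (\<And>i. i \<in> S \<Longrightarrow> \<rho> \<le> norm (p i - z)) \<Longrightarrow> (\<Sum>i\<in>S. ambiguity g (p i - z)) \<le> e / 2"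
    using ambiguity_sum_tail[OF g r, of "e / 2"] e by (metis half_gt_zero)
  obtain R0 where R0: "0 < R0" "\<And>R (p::real^('d + 'd)) q. R0 \<le> R \<Longrightarrow> dist p q \<le> \<rho> \<Longrightarrow> 1 - overlap R p q \<le> e / (2 * K)"
  proof (rule overlap_near_one[of "e / (2 * K)" \<rho>, where 'a="real^('d + 'd)"])
    show "0 < e / (2 * K)" "0 \<le> \<rho>" using e K(1) \<rho>(1) by auto
  qed blast
  have "(\<Sum>i\<in>S. ambiguity g (p i - z) * (1 - overlap R (p i) z)) \<le> e"
    if R: "R0 \<le> R" and sep: "separated_family I p r N" and S: "finite S" "S \<subseteq> I" for I :: "'i set" and p S z R
  proof -
    have Rpos: "0 < R" using R R0(1) by simp
    let ?A = "{i \<in> S. norm (p i - z) < \<rho>}" and ?B = "{i \<in> S. \<rho> \<le> norm (p i - z)}"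
    have "(\<Sum>i\<in>S. ambiguity g (p i - z) * (1 - overlap R (p i) z))
        = (\<Sum>i\<in>?A. ambiguity g (p i - z) * (1 - overlap R (p i) z)) + (\<Sum>i\<in>?B. ambiguity g (p i - z) * (1 - overlap R (p i) z))"
      using S(1) by (subst sum.union_disjoint[symmetric]) (auto intro!: sum.cong)
    also have "(\<Sum>i\<in>?A. ambiguity g (p i - z) * (1 - overlap R (p i) z)) \<le> (\<Sum>i\<in>?A. ambiguity g (p i - z) * (e / (2 * K)))"
      using R0(2)[OF R] by (intro sum_mono mult_left_mono) (auto simp: dist_norm)
    also have "\<dots> \<le> K * (e / (2 * K))"
      unfolding sum_distrib_right[symmetric] using e K
      by (intro mult_right_mono K(2)[OF sep]) (use S in auto)
    also have "\<dots> = e / 2" using K(1) by simp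
    also have "(\<Sum>i\<in>?B. ambiguity g (p i - z) * (1 - overlap R (p i) z)) \<le> (\<Sum>i\<in>?B. ambiguity g (p i - z) * 1)"
      using overlap_bounds[OF Rpos] by (intro sum_mono mult_left_mono) auto
    also have "\<dots> \<le> e / 2"
      unfolding mult_1_right by (rule \<rho>(2)[OF sep]) (use S in auto)
    finally show ?thesis by simp
  qed
  then show ?thesis using that[OF R0(1)] by blast
qed

subsection \<open>Schur tests\<close>

text \<open>The symmetric Schur test: \<open>cmod (c i) * cmod (c j)\<close> is split into halves of
  squares, one summed along rows and the other along columns.\<close>

lemma Schur_form_bound:
  fixes c :: "'i \<Rightarrow> complex"
  assumes S: "finite S" and a: "\<And>i j. i \<in> S \<Longrightarrow> j \<in> S \<Longrightarrow> cmod (a i j) \<le> w i j"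
    and row: "\<And>i. i \<in> S \<Longrightarrow> (\<Sum>j\<in>S. w i j) \<le> K"
    and col: "\<And>j. j \<in> S \<Longrightarrow> (\<Sum>i\<in>S. w i j) \<le> K"
  shows "cmod (\<Sum>i\<in>S. \<Sum>j\<in>S. c i * cnj (c j) * a i j) \<le> K * (\<Sum>i\<in>S. (cmod (c i))\<^sup>2)"
proof -
  have w: "0 \<le> w i j" if "i \<in> S" "j \<in> S" for i j using a[OF that] norm_ge_zero order_trans by blast
  have "cmod (\<Sum>i\<in>S. \<Sum>j\<in>S. c i * cnj (c j) * a i j) \<le> (\<Sum>i\<in>S. \<Sum>j\<in>S. cmod (c i * cnj (c j) * a i j))"
    by (intro order_trans[OF norm_sum] sum_mono norm_sum)
  also have "\<dots> \<le> (\<Sum>i\<in>S. \<Sum>j\<in>S. w i j * ((cmod (c i))\<^sup>2 / 2) + w i j * ((cmod (c j))\<^sup>2 / 2))"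
  proof (intro sum_mono)
    fix i j assume ij: "i \<in> S" "j \<in> S"
    have "cmod (c i * cnj (c j) * a i j) = (cmod (c i) * cmod (c j)) * cmod (a i j)" by (simp add: norm_mult)
    also have "\<dots> \<le> ((cmod (c i))\<^sup>2 / 2 + (cmod (c j))\<^sup>2 / 2) * w i j"
      using sum_squares_bound[of "cmod (c i)" "cmod (c j)"] by (intro mult_mono a ij) auto
    finally show "cmod (c i * cnj (c j) * a i j) \<le> w i j * ((cmod (c i))\<^sup>2 / 2) + w i j * ((cmod (c j))\<^sup>2 / 2)"
      by (simp add: algebra_simps)
  qed
  also have "\<dots> = (\<Sum>i\<in>S. (\<Sum>j\<in>S. w i j) * ((cmod (c i))\<^sup>2 / 2)) + (\<Sum>j\<in>S. (\<Sum>i\<in>S. w i j) * ((cmod (c j))\<^sup>2 / 2))"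
    unfolding sum.distrib sum_distrib_right by (subst (2) sum.swap) simp
  also have "\<dots> \<le> (\<Sum>i\<in>S. K * ((cmod (c i))\<^sup>2 / 2)) + (\<Sum>j\<in>S. K * ((cmod (c j))\<^sup>2 / 2))"
    by (intro add_mono sum_mono mult_right_mono row col) auto
  also have "\<dots> = K * (\<Sum>i\<in>S. (cmod (c i))\<^sup>2)"
    unfolding sum.distrib[symmetric] sum_distrib_left by (intro sum.cong) (auto simp: field_simps)
  finally show ?thesis .
qed

lemma weighted_sum_square_le:
  fixes c :: "'i \<Rightarrow> complex"
  assumes a: "\<And>i. i \<in> S \<Longrightarrow> cmod (a i) \<le> w i"
  shows "(cmod (\<Sum>i\<in>S. c i * a i))\<^sup>2 \<le> (\<Sum>i\<in>S. w i) * (\<Sum>i\<in>S. w i * (cmod (c i))\<^sup>2)"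
proof -
  have w: "0 \<le> w i" if "i \<in> S" for i using a[OF that] norm_ge_zero order_trans by blast
  have "cmod (\<Sum>i\<in>S. c i * a i) \<le> (\<Sum>i\<in>S. sqrt (w i) * (sqrt (w i) * cmod (c i)))"
  proof (rule order_trans[OF norm_sum], rule sum_mono)
    fix i assume i: "i \<in> S"
    have "cmod (c i * a i) \<le> cmod (c i) * w i" unfolding norm_mult by (intro mult_left_mono a i) simp
    also have "\<dots> = sqrt (w i) * (sqrt (w i) * cmod (c i))" using w[OF i] by simp
    finally show "cmod (c i * a i) \<le> sqrt (w i) * (sqrt (w i) * cmod (c i))" .
  qed
  then have "(cmod (\<Sum>i\<in>S. c i * a i))\<^sup>2 \<le> (\<Sum>i\<in>S. sqrt (w i) * (sqrt (w i) * cmod (c i)))\<^sup>2"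
    by (intro power_mono) auto
  also have "\<dots> \<le> (\<Sum>i\<in>S. (sqrt (w i))\<^sup>2) * (\<Sum>i\<in>S. (sqrt (w i) * cmod (c i))\<^sup>2)"
    by (rule Cauchy_Schwarz_ineq_sum)
  also have "\<dots> = (\<Sum>i\<in>S. w i) * (\<Sum>i\<in>S. w i * (cmod (c i))\<^sup>2)"
    using w by (simp add: power_mult_distrib)
  finally show ?thesis .
qed

text \<open>The product \<open>K1 * K2\<close> is small as soon as one factor is, so a tail estimate
  in one index alone controls the far nodes in \<open>local_frame_bound\<close>.\<close>

lemma Schur_map_bound:
  fixes c :: "'i \<Rightarrow> complex"
  assumes a: "\<And>l i. l \<in> L \<Longrightarrow> i \<in> S \<Longrightarrow> cmod (a l i) \<le> w l i"
    and row: "\<And>l. l \<in> L \<Longrightarrow> (\<Sum>i\<in>S. w l i) \<le> K1" and col: "\<And>i. i \<in> S \<Longrightarrow> (\<Sum>l\<in>L. w l i) \<le> K2"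
    and K1: "0 \<le> K1"
  shows "(\<Sum>l\<in>L. (cmod (\<Sum>i\<in>S. c i * a l i))\<^sup>2) \<le> K1 * K2 * (\<Sum>i\<in>S. (cmod (c i))\<^sup>2)"
proof -
  have w: "0 \<le> w l i" if "l \<in> L" "i \<in> S" for l i using a[OF that] norm_ge_zero order_trans by blast
  have "(\<Sum>l\<in>L. (cmod (\<Sum>i\<in>S. c i * a l i))\<^sup>2) \<le> (\<Sum>l\<in>L. K1 * (\<Sum>i\<in>S. w l i * (cmod (c i))\<^sup>2))"
  proof (rule sum_mono)
    fix l assume l: "l \<in> L"
    have "(cmod (\<Sum>i\<in>S. c i * a l i))\<^sup>2 \<le> (\<Sum>i\<in>S. w l i) * (\<Sum>i\<in>S. w l i * (cmod (c i))\<^sup>2)"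
      by (rule weighted_sum_square_le) (rule a[OF l])
    also have "\<dots> \<le> K1 * (\<Sum>i\<in>S. w l i * (cmod (c i))\<^sup>2)"
      by (intro mult_right_mono row l sum_nonneg mult_nonneg_nonneg w) auto
    finally show "(cmod (\<Sum>i\<in>S. c i * a l i))\<^sup>2 \<le> K1 * (\<Sum>i\<in>S. w l i * (cmod (c i))\<^sup>2)" .
  qed
  also have "\<dots> = K1 * (\<Sum>i\<in>S. (\<Sum>l\<in>L. w l i) * (cmod (c i))\<^sup>2)"
    unfolding sum_distrib_left[symmetric] sum_distrib_right by (subst sum.swap) simp
  also have "\<dots> \<le> K1 * (\<Sum>i\<in>S. K2 * (cmod (c i))\<^sup>2)"
    by (intro mult_left_mono sum_mono mult_right_mono col K1) auto
  finally show ?thesis by (simp add: sum_distrib_left mult.assoc)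
qed

lemma L2_Schur_synthesis:
  fixes c :: "'i \<Rightarrow> complex"
  assumes S: "finite S" and u: "\<And>i. i \<in> S \<Longrightarrow> u i \<in> L2"
    and K: "\<And>i. i \<in> S \<Longrightarrow> (\<Sum>j\<in>S. cmod (L2_inner (u j) (u i))) \<le> K"
  shows "(L2_norm (\<lambda>t. \<Sum>i\<in>S. c i * u i t))\<^sup>2 \<le> K * (\<Sum>i\<in>S. (cmod (c i))\<^sup>2)"
proof -
  have K': "(\<Sum>j\<in>S. cmod (L2_inner (u i) (u j))) \<le> K" if "i \<in> S" for i
    using K[OF that] by (simp add: cmod_L2_inner_commute[of "u i"])
  have "(L2_norm (\<lambda>t. \<Sum>i\<in>S. c i * u i t))\<^sup>2 = cmod (complex_of_real ((L2_norm (\<lambda>t. \<Sum>i\<in>S. c i * u i t))\<^sup>2))"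
    by (simp add: norm_power)
  also have "\<dots> = cmod (\<Sum>i\<in>S. \<Sum>j\<in>S. c i * cnj (c j) * L2_inner (u i) (u j))"
    by (simp only: L2_norm_square_lincomb[OF u])
  also have "\<dots> \<le> K * (\<Sum>i\<in>S. (cmod (c i))\<^sup>2)"
    by (rule Schur_form_bound[OF S order_refl]) (use K K' in auto)
  finally show ?thesis .
qed

text \<open>Analysis is adjoint to synthesis: the synthesis bound is tested on the coefficients of
  \<open>f\<close> itself, and one factor of their squared norm cancels.\<close>

lemma L2_Bessel_dual:
  fixes u :: "'i \<Rightarrow> real^'d \<Rightarrow> complex"
  assumes f: "f \<in> L2" and u: "\<And>i. i \<in> S \<Longrightarrow> u i \<in> L2"
    and K0: "0 \<le> K"
    and K: "\<And>c. (L2_norm (\<lambda>t. \<Sum>i\<in>S. c i * u i t))\<^sup>2 \<le> K * (\<Sum>i\<in>S. (cmod (c i))\<^sup>2)"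
  shows "(\<Sum>i\<in>S. (cmod (L2_inner f (u i)))\<^sup>2) \<le> K * (L2_norm f)\<^sup>2"
proof -
  define c where "c i = L2_inner f (u i)" for i
  define s where "s = (\<Sum>i\<in>S. (cmod (c i))\<^sup>2)"
  have s0: "0 \<le> s" by (simp add: s_def sum_nonneg)
  have "L2_inner f (\<lambda>t. \<Sum>i\<in>S. c i * u i t) = (\<Sum>i\<in>S. cnj (c i) * c i)"
    by (simp add: L2_inner_sum_right[OF u f] c_def)
  also have "\<dots> = complex_of_real s"
    unfolding s_def of_real_sum by (intro sum.cong) (auto simp: complex_norm_square mult.commute simp del: of_real_power)
  finally have "s = cmod (L2_inner f (\<lambda>t. \<Sum>i\<in>S. c i * u i t))" using s0 by simp
  also have "\<dots> \<le> L2_norm f * L2_norm (\<lambda>t. \<Sum>i\<in>S. c i * u i t)"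
    by (intro L2_Cauchy_Schwarz f L2_lincomb u)
  finally have "s\<^sup>2 \<le> (L2_norm f)\<^sup>2 * (L2_norm (\<lambda>t. \<Sum>i\<in>S. c i * u i t))\<^sup>2"
    using s0 by (simp add: power_mono flip: power_mult_distrib)
  also have "\<dots> \<le> (L2_norm f)\<^sup>2 * (K * s)"
    unfolding s_def by (intro mult_left_mono K) simp
  finally have "s * s \<le> (K * (L2_norm f)\<^sup>2) * s" by (simp add: power2_eq_square mult_ac)
  show ?thesis
  proof (cases "s = 0")
    case True
    then show ?thesis using K0 by (simp add: s_def c_def)
  next
    case False
    then show ?thesis
      using \<open>s * s \<le> (K * (L2_norm f)\<^sup>2) * s\<close> s0 by (simp add: s_def c_def)
  qed
qed

subsection \<open>Averaging over large balls\<close>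

text \<open>Cutoff of the node \<open>p\<close> to the ball centred at \<open>y\<close>, written
  with the ball around \<open>p\<close> because the integration variable is
  \<open>y\<close>.\<close>

definition ball_cut :: "real \<Rightarrow> 'a::euclidean_space \<Rightarrow> 'a \<Rightarrow> real" where
  "ball_cut R y p = indicator (ball p R) y"

lemma ball_cut_simps: "ball_cut R y p = (if dist p y < R then 1 else 0)"
  by (simp add: ball_cut_def indicator_def)

lemma ball_cut_integrable:
  fixes p q :: "'a::euclidean_space"
  assumes "0 < R"
  shows "integrable lborel (\<lambda>y. ball_cut R y p * ball_cut R y q)"
    and "(\<integral>y. ball_cut R y p * ball_cut R y q \<partial>lborel) = measure lborel (ball (0::'a) R) * overlap R p q"
proof -
  have eq: "ball_cut R y p * ball_cut R y q = indicator (ball p R \<inter> ball q R) y" for y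
    by (simp add: ball_cut_def indicator_inter_arith)
  have fin: "emeasure lborel (ball p R \<inter> ball q R) < \<infinity>"
    by (rule order_le_less_trans[OF emeasure_mono[of _ "ball p R"]])
      (auto simp: emeasure_ball assms less_imp_le)
  show "integrable lborel (\<lambda>y. ball_cut R y p * ball_cut R y q)"
    unfolding eq by (rule integrable_real_indicator) (use fin in auto)
  show "(\<integral>y. ball_cut R y p * ball_cut R y q \<partial>lborel) = measure lborel (ball (0::'a) R) * overlap R p q"
    unfolding eq using emeasure_ball_bounds(2)[OF assms, where 'a='a] by (simp add: overlap_def)
qed

lemma ball_cut_idem: "ball_cut R y p * ball_cut R y p = ball_cut R y p"
  by (simp add: ball_cut_simps)

lemma ball_cut_integrable1:
  fixes p :: "'a::euclidean_space"
  assumes "0 < R"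
  shows "integrable lborel (\<lambda>y. ball_cut R y p)"
    and "(\<integral>y. ball_cut R y p \<partial>lborel) = measure lborel (ball (0::'a) R)"
  using ball_cut_integrable[OF assms, of p p] overlap_self[OF assms, of p] by (auto simp: ball_cut_idem)

lemma ball_cut_form_integral:
  fixes a :: "'i \<Rightarrow> 'i \<Rightarrow> complex" and q :: "'i \<Rightarrow> 'a::euclidean_space"
  assumes R: "0 < R"
    and eq: "\<And>y. complex_of_real (X y) = (\<Sum>i\<in>S. \<Sum>j\<in>S. complex_of_real (ball_cut R y (q i) * ball_cut R y (q j)) * a i j)"
  shows "integrable lborel X"
    and "complex_of_real (\<integral>y. X y \<partial>lborel)
      = (\<Sum>i\<in>S. \<Sum>j\<in>S. complex_of_real (measure lborel (ball (0::'a) R) * overlap R (q i) (q j)) * a i j)"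
proof -
  have 1: "integrable lborel (\<lambda>y. complex_of_real (ball_cut R y (q i) * ball_cut R y (q j)) * a i j)" for i j
    by (intro integrable_mult_left integrable_of_real ball_cut_integrable R)
  have "integrable lborel (\<lambda>y. complex_of_real (X y))"
    unfolding eq by (intro Bochner_Integration.integrable_sum 1)
  then show "integrable lborel X" by (simp only: complex_of_real_integrable_eq)
  have "complex_of_real (\<integral>y. X y \<partial>lborel) = (\<integral>y. complex_of_real (X y) \<partial>lborel)"
    by (rule integral_complex_of_real[symmetric])
  also have "\<dots> = (\<Sum>i\<in>S. \<Sum>j\<in>S. \<integral>y. complex_of_real (ball_cut R y (q i) * ball_cut R y (q j)) * a i j \<partial>lborel)"
    unfolding eq by (simp only: Bochner_Integration.integral_sum Bochner_Integration.integrable_sum 1)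
  also have "\<dots> = (\<Sum>i\<in>S. \<Sum>j\<in>S. complex_of_real (measure lborel (ball (0::'a) R) * overlap R (q i) (q j)) * a i j)"
    by (simp only: integral_mult_left_zero integral_complex_of_real ball_cut_integrable(2)[OF R])
  finally show "complex_of_real (\<integral>y. X y \<partial>lborel)
      = (\<Sum>i\<in>S. \<Sum>j\<in>S. complex_of_real (measure lborel (ball (0::'a) R) * overlap R (q i) (q j)) * a i j)" .
qed

text \<open>
  The localization formula: restricting the coefficients to a ball of radius \<open>R\<close> and averaging
  over its centre multiplies the Gram matrix entrywise by the overlap of the two balls.
\<close>

lemma localization_formula:
  fixes u :: "'i \<Rightarrow> real^'d \<Rightarrow> complex" and q :: "'i \<Rightarrow> 'a::euclidean_space" and c :: "'i \<Rightarrow> complex"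
  assumes R: "0 < R" and S: "finite S" and u: "\<And>i. i \<in> S \<Longrightarrow> u i \<in> L2"
    and \<delta>: "\<And>i. i \<in> S \<Longrightarrow> (\<Sum>j\<in>S. cmod (L2_inner (u j) (u i)) * (1 - overlap R (q j) (q i))) \<le> \<delta>"
  defines "F \<equiv> \<lambda>y. (L2_norm (\<lambda>t. \<Sum>i\<in>S. (complex_of_real (ball_cut R y (q i)) * c i) * u i t))\<^sup>2"
    and "V \<equiv> measure lborel (ball (0::'a) R)"
  shows "integrable lborel F"
    and "\<bar>V * (L2_norm (\<lambda>t. \<Sum>i\<in>S. c i * u i t))\<^sup>2 - (\<integral>y. F y \<partial>lborel)\<bar>
      \<le> V * \<delta> * (\<Sum>i\<in>S. (cmod (c i))\<^sup>2)"
proof -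
  have V: "0 < V" unfolding V_def by (rule emeasure_ball_bounds(2)[OF R])
  have eq: "complex_of_real (F y) = (\<Sum>i\<in>S. \<Sum>j\<in>S. complex_of_real (ball_cut R y (q i) * ball_cut R y (q j)) *
      (c i * cnj (c j) * L2_inner (u i) (u j)))" for y
    unfolding F_def
    by (subst L2_norm_square_lincomb[OF u, where c="\<lambda>i. complex_of_real (ball_cut R y (q i)) * c i"])
      (auto intro!: sum.cong)
  show "integrable lborel F" by (rule ball_cut_form_integral(1)[OF R eq])
  have "complex_of_real (V * (L2_norm (\<lambda>t. \<Sum>i\<in>S. c i * u i t))\<^sup>2 - (\<integral>y. F y \<partial>lborel))
      = complex_of_real V * (\<Sum>i\<in>S. \<Sum>j\<in>S. c i * cnj (c j) * L2_inner (u i) (u j))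
        - (\<Sum>i\<in>S. \<Sum>j\<in>S. complex_of_real (V * overlap R (q i) (q j)) * (c i * cnj (c j) * L2_inner (u i) (u j)))"
    by (simp only: of_real_diff of_real_mult[of V] L2_norm_square_lincomb[OF u] ball_cut_form_integral(2)[OF R eq, folded V_def])
  \<comment> \<open>The two forms are merged so that the Schur test applies to Gram entries weighted
    by the overlap defect.\<close>
  also have "\<dots> = complex_of_real V * (\<Sum>i\<in>S. \<Sum>j\<in>S. c i * cnj (c j) *
      (complex_of_real (1 - overlap R (q i) (q j)) * L2_inner (u i) (u j)))"
    unfolding sum_distrib_left sum_subtractf[symmetric]
    by (intro sum.cong refl) (simp add: algebra_simps)
  finally have of_real_eq: "complex_of_real (V * (L2_norm (\<lambda>t. \<Sum>i\<in>S. c i * u i t))\<^sup>2 - (\<integral>y. F y \<partial>lborel))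
      = complex_of_real V * (\<Sum>i\<in>S. \<Sum>j\<in>S. c i * cnj (c j) *
      (complex_of_real (1 - overlap R (q i) (q j)) * L2_inner (u i) (u j)))" .
  have "\<bar>V * (L2_norm (\<lambda>t. \<Sum>i\<in>S. c i * u i t))\<^sup>2 - (\<integral>y. F y \<partial>lborel)\<bar>
      = V * cmod (\<Sum>i\<in>S. \<Sum>j\<in>S. c i * cnj (c j) * (complex_of_real (1 - overlap R (q i) (q j)) * L2_inner (u i) (u j)))"
    using arg_cong[OF of_real_eq, of cmod] V unfolding norm_mult norm_of_real by simp
  also have "\<dots> \<le> V * (\<delta> * (\<Sum>i\<in>S. (cmod (c i))\<^sup>2))"
  proof (intro mult_left_mono Schur_form_bound[OF S order_refl])
    have 2: "cmod (complex_of_real (1 - overlap R (q i) (q j)) * L2_inner (u i) (u j))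
        = cmod (L2_inner (u i) (u j)) * (1 - overlap R (q i) (q j))" for i j
    proof -
      have "\<bar>1 - overlap R (q i) (q j)\<bar> = 1 - overlap R (q i) (q j)"
        using overlap_bounds[OF R, of "q i" "q j"] by simp
      then show ?thesis by (simp only: norm_mult norm_of_real mult.commute)
    qed
    have 1: "cmod (complex_of_real (1 - overlap R (q i) (q j)) * L2_inner (u i) (u j))
        = cmod (L2_inner (u j) (u i)) * (1 - overlap R (q j) (q i))" for i j
      using 2[of i j] by (simp only: overlap_commute[of R "q j" "q i"] cmod_L2_inner_commute[of "u j" "u i"])
    show "(\<Sum>j\<in>S. cmod (complex_of_real (1 - overlap R (q i) (q j)) * L2_inner (u i) (u j))) \<le> \<delta>" if "i \<in> S" for i
      unfolding 1 by (rule \<delta>[OF that])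
    show "(\<Sum>i\<in>S. cmod (complex_of_real (1 - overlap R (q i) (q j)) * L2_inner (u i) (u j))) \<le> \<delta>" if "j \<in> S" for j
      unfolding 2 by (rule \<delta>[OF that])
  qed (use V in simp)
  finally show "\<bar>V * (L2_norm (\<lambda>t. \<Sum>i\<in>S. c i * u i t))\<^sup>2 - (\<integral>y. F y \<partial>lborel)\<bar>
      \<le> V * \<delta> * (\<Sum>i\<in>S. (cmod (c i))\<^sup>2)"
    by (simp add: mult.assoc)
qed

lemma ball_cut_square_sum_integral:
  fixes q :: "'i \<Rightarrow> 'a::euclidean_space" and c :: "'i \<Rightarrow> complex"
  assumes R: "0 < R"
  shows "integrable lborel (\<lambda>y. \<Sum>i\<in>S. (cmod (complex_of_real (ball_cut R y (q i)) * c i))\<^sup>2)"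
    and "(\<integral>y. (\<Sum>i\<in>S. (cmod (complex_of_real (ball_cut R y (q i)) * c i))\<^sup>2) \<partial>lborel)
      = measure lborel (ball (0::'a) R) * (\<Sum>i\<in>S. (cmod (c i))\<^sup>2)"
proof -
  have eq: "(cmod (complex_of_real (ball_cut R y (q i)) * c i))\<^sup>2 = ball_cut R y (q i) * (cmod (c i))\<^sup>2" for y i
    by (simp add: ball_cut_simps)
  have 1: "integrable lborel (\<lambda>y. ball_cut R y (q i) * (cmod (c i))\<^sup>2)" for i
    by (intro integrable_mult_left ball_cut_integrable1 R)
  show "integrable lborel (\<lambda>y. \<Sum>i\<in>S. (cmod (complex_of_real (ball_cut R y (q i)) * c i))\<^sup>2)"
    unfolding eq by (intro Bochner_Integration.integrable_sum 1)
  show "(\<integral>y. (\<Sum>i\<in>S. (cmod (complex_of_real (ball_cut R y (q i)) * c i))\<^sup>2) \<partial>lborel)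
      = measure lborel (ball (0::'a) R) * (\<Sum>i\<in>S. (cmod (c i))\<^sup>2)"
    unfolding eq
    by (simp only: Bochner_Integration.integral_sum 1 integral_mult_left_zero ball_cut_integrable1(2)[OF R] sum_distrib_left)
qed

text \<open>The cut at \<open>q i\<close> is compared with the cut at the fixed point
  \<open>z\<close>, which factors out of the sum. The squared difference of the two cuts has
  integral \<open>2 * V * (1 - overlap R (q i) z)\<close>, and weighted Cauchy-Schwarz turns this
  into the second term. The intended \<open>z\<close> is a perturbed node and \<open>b\<close> its
  row of the cross Gram matrix, which decays away from \<open>z\<close>.\<close>

lemma ball_cut_inner_average:
  fixes q :: "'i \<Rightarrow> 'a::euclidean_space" and c b :: "'i \<Rightarrow> complex"
  assumes R: "0 < R" and S: "finite S" and K: "(\<Sum>i\<in>S. cmod (b i)) \<le> K"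
  defines "V \<equiv> measure lborel (ball (0::'a) R)"
  defines "X \<equiv> \<lambda>y. (cmod (\<Sum>i\<in>S. (complex_of_real (ball_cut R y (q i)) * c i) * b i))\<^sup>2"
  shows "integrable lborel X"
    and "(\<integral>y. X y \<partial>lborel) \<le> 2 * V * (cmod (\<Sum>i\<in>S. c i * b i))\<^sup>2
      + 4 * V * K * (\<Sum>i\<in>S. cmod (b i) * (1 - overlap R (q i) z) * (cmod (c i))\<^sup>2)"
proof -
  have eq: "complex_of_real (X y) = (\<Sum>i\<in>S. \<Sum>j\<in>S. complex_of_real (ball_cut R y (q i) * ball_cut R y (q j)) *
      ((c i * b i) * cnj (c j * b j)))" for y
    unfolding X_def complex_norm_square cnj_sum sum_product by (intro sum.cong refl) (simp add: mult_ac)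
  show intX: "integrable lborel X" by (rule ball_cut_form_integral(1)[OF R eq])
  let ?d = "\<lambda>y i. ball_cut R y (q i) - ball_cut R y z"
  \<comment> \<open>The square of \<open>?d y i\<close> is kept expanded into products of two
    cutoffs, whose integrals are overlaps.\<close>
  let ?Y = "\<lambda>y. 2 * (ball_cut R y z * (cmod (\<Sum>i\<in>S. c i * b i))\<^sup>2)
      + 2 * (K * (\<Sum>i\<in>S. (ball_cut R y (q i) * ball_cut R y (q i) + ball_cut R y z * ball_cut R y z - 2 * (ball_cut R y (q i) * ball_cut R y z)) * (cmod (b i) * (cmod (c i))\<^sup>2)))"
  have le: "X y \<le> ?Y y" for y
  proof -
    have "(\<Sum>i\<in>S. (complex_of_real (ball_cut R y (q i)) * c i) * b i)
        = complex_of_real (ball_cut R y z) * (\<Sum>i\<in>S. c i * b i) + (\<Sum>i\<in>S. (complex_of_real (?d y i) * c i) * b i)"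
      unfolding sum_distrib_left sum.distrib[symmetric] by (intro sum.cong refl) (simp add: algebra_simps)
    then have "X y \<le> 2 * (cmod (complex_of_real (ball_cut R y z) * (\<Sum>i\<in>S. c i * b i)))\<^sup>2
        + 2 * (cmod (\<Sum>i\<in>S. (complex_of_real (?d y i) * c i) * b i))\<^sup>2"
      unfolding X_def by (simp only: cmod_add_square_le)
    also have "(cmod (complex_of_real (ball_cut R y z) * (\<Sum>i\<in>S. c i * b i)))\<^sup>2 = ball_cut R y z * (cmod (\<Sum>i\<in>S. c i * b i))\<^sup>2"
      by (simp add: ball_cut_simps)
    also have "(cmod (\<Sum>i\<in>S. (complex_of_real (?d y i) * c i) * b i))\<^sup>2
        \<le> (\<Sum>i\<in>S. cmod (b i)) * (\<Sum>i\<in>S. cmod (b i) * (cmod (complex_of_real (?d y i) * c i))\<^sup>2)"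
      by (rule weighted_sum_square_le) simp
    also have "\<dots> \<le> K * (\<Sum>i\<in>S. cmod (b i) * (cmod (complex_of_real (?d y i) * c i))\<^sup>2)"
      by (intro mult_right_mono K sum_nonneg) auto
    also have "(\<Sum>i\<in>S. cmod (b i) * (cmod (complex_of_real (?d y i) * c i))\<^sup>2)
        = (\<Sum>i\<in>S. (ball_cut R y (q i) * ball_cut R y (q i) + ball_cut R y z * ball_cut R y z - 2 * (ball_cut R y (q i) * ball_cut R y z)) * (cmod (b i) * (cmod (c i))\<^sup>2))"
      by (intro sum.cong refl) (simp add: ball_cut_simps)
    finally show ?thesis by simp
  qed
  note ints = ball_cut_integrable1(1)[OF R] ball_cut_integrable(1)[OF R]
  have intd: "integrable lborel (\<lambda>y. (ball_cut R y (q i) * ball_cut R y (q i) + ball_cut R y z * ball_cut R y z - 2 * (ball_cut R y (q i) * ball_cut R y z)) * (cmod (b i) * (cmod (c i))\<^sup>2))" for i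
    by (intro integrable_mult_left Bochner_Integration.integrable_diff Bochner_Integration.integrable_add integrable_mult_right ints)
  have "(\<integral>y. X y \<partial>lborel) \<le> (\<integral>y. ?Y y \<partial>lborel)"
    by (intro integral_mono intX le Bochner_Integration.integrable_add integrable_mult_right integrable_mult_left
        Bochner_Integration.integrable_sum intd ints)
  also have "(\<integral>y. ?Y y \<partial>lborel) = (\<integral>y. 2 * (ball_cut R y z * (cmod (\<Sum>i\<in>S. c i * b i))\<^sup>2) \<partial>lborel)
      + (\<integral>y. 2 * (K * (\<Sum>i\<in>S. (ball_cut R y (q i) * ball_cut R y (q i) + ball_cut R y z * ball_cut R y z - 2 * (ball_cut R y (q i) * ball_cut R y z)) * (cmod (b i) * (cmod (c i))\<^sup>2))) \<partial>lborel)"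
    by (intro Bochner_Integration.integral_add integrable_mult_right integrable_mult_left
        Bochner_Integration.integrable_sum intd ints)
  also have "(\<integral>y. 2 * (ball_cut R y z * (cmod (\<Sum>i\<in>S. c i * b i))\<^sup>2) \<partial>lborel) = 2 * V * (cmod (\<Sum>i\<in>S. c i * b i))\<^sup>2"
    by (simp add: ball_cut_integrable1(2)[OF R] V_def)
  also have "(\<integral>y. 2 * (K * (\<Sum>i\<in>S. (ball_cut R y (q i) * ball_cut R y (q i) + ball_cut R y z * ball_cut R y z - 2 * (ball_cut R y (q i) * ball_cut R y z)) * (cmod (b i) * (cmod (c i))\<^sup>2))) \<partial>lborel)
      = 2 * (K * (\<Sum>i\<in>S. \<integral>y. (ball_cut R y (q i) * ball_cut R y (q i) + ball_cut R y z * ball_cut R y z - 2 * (ball_cut R y (q i) * ball_cut R y z)) * (cmod (b i) * (cmod (c i))\<^sup>2) \<partial>lborel))"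
    by (simp only: integral_mult_right_zero Bochner_Integration.integral_sum intd)
  also have "(\<lambda>i. \<integral>y. (ball_cut R y (q i) * ball_cut R y (q i) + ball_cut R y z * ball_cut R y z - 2 * (ball_cut R y (q i) * ball_cut R y z)) * (cmod (b i) * (cmod (c i))\<^sup>2) \<partial>lborel)
      = (\<lambda>i. (V + V - 2 * (V * overlap R (q i) z)) * (cmod (b i) * (cmod (c i))\<^sup>2))"
  proof
    fix i
    have "(\<integral>y. ball_cut R y (q i) * ball_cut R y (q i) + ball_cut R y z * ball_cut R y z - 2 * (ball_cut R y (q i) * ball_cut R y z) \<partial>lborel)
        = V + V - 2 * (V * overlap R (q i) z)"
      by (simp add: ints ball_cut_integrable(2)[OF R] overlap_self[OF R] V_def)
    then show "(\<integral>y. (ball_cut R y (q i) * ball_cut R y (q i) + ball_cut R y z * ball_cut R y z - 2 * (ball_cut R y (q i) * ball_cut R y z)) * (cmod (b i) * (cmod (c i))\<^sup>2) \<partial>lborel)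
        = (V + V - 2 * (V * overlap R (q i) z)) * (cmod (b i) * (cmod (c i))\<^sup>2)"
      by (simp only: integral_mult_left_zero)
  qed
  also have "2 * (K * (\<Sum>i\<in>S. (V + V - 2 * (V * overlap R (q i) z)) * (cmod (b i) * (cmod (c i))\<^sup>2)))
      = 4 * V * K * (\<Sum>i\<in>S. cmod (b i) * (1 - overlap R (q i) z) * (cmod (c i))\<^sup>2)"
    unfolding sum_distrib_left by (intro sum.cong refl) (simp add: algebra_simps)
  finally show "(\<integral>y. X y \<partial>lborel) \<le> 2 * V * (cmod (\<Sum>i\<in>S. c i * b i))\<^sup>2
      + 4 * V * K * (\<Sum>i\<in>S. cmod (b i) * (1 - overlap R (q i) z) * (cmod (c i))\<^sup>2)" .
qed

subsection \<open>Lipschitz perturbations of the identity\<close>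

text \<open>A typical example is dilation by \<open>1 + \<epsilon>\<close>, which moves remote nodes
  arbitrarily far.\<close>

definition lipschitz_perturbation :: "real \<Rightarrow> ('a::euclidean_space \<Rightarrow> 'a) \<Rightarrow> bool" where
  "lipschitz_perturbation \<epsilon> T \<longleftrightarrow> (\<forall>z w. norm ((T z - T w) - (z - w)) \<le> \<epsilon> * norm (z - w))"

lemma lipschitz_perturbationD:
  "lipschitz_perturbation \<epsilon> T \<Longrightarrow> norm ((T z - T w) - (z - w)) \<le> \<epsilon> * norm (z - w)"
  by (simp add: lipschitz_perturbation_def)

lemma lipschitz_perturbation_bounds:
  assumes T: "lipschitz_perturbation \<epsilon> T" and \<epsilon>: "\<epsilon> \<le> 1/2"
  shows "norm (z - w) \<le> 2 * norm (T z - T w)" "norm (T z - T w) \<le> 2 * norm (z - w)"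
proof -
  have "norm ((T z - T w) - (z - w)) \<le> 1/2 * norm (z - w)"
    using lipschitz_perturbationD[OF T, of z w] mult_right_mono[OF \<epsilon>, of "norm (z - w)"] by simp
  then show "norm (z - w) \<le> 2 * norm (T z - T w)" "norm (T z - T w) \<le> 2 * norm (z - w)"
    using norm_triangle_ineq3[of "T z - T w" "z - w"] by auto
qed

lemma lipschitz_perturbation_inj:
  assumes "lipschitz_perturbation \<epsilon> T" "\<epsilon> \<le> 1/2"
  shows "inj T"
proof (rule injI)
  fix z w assume "T z = T w"
  then show "z = w" using lipschitz_perturbation_bounds(1)[OF assms, of z w] by simp
qed

text \<open>\<open>T z = y\<close> is the fixed point equation of the contraction
  \<open>z \<mapsto> y - (T z - z)\<close>. Surjectivity provides a preimage \<open>y'\<close> for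
  every averaging centre \<open>y\<close>.\<close>

lemma lipschitz_perturbation_surj:
  assumes T: "lipschitz_perturbation \<epsilon> T" and \<epsilon>: "0 \<le> \<epsilon>" "\<epsilon> \<le> 1/2"
  obtains z where "T z = y"
proof -
  have "\<exists>!z\<in>UNIV. y - (T z - z) = z"
  proof (rule Banach_fix[of UNIV \<epsilon>])
    show "dist (y - (T a - a)) (y - (T b - b)) \<le> \<epsilon> * dist a b" for a b
    proof -
      have "y - (T a - a) - (y - (T b - b)) = - ((T a - T b) - (a - b))" by simp
      then have "dist (y - (T a - a)) (y - (T b - b)) = norm ((T a - T b) - (a - b))"
        by (metis dist_norm norm_minus_cancel)
      then show "dist (y - (T a - a)) (y - (T b - b)) \<le> \<epsilon> * dist a b"
        using lipschitz_perturbationD[OF T, of a b] by (simp add: dist_norm)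
    qed
  qed (use \<epsilon> in \<open>auto simp: complete_UNIV\<close>)
  then obtain z where "y - (T z - z) = z" by auto
  then have "T z = y" by (simp add: algebra_simps)
  then show ?thesis by (rule that)
qed

lemma separated_family_mono:
  assumes sep: "separated_family I p r N" and r': "r' \<le> r"
  shows "separated_family I p r' N"
  unfolding separated_family_def
proof (intro allI conjI)
  fix z
  have sub: "{i \<in> I. dist (p i) z < r'} \<subseteq> {i \<in> I. dist (p i) z < r}" using r' by auto
  have fin: "finite {i \<in> I. dist (p i) z < r}" and card: "card {i \<in> I. dist (p i) z < r} \<le> N"
    using sep by (auto simp: separated_family_def)
  show "finite {i \<in> I. dist (p i) z < r'}" by (rule finite_subset[OF sub fin])
  show "card {i \<in> I. dist (p i) z < r'} \<le> N" using card_mono[OF fin sub] card by simp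
qed

text \<open>If the ball about \<open>y\<close> contains an image \<open>T i0\<close>, every other
  image in it lies within \<open>r / 2\<close> of \<open>T i0\<close>, hence its preimage within
  \<open>r\<close> of \<open>i0\<close>, since distances shrink at most by a factor 2.\<close>

lemma separated_family_perturbed:
  assumes sep: "separated_family I (\<lambda>z. z) r N" and T: "lipschitz_perturbation \<epsilon> T" and \<epsilon>: "\<epsilon> \<le> 1/2"
  shows "separated_family I T (r / 4) N"
  unfolding separated_family_def
proof (intro allI)
  fix y
  let ?A = "{i \<in> I. dist (T i) y < r / 4}"
  show "finite ?A \<and> card ?A \<le> N"
  proof (cases "?A = {}")
    case True
    then show ?thesis by (metis card.empty finite.emptyI le0)
  next
    case False
    then obtain i0 where i0: "i0 \<in> I" "dist (T i0) y < r / 4" by auto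
    have sub: "?A \<subseteq> {i \<in> I. dist i i0 < r}"
    proof
      fix i assume i: "i \<in> ?A"
      have "dist (T i) (T i0) < r / 2"
        using i i0 dist_triangle2[of "T i" "T i0" y] by simp
      then have "dist i i0 < r"
        using lipschitz_perturbation_bounds(1)[OF T \<epsilon>, of i i0] by (simp add: dist_norm)
      then show "i \<in> {i \<in> I. dist i i0 < r}" using i by simp
    qed
    have fin: "finite {i \<in> I. dist i i0 < r}" and card: "card {i \<in> I. dist i i0 < r} \<le> N"
      using sep by (auto simp: separated_family_def)
    show ?thesis using finite_subset[OF sub fin] card_mono[OF fin sub] card by simp
  qed
qed

text \<open>A ball of radius \<open>R\<close> is covered by finitely many balls of radius
  \<open>r\<close>, and their number does not depend on the centre.\<close>

lemma separated_family_large_balls: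
  fixes p :: "'i \<Rightarrow> 'a::euclidean_space"
  assumes sep: "separated_family I p r N" and r: "0 < r"
  obtains M where "separated_family I p R M"
proof -
  have "compact (cball (0::'a) R)" by simp
  then obtain F where F: "finite F" "cball (0::'a) R \<subseteq> (\<Union>x\<in>F. ball x r)"
    using r unfolding compact_eq_totally_bounded by blast
  have "separated_family I p R (card F * N)"
    unfolding separated_family_def
  proof (intro allI)
    fix z
    have sub: "{i \<in> I. dist (p i) z < R} \<subseteq> (\<Union>x\<in>F. {i \<in> I. dist (p i) (x + z) < r})"
    proof
      fix i assume i: "i \<in> {i \<in> I. dist (p i) z < R}"
      then have "p i - z \<in> cball 0 R" by (simp add: dist_norm norm_minus_commute)
      then obtain x where x: "x \<in> F" "dist x (p i - z) < r" using F(2) by auto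
      have "dist (p i) (x + z) = dist x (p i - z)"
        by (simp add: dist_norm norm_minus_commute algebra_simps)
      then have "dist (p i) (x + z) < r" using x(2) by (simp only:)
      then show "i \<in> (\<Union>x\<in>F. {i \<in> I. dist (p i) (x + z) < r})" using x(1) i by blast
    qed
    have fin: "finite (\<Union>x\<in>F. {i \<in> I. dist (p i) (x + z) < r})"
      using F(1) sep by (auto simp: separated_family_def)
    have "card (\<Union>x\<in>F. {i \<in> I. dist (p i) (x + z) < r}) \<le> (\<Sum>x\<in>F. card {i \<in> I. dist (p i) (x + z) < r})"
      by (rule card_UN_le[OF F(1)])
    also have "\<dots> \<le> card F * N"
      using sep sum_bounded_above[of F "\<lambda>x. card {i \<in> I. dist (p i) (x + z) < r}" N]
      by (simp add: separated_family_def)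
    finally show "finite {i \<in> I. dist (p i) z < R} \<and> card {i \<in> I. dist (p i) z < R} \<le> card F * N"
      using finite_subset[OF sub fin] card_mono[OF fin sub] by simp
  qed
  then show ?thesis by (rule that)
qed

text \<open>Splits \<open>p\<close> as \<open>w + l + (p - l - w)\<close> with the common
  translation \<open>w\<close> outermost, so that for many nodes it acts as one unitary on the whole
  sum and only the small remainder hits \<open>g\<close>.\<close>

lemma tf_shift_perturbed:
  assumes g: "g \<in> L2"
  obtains \<theta> where "cmod \<theta> = 1"
    "tf_shift p g = (\<lambda>t. \<theta> * tf_shift w (tf_shift l (tf_shift (p - l - w) g)) t)"
proof -
  let ?u = "p - l - w"
  have "tf_shift p g = tf_shift (w + (l + ?u)) g" by simp
  also have "\<dots> = (\<lambda>t. (cis (2 * pi * (freq_part (l + ?u) \<bullet> time_part w)) * cis (2 * pi * (freq_part ?u \<bullet> time_part l)))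
      * tf_shift w (tf_shift l (tf_shift ?u g)) t)"
    by (simp only: tf_shift_add tf_shift_scale mult.assoc)
  finally have eq: "tf_shift p g = (\<lambda>t. (cis (2 * pi * (freq_part (l + ?u) \<bullet> time_part w)) *
      cis (2 * pi * (freq_part ?u \<bullet> time_part l))) * tf_shift w (tf_shift l (tf_shift ?u g)) t)" .
  show ?thesis by (rule that[OF _ eq]) (simp add: norm_mult)
qed

text \<open>The phases \<open>\<theta>\<close> are absorbed into the coefficients, which is possible
  because the lower bound holds for all of them. After the unitary of \<open>w\<close> is removed,
  the atoms differ from the unperturbed ones by at most \<open>\<eta>\<close>, and Cauchy-Schwarz
  over at most \<open>M\<close> terms produces \<open>sqrt M\<close>.\<close>

lemma synthesis_perturbation:
  fixes g :: "real^'d \<Rightarrow> complex"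
  assumes g: "g \<in> L2" and S: "finite S" and M: "card S \<le> M" and \<eta>: "0 \<le> \<eta>"
    and near: "\<And>z. z \<in> S \<Longrightarrow> L2_norm (\<lambda>t. tf_shift (T z - z - w) g t - g t) \<le> \<eta>"
    and lower: "\<And>c. a * sqrt (\<Sum>z\<in>S. (cmod (c z))\<^sup>2) \<le> L2_norm (\<lambda>t. \<Sum>z\<in>S. c z * tf_shift z g t)"
  shows "(a - sqrt M * \<eta>) * sqrt (\<Sum>z\<in>S. (cmod (c z))\<^sup>2) \<le> L2_norm (\<lambda>t. \<Sum>z\<in>S. c z * tf_shift (T z) g t)"
proof -
  define u where "u z = T z - z - w" for z
  have "\<exists>\<theta>. cmod \<theta> = 1 \<and> tf_shift (T z) g = (\<lambda>t. \<theta> * tf_shift w (tf_shift z (tf_shift (u z) g)) t)" for z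
    using tf_shift_perturbed[OF g, of "T z" w z] unfolding u_def by metis
  then obtain \<theta> where \<theta>: "\<And>z. cmod (\<theta> z) = 1"
      "\<And>z. tf_shift (T z) g = (\<lambda>t. \<theta> z * tf_shift w (tf_shift z (tf_shift (u z) g)) t)"
    by metis
  let ?s = "sqrt (\<Sum>z\<in>S. (cmod (c z))\<^sup>2)"
  let ?D = "\<lambda>t. \<Sum>z\<in>S. (c z * \<theta> z) * tf_shift z g t"
  let ?E = "\<lambda>t. \<Sum>z\<in>S. (c z * \<theta> z) * tf_shift z (tf_shift (u z) g) t"
  have D: "?D \<in> L2" and E: "?E \<in> L2" by (intro L2_lincomb L2_tf_shift g)+
  have "(\<lambda>t. \<Sum>z\<in>S. c z * tf_shift (T z) g t) = tf_shift w ?E"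
    unfolding tf_shift_sum by (simp add: \<theta>(2) mult.assoc)
  then have "L2_norm (\<lambda>t. \<Sum>z\<in>S. c z * tf_shift (T z) g t) = L2_norm ?E"
    using L2_norm_tf_shift[OF E] by simp
  moreover have "L2_norm ?D \<le> L2_norm ?E + L2_norm (\<lambda>t. ?D t - ?E t)"
    by (rule L2_norm_le_diff[OF D E])
  moreover have "L2_norm (\<lambda>t. ?D t - ?E t) \<le> sqrt M * \<eta> * ?s"
  proof -
    have "(\<lambda>t. ?D t - ?E t) = (\<lambda>t. \<Sum>z\<in>S. (c z * \<theta> z) * tf_shift z (\<lambda>t. g t - tf_shift (u z) g t) t)"
      by (simp add: tf_shift_minus sum_subtractf right_diff_distrib)
    then have "L2_norm (\<lambda>t. ?D t - ?E t)
        \<le> (\<Sum>z\<in>S. L2_norm (\<lambda>t. (c z * \<theta> z) * tf_shift z (\<lambda>t. g t - tf_shift (u z) g t) t))"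
      using L2_norm_sum_le[of S "\<lambda>z t. (c z * \<theta> z) * tf_shift z (\<lambda>t. g t - tf_shift (u z) g t) t"]
      by (simp add: L2_scale L2_tf_shift L2_diff g)
    also have "\<dots> \<le> (\<Sum>z\<in>S. cmod (c z) * \<eta>)"
    proof (rule sum_mono)
      fix z assume z: "z \<in> S"
      have "L2_norm (\<lambda>t. (c z * \<theta> z) * tf_shift z (\<lambda>t. g t - tf_shift (u z) g t) t)
          = cmod (c z) * L2_norm (\<lambda>t. tf_shift (u z) g t - g t)"
        by (simp add: L2_norm_scale norm_mult \<theta>(1) L2_norm_tf_shift L2_diff L2_tf_shift g L2_norm_commute[of g])
      also have "\<dots> \<le> cmod (c z) * \<eta>"
        using near[OF z] by (intro mult_left_mono) (auto simp: u_def)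
      finally show "L2_norm (\<lambda>t. (c z * \<theta> z) * tf_shift z (\<lambda>t. g t - tf_shift (u z) g t) t) \<le> cmod (c z) * \<eta>" .
    qed
    also have "\<dots> = (\<Sum>z\<in>S. cmod (c z)) * \<eta>" by (simp add: sum_distrib_right)
    also have "\<dots> \<le> (sqrt M * ?s) * \<eta>"
    proof (intro mult_right_mono \<eta>)
      have "(\<Sum>z\<in>S. 1 * cmod (c z))\<^sup>2 \<le> (\<Sum>z\<in>S. 1\<^sup>2) * (\<Sum>z\<in>S. (cmod (c z))\<^sup>2)"
        by (rule Cauchy_Schwarz_ineq_sum)
      also have "\<dots> \<le> M * (\<Sum>z\<in>S. (cmod (c z))\<^sup>2)"
        using M by (intro mult_right_mono) (auto intro: sum_nonneg)
      finally show "(\<Sum>z\<in>S. cmod (c z)) \<le> sqrt M * ?s"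
        unfolding real_sqrt_mult[symmetric] by (intro real_le_rsqrt) simp
    qed
    finally show ?thesis by (simp add: mult_ac)
  qed
  moreover have "a * ?s \<le> L2_norm ?D"
    using lower[of "\<lambda>z. c z * \<theta> z"] by (simp add: norm_mult \<theta>(1))
  ultimately show ?thesis by (simp add: algebra_simps)
qed

lemma sum_ball_cut:
  fixes F :: "'i \<Rightarrow> 'b::comm_monoid_add"
  assumes "finite S" "\<And>i. i \<in> S \<Longrightarrow> \<not> dist (q i) y < R \<Longrightarrow> F i = 0"
  shows "(\<Sum>i\<in>S. F i) = (\<Sum>i\<in>{i \<in> S. dist (q i) y < R}. F i)"
  by (rule sum.mono_neutral_right) (use assms in auto)

subsection \<open>Stability of Riesz sequences\<close>

text \<open>On each ball \<open>synthesis_perturbation\<close> gives a lower bound with constant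
  \<open>a / 2\<close>, hence \<open>a\<^sup>2 / 4\<close> after squaring; averaging over the
  centres costs at most \<open>a\<^sup>2 / 8\<close>, so half of it survives.\<close>

lemma Riesz_deformation:
  fixes g :: "real^'d \<Rightarrow> complex"
  assumes g: "g \<in> M1" and r: "0 < r" and sep: "separated_family \<Lambda> (\<lambda>z. z) r N" and a: "0 < a"
    and lower: "\<And>S c. finite S \<Longrightarrow> S \<subseteq> \<Lambda> \<Longrightarrow>
      a * sqrt (\<Sum>z\<in>S. (cmod (c z))\<^sup>2) \<le> L2_norm (\<lambda>t. \<Sum>z\<in>S. c z * tf_shift z g t)"
  obtains \<epsilon> where "0 < \<epsilon>" "\<epsilon> \<le> 1/2"
    "\<And>T S c. lipschitz_perturbation \<epsilon> T \<Longrightarrow> finite S \<Longrightarrow> S \<subseteq> \<Lambda> \<Longrightarrow>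
      a\<^sup>2 / 8 * (\<Sum>z\<in>S. (cmod (c z))\<^sup>2) \<le> (L2_norm (\<lambda>t. \<Sum>z\<in>S. c z * tf_shift (T z) g t))\<^sup>2"
proof -
  have gL2: "g \<in> L2" using g by (simp add: M1_def)
  \<comment> \<open>The 4 is the loss in \<open>separated_family_perturbed\<close>; the cap at 1
    matches the unit balls of the envelope.\<close>
  define r0 where "r0 = min r 1 / 4"
  have r0: "0 < r0" "r0 \<le> 1" using r by (auto simp: r0_def)
  have sep1: "separated_family \<Lambda> (\<lambda>z. z) (min r 1) N" by (rule separated_family_mono[OF sep]) simp
  define \<delta> where "\<delta> = a\<^sup>2 / 8"
  have \<delta>: "0 < \<delta>" using a by (simp add: \<delta>_def)
  obtain R where R: "0 < R"
    "\<And>(I::(real^('d + 'd)) set) p S z R'. R \<le> R' \<Longrightarrow> separated_family I p r0 N \<Longrightarrow> finite S \<Longrightarrow> S \<subseteq> I \<Longrightarrow>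
      (\<Sum>i\<in>S. ambiguity g (p i - z) * (1 - overlap R' (p i) z)) \<le> \<delta>"
    by (rule ambiguity_overlap_sum[OF g r0 \<delta>, where 'i="real^('d + 'd)" and N=N]) blast
  \<comment> \<open>Nodes with image within \<open>R\<close> of \<open>T y'\<close> lie within
    \<open>2 * R\<close> of \<open>y'\<close>, so \<open>M\<close> bounds their number for every
    admissible \<open>T\<close>.\<close>
  obtain M where M: "separated_family \<Lambda> (\<lambda>z. z) (2 * R) M"
    using separated_family_large_balls[OF sep r] by blast
  \<comment> \<open>Chosen to make \<open>sqrt M * \<eta> \<le> a / 2\<close>; the
    \<open>+ 1\<close> covers \<open>M = 0\<close>.\<close>
  define \<eta> where "\<eta> = a / (2 * sqrt (real M + 1))"
  have \<eta>: "0 < \<eta>" using a by (simp add: \<eta>_def)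
  have M\<eta>: "sqrt M * \<eta> \<le> a / 2"
  proof -
    have "sqrt M * \<eta> \<le> sqrt (real M + 1) * \<eta>" using \<eta> by (intro mult_right_mono) auto
    also have "\<dots> = a / 2" by (simp add: \<eta>_def)
    finally show ?thesis .
  qed
  obtain d where d: "0 < d" "\<And>u. norm u < d \<Longrightarrow> L2_norm (\<lambda>t. tf_shift u g t - g t) < \<eta>"
    using tf_shift_continuous_at_zero[OF gL2 \<eta>] by blast
  define \<epsilon> where "\<epsilon> = min (1/2) (d / (4 * R))"
  have \<epsilon>: "0 < \<epsilon>" "\<epsilon> \<le> 1/2" "\<epsilon> * (2 * R) < d"
  proof -
    show "0 < \<epsilon>" "\<epsilon> \<le> 1/2" using d R by (auto simp: \<epsilon>_def)
    have "\<epsilon> * (2 * R) \<le> d / (4 * R) * (2 * R)" using R by (intro mult_right_mono) (auto simp: \<epsilon>_def)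
    also have "\<dots> = d / 2" using R by simp
    finally show "\<epsilon> * (2 * R) < d" using d by simp
  qed
  have "a\<^sup>2 / 8 * (\<Sum>z\<in>S. (cmod (c z))\<^sup>2) \<le> (L2_norm (\<lambda>t. \<Sum>z\<in>S. c z * tf_shift (T z) g t))\<^sup>2"
    if T: "lipschitz_perturbation \<epsilon> T" and S: "finite S" "S \<subseteq> \<Lambda>" for T S c
  proof -
    have sepT: "separated_family \<Lambda> T r0 N"
      unfolding r0_def by (rule separated_family_perturbed[OF sep1 T \<epsilon>(2)])
    let ?V = "measure lborel (ball (0::real^('d + 'd)) R)"
    let ?F = "\<lambda>y. (L2_norm (\<lambda>t. \<Sum>i\<in>S. (complex_of_real (ball_cut R y (T i)) * c i) * tf_shift (T i) g t))\<^sup>2"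
    let ?C = "\<lambda>y. \<Sum>i\<in>S. (cmod (complex_of_real (ball_cut R y (T i)) * c i))\<^sup>2"
    have V: "0 < ?V" by (rule emeasure_ball_bounds(2)[OF R(1)])
    have loc1: "(\<Sum>j\<in>S. cmod (L2_inner (tf_shift (T j) g) (tf_shift (T i) g)) * (1 - overlap R (T j) (T i))) \<le> \<delta>" for i
      using R(2)[OF order_refl sepT S, of "T i"]
      by (simp add: cmod_L2_inner_ambiguity gL2 ambiguity_diff_commute[OF gL2, of "T i"])
    note loc = localization_formula[OF R(1) S(1), of "\<lambda>i. tf_shift (T i) g" T \<delta> c, OF L2_tf_shift[OF gL2] loc1]
    have pt: "a\<^sup>2 / 4 * ?C y \<le> ?F y" for y
    proof -
      \<comment> \<open>On the nodes seen from the centre \<open>y\<close>, the map \<open>T\<close>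
        is nearly the translation by \<open>T y' - y'\<close>.\<close>
      obtain y' where y': "T y' = y" using lipschitz_perturbation_surj[OF T _ \<epsilon>(2)] \<epsilon>(1) by (metis less_imp_le)
      let ?S = "{i \<in> S. dist (T i) y < R}"
      have near: "norm (z - y') < 2 * R" if "z \<in> ?S" for z
        using lipschitz_perturbation_bounds(1)[OF T \<epsilon>(2), of z y'] that y' by (simp add: dist_norm)
      have fin: "finite {i \<in> \<Lambda>. dist i y' < 2 * R}" "card {i \<in> \<Lambda>. dist i y' < 2 * R} \<le> M"
        using M by (auto simp: separated_family_def)
      have "card ?S \<le> card {i \<in> \<Lambda>. dist i y' < 2 * R}"
        using near S(2) by (intro card_mono fin) (auto simp: dist_norm)
      then have card: "card ?S \<le> M" using fin(2) by simp
      have "(a - sqrt M * \<eta>) * sqrt (\<Sum>z\<in>?S. (cmod (c z))\<^sup>2) \<le> L2_norm (\<lambda>t. \<Sum>z\<in>?S. c z * tf_shift (T z) g t)"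
      proof (rule synthesis_perturbation[OF gL2 _ card, where w="T y' - y'"])
        fix z assume z: "z \<in> ?S"
        have "norm (T z - z - (T y' - y')) = norm ((T z - T y') - (z - y'))" by (simp add: algebra_simps)
        also have "\<dots> \<le> \<epsilon> * norm (z - y')" by (rule lipschitz_perturbationD[OF T])
        also have "\<dots> \<le> \<epsilon> * (2 * R)" using near[OF z] \<epsilon>(1) by (intro mult_left_mono) auto
        also have "\<dots> < d" by (rule \<epsilon>(3))
        finally show "L2_norm (\<lambda>t. tf_shift (T z - z - (T y' - y')) g t - g t) \<le> \<eta>"
          using d(2) by (simp add: less_imp_le)
      next
        show "a * sqrt (\<Sum>z\<in>?S. (cmod (b z))\<^sup>2) \<le> L2_norm (\<lambda>t. \<Sum>z\<in>?S. b z * tf_shift z g t)" for b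
          by (rule lower) (use S in auto)
      qed (use S \<eta> in auto)
      moreover have "a / 2 * sqrt (\<Sum>z\<in>?S. (cmod (c z))\<^sup>2) \<le> (a - sqrt M * \<eta>) * sqrt (\<Sum>z\<in>?S. (cmod (c z))\<^sup>2)"
        using M\<eta> by (intro mult_right_mono) (auto intro: sum_nonneg)
      ultimately have "a / 2 * sqrt (\<Sum>z\<in>?S. (cmod (c z))\<^sup>2) \<le> L2_norm (\<lambda>t. \<Sum>z\<in>?S. c z * tf_shift (T z) g t)"
        by linarith
      then have "(a / 2 * sqrt (\<Sum>z\<in>?S. (cmod (c z))\<^sup>2))\<^sup>2 \<le> (L2_norm (\<lambda>t. \<Sum>z\<in>?S. c z * tf_shift (T z) g t))\<^sup>2"
        using a by (intro power_mono) (auto intro!: mult_nonneg_nonneg sum_nonneg)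
      then have le: "a\<^sup>2 / 4 * (\<Sum>z\<in>?S. (cmod (c z))\<^sup>2) \<le> (L2_norm (\<lambda>t. \<Sum>z\<in>?S. c z * tf_shift (T z) g t))\<^sup>2"
        by (simp add: power_mult_distrib power_divide sum_nonneg)
      have e1: "?C y = (\<Sum>z\<in>?S. (cmod (c z))\<^sup>2)"
        by (subst sum_ball_cut[OF S(1), of T y R]) (auto simp: ball_cut_simps intro!: sum.cong)
      have e2: "(\<Sum>i\<in>S. (complex_of_real (ball_cut R y (T i)) * c i) * tf_shift (T i) g t) = (\<Sum>z\<in>?S. c z * tf_shift (T z) g t)" for t
        by (subst sum_ball_cut[OF S(1), of T y R]) (auto simp: ball_cut_simps intro!: sum.cong)
      show ?thesis unfolding e1 e2 by (rule le)
    qed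
    have "a\<^sup>2 / 4 * (?V * (\<Sum>z\<in>S. (cmod (c z))\<^sup>2)) = (\<integral>y. a\<^sup>2 / 4 * ?C y \<partial>lborel)"
      by (simp only: integral_mult_right_zero ball_cut_square_sum_integral(2)[OF R(1)])
    also have "\<dots> \<le> (\<integral>y. ?F y \<partial>lborel)"
      by (intro integral_mono pt integrable_mult_right ball_cut_square_sum_integral(1)[OF R(1)] loc(1))
    also have "\<dots> \<le> ?V * (L2_norm (\<lambda>t. \<Sum>i\<in>S. c i * tf_shift (T i) g t))\<^sup>2 + ?V * \<delta> * (\<Sum>i\<in>S. (cmod (c i))\<^sup>2)"
      using loc(2) by linarith
    finally have "?V * (a\<^sup>2 / 4 * (\<Sum>z\<in>S. (cmod (c z))\<^sup>2))
        \<le> ?V * ((L2_norm (\<lambda>t. \<Sum>i\<in>S. c i * tf_shift (T i) g t))\<^sup>2 + \<delta> * (\<Sum>i\<in>S. (cmod (c i))\<^sup>2))"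
      by (simp add: algebra_simps)
    then have "a\<^sup>2 / 4 * (\<Sum>z\<in>S. (cmod (c z))\<^sup>2)
        \<le> (L2_norm (\<lambda>t. \<Sum>i\<in>S. c i * tf_shift (T i) g t))\<^sup>2 + \<delta> * (\<Sum>i\<in>S. (cmod (c i))\<^sup>2)"
      using V by simp
    then show ?thesis by (simp add: \<delta>_def)
  qed
  then show ?thesis using that \<epsilon> by blast
qed

subsection \<open>Stability of frames\<close>

text \<open>
  Richardson iteration: the residual \<open>f - \<Sum> c\<^sub>z u\<^sub>z\<close> is corrected by \<open>1/K\<close> times its own frame
  coefficients on a finite set.
\<close>

lemma frame_approximation:
  fixes u :: "'i \<Rightarrow> real^'d \<Rightarrow> complex"
  assumes u: "\<And>z. z \<in> \<Lambda> \<Longrightarrow> u z \<in> L2" and A: "0 < A" and K: "0 < K"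
    and lower: "\<And>f. f \<in> L2 \<Longrightarrow> \<exists>S. finite S \<and> S \<subseteq> \<Lambda> \<and> A * (L2_norm f)\<^sup>2 \<le> (\<Sum>z\<in>S. (cmod (L2_inner f (u z)))\<^sup>2)"
    and upper: "\<And>S c. finite S \<Longrightarrow> S \<subseteq> \<Lambda> \<Longrightarrow>
      (L2_norm (\<lambda>t. \<Sum>z\<in>S. c z * u z t))\<^sup>2 \<le> K * (\<Sum>z\<in>S. (cmod (c z))\<^sup>2)"
  obtains C where "0 < C"
    "\<And>f \<beta>. f \<in> L2 \<Longrightarrow> 0 < \<beta> \<Longrightarrow> \<exists>S c. finite S \<and> S \<subseteq> \<Lambda> \<and> (\<Sum>z\<in>S. (cmod (c z))\<^sup>2) \<le> (C * L2_norm f)\<^sup>2 \<and>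
      L2_norm (\<lambda>t. f t - (\<Sum>z\<in>S. c z * u z t)) \<le> \<beta> * L2_norm f"
proof -
  \<comment> \<open>The larger of \<open>K\<close> and \<open>A\<close> gives
    \<open>A / K' \<le> 1\<close>, so that \<open>q\<close> is the root of a nonnegative
    number.\<close>
  define K' where "K' = max K A"
  have K': "0 < K'" "A \<le> K'" using K by (auto simp: K'_def)
  have upper': "(L2_norm (\<lambda>t. \<Sum>z\<in>S. c z * u z t))\<^sup>2 \<le> K' * (\<Sum>z\<in>S. (cmod (c z))\<^sup>2)"
    if "finite S" "S \<subseteq> \<Lambda>" for S c
  proof -
    have "K * (\<Sum>z\<in>S. (cmod (c z))\<^sup>2) \<le> K' * (\<Sum>z\<in>S. (cmod (c z))\<^sup>2)"
      by (intro mult_right_mono) (auto simp: K'_def intro: sum_nonneg)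
    then show ?thesis using upper[OF that, of c] by linarith
  qed
  define q where "q = sqrt (1 - A / K')"
  have AK: "0 < A / K'" "A / K' \<le> 1" using A K' by auto
  have q: "0 \<le> q" "q < 1" "q\<^sup>2 = 1 - A / K'"
    using AK by (auto simp: q_def)
  \<comment> \<open>One correction has coefficient norm at most \<open>b\<close> times the norm of
    the residual. Residuals decay like \<open>q ^ n\<close>, so the total stays below
    \<open>b / (1 - q)\<close> times the norm of \<open>f\<close> for any number of
    iterations.\<close>
  define b where "b = 1 / sqrt K'"
  have b: "0 < b" using K' by (simp add: b_def)
  define C where "C = b / (1 - q)"
  have C: "0 < C" using b q by (simp add: C_def)
  \<comment> \<open>Coefficients are required to vanish off \<open>S\<close>, so that corrections
    with different supports can be added on the union.\<close>
  have iter: "\<exists>S c. finite S \<and> S \<subseteq> \<Lambda> \<and> (\<forall>z. z \<notin> S \<longrightarrow> c z = 0) \<and>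
      L2_set (\<lambda>z. cmod (c z)) S \<le> b * (\<Sum>k<n. q ^ k) * L2_norm f \<and>
      L2_norm (\<lambda>t. f t - (\<Sum>z\<in>S. c z * u z t)) \<le> q ^ n * L2_norm f"
    if f: "f \<in> L2" for f n
  proof (induction n)
    case 0
    show ?case by (rule exI[of _ "{}"], rule exI[of _ "\<lambda>_. 0"]) simp
  next
    case (Suc n)
    then obtain S c where S: "finite S" "S \<subseteq> \<Lambda>" "\<And>z. z \<notin> S \<Longrightarrow> c z = 0"
      and c: "L2_set (\<lambda>z. cmod (c z)) S \<le> b * (\<Sum>k<n. q ^ k) * L2_norm f"
      and res: "L2_norm (\<lambda>t. f t - (\<Sum>z\<in>S. c z * u z t)) \<le> q ^ n * L2_norm f" by blast
    define h where "h t = f t - (\<Sum>z\<in>S. c z * u z t)" for t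
    have h: "h \<in> L2"
      unfolding h_def[abs_def] using S(2) by (intro L2_diff f L2_lincomb u) auto
    obtain S1 where S1: "finite S1" "S1 \<subseteq> \<Lambda>" "A * (L2_norm h)\<^sup>2 \<le> (\<Sum>z\<in>S1. (cmod (L2_inner h (u z)))\<^sup>2)"
      using lower[OF h] by blast
    have uS1: "\<And>z. z \<in> S1 \<Longrightarrow> u z \<in> L2" using u S1(2) by auto
    define s where "s = (\<Sum>z\<in>S1. (cmod (L2_inner h (u z)))\<^sup>2)"
    have s_le: "s \<le> K' * (L2_norm h)\<^sup>2"
      unfolding s_def by (rule L2_Bessel_dual[OF h uS1]) (use K' upper'[OF S1(1,2)] in auto)
    define c1 where "c1 z = (if z \<in> S1 then L2_inner h (u z) / complex_of_real K' else 0)" for z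
    let ?D1 = "\<lambda>t. \<Sum>z\<in>S1. c1 z * u z t"
    have D1: "?D1 \<in> L2" by (intro L2_lincomb uS1)
    have c1_sum: "(\<Sum>z\<in>S1. (cmod (c1 z))\<^sup>2) = s / K'\<^sup>2"
      unfolding s_def sum_divide_distrib using K' by (intro sum.cong) (auto simp: c1_def norm_divide power_divide)
    have D1_norm: "(L2_norm ?D1)\<^sup>2 \<le> s / K'"
    proof -
      have "K' * (s / K'\<^sup>2) = s / K'" using K' by (simp add: power2_eq_square)
      then show ?thesis using upper'[OF S1(1,2), of c1] by (simp only: c1_sum)
    qed
    have "L2_inner h ?D1 = (\<Sum>z\<in>S1. cnj (c1 z) * L2_inner h (u z))"
      by (rule L2_inner_sum_right[OF uS1 h])
    also have "\<dots> = (\<Sum>z\<in>S1. complex_of_real ((cmod (L2_inner h (u z)))\<^sup>2 / K'))"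
    proof (intro sum.cong refl)
      fix z assume "z \<in> S1"
      then show "cnj (c1 z) * L2_inner h (u z) = complex_of_real ((cmod (L2_inner h (u z)))\<^sup>2 / K')"
        using complex_norm_square[of "L2_inner h (u z)"] by (simp add: c1_def mult.commute)
    qed
    also have "\<dots> = complex_of_real (s / K')"
      by (simp add: s_def sum_divide_distrib)
    finally have inner: "Re (L2_inner h ?D1) = s / K'" by simp
    \<comment> \<open>The cross term contributes \<open>- 2 * s / K'\<close> and the upper bound
      returns at most \<open>s / K'\<close>; the surviving \<open>- s / K'\<close> is the
      contraction.\<close>
    have "(L2_norm (\<lambda>t. h t - ?D1 t))\<^sup>2 = (L2_norm h)\<^sup>2 - 2 * Re (L2_inner h ?D1) + (L2_norm ?D1)\<^sup>2"
      using L2_norm_square_add[OF h L2_uminus[OF D1]] L2_inner_scale_right[of h "-1" ?D1]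
      by (simp add: L2_norm_uminus)
    also have "\<dots> \<le> (L2_norm h)\<^sup>2 - s / K'" using D1_norm inner by simp
    also have "\<dots> \<le> (L2_norm h)\<^sup>2 - A * (L2_norm h)\<^sup>2 / K'"
      using S1(3) K' by (intro diff_left_mono divide_right_mono) (auto simp: s_def)
    also have "\<dots> = (q * L2_norm h)\<^sup>2" by (simp add: power_mult_distrib q(3) algebra_simps)
    finally have step: "L2_norm (\<lambda>t. h t - ?D1 t) \<le> q * L2_norm h"
      by (rule power2_le_imp_le) (use q in simp)
    have c1_norm: "L2_set (\<lambda>z. cmod (c1 z)) S1 \<le> b * L2_norm h"
    proof -
      have "s / K'\<^sup>2 \<le> (K' * (L2_norm h)\<^sup>2) / K'\<^sup>2" by (intro divide_right_mono s_le) simp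
      also have "\<dots> = (b * L2_norm h)\<^sup>2"
        using K' by (simp add: b_def power_mult_distrib power_divide power2_eq_square)
      finally show ?thesis
        unfolding L2_set_def c1_sum using b by (intro real_le_lsqrt) auto
    qed
    let ?U = "S \<union> S1"
    have U: "finite ?U" "?U \<subseteq> \<Lambda>" using S S1 by auto
    have ext: "(\<Sum>z\<in>?U. c z * u z t) = (\<Sum>z\<in>S. c z * u z t)" "(\<Sum>z\<in>?U. c1 z * u z t) = ?D1 t" for t
      by (intro sum.mono_neutral_right; use S S1 in \<open>auto simp: c1_def\<close>)+
    have ext2: "L2_set (\<lambda>z. cmod (c z)) ?U = L2_set (\<lambda>z. cmod (c z)) S"
      "L2_set (\<lambda>z. cmod (c1 z)) ?U = L2_set (\<lambda>z. cmod (c1 z)) S1"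
      unfolding L2_set_def by (intro arg_cong[where f=sqrt] sum.mono_neutral_right; use S S1 in \<open>auto simp: c1_def\<close>)+
    have "L2_set (\<lambda>z. cmod (c z + c1 z)) ?U \<le> L2_set (\<lambda>z. cmod (c z) + cmod (c1 z)) ?U"
      by (intro L2_set_mono norm_triangle_ineq) auto
    also have "\<dots> \<le> L2_set (\<lambda>z. cmod (c z)) S + L2_set (\<lambda>z. cmod (c1 z)) S1"
      using L2_set_triangle_ineq[of "\<lambda>z. cmod (c z)" "\<lambda>z. cmod (c1 z)" ?U] ext2 by simp
    also have "\<dots> \<le> b * (\<Sum>k<n. q ^ k) * L2_norm f + b * (q ^ n * L2_norm f)"
    proof (rule add_mono[OF c order_trans[OF c1_norm]])
      show "b * L2_norm h \<le> b * (q ^ n * L2_norm f)"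
        unfolding h_def[abs_def] by (rule mult_left_mono[OF res]) (use b in simp)
    qed
    also have "\<dots> = b * (\<Sum>k<Suc n. q ^ k) * L2_norm f" by (simp add: algebra_simps)
    finally have n1: "L2_set (\<lambda>z. cmod (c z + c1 z)) ?U \<le> b * (\<Sum>k<Suc n. q ^ k) * L2_norm f" .
    have "(\<lambda>t. f t - (\<Sum>z\<in>?U. (c z + c1 z) * u z t)) = (\<lambda>t. h t - ?D1 t)"
      by (simp add: h_def distrib_right sum.distrib ext diff_diff_eq)
    then have "L2_norm (\<lambda>t. f t - (\<Sum>z\<in>?U. (c z + c1 z) * u z t)) \<le> q * L2_norm h"
      using step by simp
    also have "\<dots> \<le> q * (q ^ n * L2_norm f)"
      using res q by (intro mult_left_mono) (auto simp: h_def[abs_def])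
    finally have n2: "L2_norm (\<lambda>t. f t - (\<Sum>z\<in>?U. (c z + c1 z) * u z t)) \<le> q ^ Suc n * L2_norm f"
      by simp
    show ?case
      by (rule exI[of _ ?U], rule exI[of _ "\<lambda>z. c z + c1 z"])
        (use U n1 n2 S(3) in \<open>auto simp: c1_def\<close>)
  qed
  have "\<exists>S c. finite S \<and> S \<subseteq> \<Lambda> \<and> (\<Sum>z\<in>S. (cmod (c z))\<^sup>2) \<le> (C * L2_norm f)\<^sup>2 \<and>
      L2_norm (\<lambda>t. f t - (\<Sum>z\<in>S. c z * u z t)) \<le> \<beta> * L2_norm f"
    if f: "f \<in> L2" and \<beta>: "0 < \<beta>" for f \<beta>
  proof -
    obtain n where n: "q ^ n < \<beta>" using real_arch_pow_inv[OF \<beta> q(2)] by blast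
    obtain S c where S: "finite S" "S \<subseteq> \<Lambda>"
      and c: "L2_set (\<lambda>z. cmod (c z)) S \<le> b * (\<Sum>k<n. q ^ k) * L2_norm f"
      and res: "L2_norm (\<lambda>t. f t - (\<Sum>z\<in>S. c z * u z t)) \<le> q ^ n * L2_norm f"
      using iter[OF f, of n] by blast
    have "(\<Sum>k<n. q ^ k) = (1 - q ^ n) / (1 - q)" using q by (simp add: sum_gp_strict)
    also have "\<dots> \<le> 1 / (1 - q)" using q by (intro divide_right_mono) auto
    finally have "b * (\<Sum>k<n. q ^ k) * L2_norm f \<le> b * (1 / (1 - q)) * L2_norm f"
      using b by (intro mult_right_mono mult_left_mono) auto
    then have "L2_set (\<lambda>z. cmod (c z)) S \<le> C * L2_norm f" using c by (simp add: C_def)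
    then have "(L2_set (\<lambda>z. cmod (c z)) S)\<^sup>2 \<le> (C * L2_norm f)\<^sup>2" by (intro power_mono) auto
    then have "(\<Sum>z\<in>S. (cmod (c z))\<^sup>2) \<le> (C * L2_norm f)\<^sup>2" by (simp add: L2_set_def sum_nonneg)
    moreover have "L2_norm (\<lambda>t. f t - (\<Sum>z\<in>S. c z * u z t)) \<le> \<beta> * L2_norm f"
      using res mult_right_mono[of "q ^ n" \<beta> "L2_norm f"] n by simp
    ultimately show ?thesis using S by blast
  qed
  then show ?thesis using that C by blast
qed

text \<open>Only moduli of coefficients occur here, so the phases drop out and the displacement
  \<open>p - l - w\<close> is charged to \<open>g\<close>. The intended \<open>p\<close> is
  \<open>T l\<close>.\<close>

lemma analysis_perturbation:
  assumes g: "g \<in> L2" and f: "f \<in> L2" and u: "L2_norm (\<lambda>t. tf_shift (p - l - w) g t - g t) \<le> \<eta>"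
  shows "cmod (L2_inner f (tf_shift (l + w) g)) \<le> cmod (L2_inner f (tf_shift p g)) + \<eta> * L2_norm f"
proof -
  let ?u = "p - l - w"
  let ?h = "\<lambda>t. tf_shift ?u g t - g t"
  have h: "?h \<in> L2" by (intro L2_diff L2_tf_shift g)
  have "p = (l + w) + ?u" by simp
  then have "cmod (L2_inner f (tf_shift p g)) = cmod (L2_inner f (tf_shift ((l + w) + ?u) g))" by simp
  also have "\<dots> = cmod (L2_inner f (tf_shift (l + w) (tf_shift ?u g)))"
    unfolding tf_shift_add[of "l + w" ?u] L2_inner_scale_right norm_mult by simp
  finally have p: "cmod (L2_inner f (tf_shift p g)) = cmod (L2_inner f (tf_shift (l + w) (tf_shift ?u g)))" .
  have "L2_inner f (tf_shift (l + w) (tf_shift ?u g)) - L2_inner f (tf_shift (l + w) g) = L2_inner f (tf_shift (l + w) ?h)"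
    by (simp add: tf_shift_minus L2_inner_diff_right L2_tf_shift f g)
  moreover have "cmod (L2_inner f (tf_shift (l + w) ?h)) \<le> L2_norm f * L2_norm ?h"
    using L2_Cauchy_Schwarz[OF f L2_tf_shift[OF h]] by (simp add: L2_norm_tf_shift h)
  moreover have "L2_norm f * L2_norm ?h \<le> L2_norm f * \<eta>" by (intro mult_left_mono u) simp
  ultimately show ?thesis
    using norm_triangle_ineq3[of "L2_inner f (tf_shift (l + w) (tf_shift ?u g))" "L2_inner f (tf_shift (l + w) g)"] p
    by (simp add: mult.commute)
qed

text \<open>
  One localized piece \<open>f\<close>, with coefficients supported in \<open>ball y R\<close>: the frame inequality for the
  translate of \<open>\<Lambda>\<close> by \<open>w = y - y'\<close> transfers to \<open>T \<Lambda>\<close>, because \<open>T\<close> is almost the translation by \<open>w\<close>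
  near \<open>y'\<close> and the points far from \<open>y'\<close> hardly see \<open>f\<close>.
\<close>

lemma local_frame_bound:
  fixes g :: "real^'d \<Rightarrow> complex" and c :: "real^('d + 'd) \<Rightarrow> complex"
  assumes g: "g \<in> L2" and A: "0 < A"
    and lower: "\<And>f. f \<in> L2 \<Longrightarrow> \<exists>S. finite S \<and> S \<subseteq> \<Lambda> \<and> A * (L2_norm f)\<^sup>2 \<le> (\<Sum>z\<in>S. (cmod (L2_inner f (tf_shift z g)))\<^sup>2)"
    and S: "finite S" "\<And>i. i \<in> S \<Longrightarrow> dist i y < R"
    and K: "\<And>z. (\<Sum>i\<in>S. ambiguity g (i - z)) \<le> K" "0 \<le> K"
    and tail: "\<And>F z. finite F \<Longrightarrow> F \<subseteq> \<Lambda> \<Longrightarrow> (\<And>i. i \<in> F \<Longrightarrow> \<rho> \<le> norm (i - z)) \<Longrightarrow> (\<Sum>i\<in>F. ambiguity g (i - z)) \<le> e"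
    and M: "finite {i \<in> \<Lambda>. dist i y' < R + \<rho>}" "card {i \<in> \<Lambda>. dist i y' < R + \<rho>} \<le> M"
    and \<eta>: "2 * real M * \<eta>\<^sup>2 \<le> A / 2"
    and near: "\<And>l. l \<in> \<Lambda> \<Longrightarrow> dist l y' < R + \<rho> \<Longrightarrow> L2_norm (\<lambda>t. tf_shift (T l - l - (y - y')) g t - g t) \<le> \<eta>"
    and L: "finite L" "{i \<in> \<Lambda>. dist i y' < R + \<rho>} \<subseteq> L"
  defines "f \<equiv> \<lambda>t. \<Sum>i\<in>S. c i * tf_shift i g t"
  shows "A / 2 * (L2_norm f)\<^sup>2 \<le> 2 * (\<Sum>l\<in>L. (cmod (L2_inner f (tf_shift (T l) g)))\<^sup>2)
    + K * e * (\<Sum>i\<in>S. (cmod (c i))\<^sup>2)"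
proof -
  define w where "w = y - y'"
  let ?N = "{i \<in> \<Lambda>. dist i y' < R + \<rho>}"
  have f: "f \<in> L2" unfolding f_def by (intro L2_lincomb L2_tf_shift g)
  \<comment> \<open>The lower bound is applied to \<open>tf_shift (- w) f\<close>, whose
    coefficients over \<open>\<Lambda>\<close> are, in modulus, those of \<open>f\<close> over the
    translate of \<open>\<Lambda>\<close> by \<open>w\<close>.\<close>
  have fw: "tf_shift (- w) f \<in> L2" by (intro L2_tf_shift f)
  obtain S1 where S1: "finite S1" "S1 \<subseteq> \<Lambda>"
      "A * (L2_norm (tf_shift (- w) f))\<^sup>2 \<le> (\<Sum>z\<in>S1. (cmod (L2_inner (tf_shift (- w) f) (tf_shift z g)))\<^sup>2)"
    using lower[OF fw] by blast
  let ?F = "\<lambda>z. (cmod (L2_inner f (tf_shift (z + w) g)))\<^sup>2"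
  have "A * (L2_norm f)\<^sup>2 \<le> (\<Sum>z\<in>S1. ?F z)"
    using S1(3) by (simp add: L2_norm_tf_shift f cmod_L2_inner_tf_shift g)
  \<comment> \<open>A node at distance at least \<open>R + \<rho>\<close> from \<open>y'\<close>
    stays, after translation by \<open>w\<close>, at distance at least \<open>\<rho>\<close> from
    every node of \<open>S\<close>; there the column sums of the Schur test are at most
    \<open>e\<close>.\<close>
  also have "\<dots> = (\<Sum>z\<in>S1 \<inter> ?N. ?F z) + (\<Sum>z\<in>S1 - ?N. ?F z)"
    by (rule sum.Int_Diff[OF S1(1)])
  also have "(\<Sum>z\<in>S1 - ?N. ?F z) \<le> K * e * (\<Sum>i\<in>S. (cmod (c i))\<^sup>2)"
  proof -
    have F: "?F z = (cmod (\<Sum>i\<in>S. c i * L2_inner (tf_shift i g) (tf_shift (z + w) g)))\<^sup>2" for z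
      unfolding f_def by (subst L2_inner_sum_left) (auto intro: L2_tf_shift g)
    show ?thesis
      unfolding F
    proof (rule Schur_map_bound[where w="\<lambda>z i. ambiguity g (z + w - i)"])
      show "cmod (L2_inner (tf_shift i g) (tf_shift (z + w) g)) \<le> ambiguity g (z + w - i)" for i z
        by (simp add: cmod_L2_inner_ambiguity g)
      show "(\<Sum>i\<in>S. ambiguity g (z + w - i)) \<le> K" for z
        using K(1)[of "z + w"] by (simp add: ambiguity_diff_commute[OF g, of "z + w"])
      show "(\<Sum>z\<in>S1 - ?N. ambiguity g (z + w - i)) \<le> e" if i: "i \<in> S" for i
      proof -
        have "(\<Sum>z\<in>S1 - ?N. ambiguity g (z - (i - w))) \<le> e"
        proof (rule tail)
          fix z assume z: "z \<in> S1 - ?N"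
          then have "R + \<rho> \<le> dist z y'" using S1(2) by auto
          also have "dist z y' = norm ((z - (i - w)) + (i - y))" by (simp add: dist_norm w_def)
          also have "\<dots> \<le> norm (z - (i - w)) + dist i y" unfolding dist_norm by (rule norm_triangle_ineq)
          finally show "\<rho> \<le> norm (z - (i - w))" using S(2)[OF i] by simp
        qed (use S1 in auto)
        moreover have "z - (i - w) = z + w - i" for z by simp
        ultimately show ?thesis by simp
      qed
    qed (rule K(2))
  qed
  \<comment> \<open>Each displacement of a near node costs \<open>\<eta> * L2_norm f\<close>; the at
    most \<open>M\<close> of them together use up half of \<open>A\<close>.\<close>
  also have "(\<Sum>z\<in>S1 \<inter> ?N. ?F z) \<le> (\<Sum>z\<in>?N. 2 * (cmod (L2_inner f (tf_shift (T z) g)))\<^sup>2 + 2 * (\<eta> * L2_norm f)\<^sup>2)"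
  proof (rule order_trans[OF sum_mono2[OF M(1)] sum_mono])
    fix z assume z: "z \<in> ?N"
    have "cmod (L2_inner f (tf_shift (z + w) g)) \<le> cmod (L2_inner f (tf_shift (T z) g)) + \<eta> * L2_norm f"
      using z near by (intro analysis_perturbation g f) (auto simp: w_def)
    then have "?F z \<le> (cmod (L2_inner f (tf_shift (T z) g)) + \<eta> * L2_norm f)\<^sup>2"
      by (intro power_mono) auto
    also have "\<dots> \<le> 2 * (cmod (L2_inner f (tf_shift (T z) g)))\<^sup>2 + 2 * (\<eta> * L2_norm f)\<^sup>2"
      using sum_squares_bound[of "cmod (L2_inner f (tf_shift (T z) g))" "\<eta> * L2_norm f"] by (simp add: power2_sum)
    finally show "?F z \<le> 2 * (cmod (L2_inner f (tf_shift (T z) g)))\<^sup>2 + 2 * (\<eta> * L2_norm f)\<^sup>2" .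
  qed auto
  also have "\<dots> = 2 * (\<Sum>z\<in>?N. (cmod (L2_inner f (tf_shift (T z) g)))\<^sup>2) + 2 * real (card ?N) * \<eta>\<^sup>2 * (L2_norm f)\<^sup>2"
    by (simp add: sum.distrib sum_distrib_left power_mult_distrib)
  also have "(\<Sum>z\<in>?N. (cmod (L2_inner f (tf_shift (T z) g)))\<^sup>2) \<le> (\<Sum>l\<in>L. (cmod (L2_inner f (tf_shift (T l) g)))\<^sup>2)"
    by (rule sum_mono2[OF L]) simp
  also have "2 * real (card ?N) * \<eta>\<^sup>2 * (L2_norm f)\<^sup>2 \<le> A / 2 * (L2_norm f)\<^sup>2"
  proof (rule mult_right_mono)
    have "2 * real (card ?N) * \<eta>\<^sup>2 \<le> 2 * real M * \<eta>\<^sup>2" using M(2) by (intro mult_right_mono) auto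
    then show "2 * real (card ?N) * \<eta>\<^sup>2 \<le> A / 2" using \<eta> by linarith
  qed simp
  finally show ?thesis by simp
qed

lemma tf_Schur_synthesis:
  fixes c :: "'i \<Rightarrow> complex"
  assumes g: "g \<in> L2" and S: "finite S" and K: "\<And>z. (\<Sum>i\<in>S. ambiguity g (p i - z)) \<le> K"
  shows "(L2_norm (\<lambda>t. \<Sum>i\<in>S. c i * tf_shift (p i) g t))\<^sup>2 \<le> K * (\<Sum>i\<in>S. (cmod (c i))\<^sup>2)"
proof (rule L2_Schur_synthesis[OF S])
  fix i
  show "(\<Sum>j\<in>S. cmod (L2_inner (tf_shift (p j) g) (tf_shift (p i) g))) \<le> K"
    using K[of "p i"] by (simp add: cmod_L2_inner_ambiguity g ambiguity_diff_commute[OF g, of "p i"])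
qed (intro L2_tf_shift g)

text \<open>The local inequality is averaged for a finite combination \<open>f'\<close> close to
  \<open>f\<close>. Its error terms are proportional to \<open>e\<close> times the squared
  coefficient norm, hence to \<open>e * C\<^sup>2\<close> times the squared norm of
  \<open>f\<close>, and \<open>e\<close> is tuned to \<open>C\<close>. As \<open>C\<close> is
  independent of \<open>\<beta>\<close>, the approximation error is tuned separately.\<close>

lemma frame_deformation:
  fixes g :: "real^'d \<Rightarrow> complex"
  assumes g: "g \<in> M1" and r: "0 < r" and sep: "separated_family \<Lambda> (\<lambda>z. z) r N" and A: "0 < A"
    and lower: "\<And>f. f \<in> L2 \<Longrightarrow> \<exists>S. finite S \<and> S \<subseteq> \<Lambda> \<and> A * (L2_norm f)\<^sup>2 \<le> (\<Sum>z\<in>S. (cmod (L2_inner f (tf_shift z g)))\<^sup>2)"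
  obtains \<epsilon> where "0 < \<epsilon>" "\<epsilon> \<le> 1/2"
    "\<And>T f. lipschitz_perturbation \<epsilon> T \<Longrightarrow> f \<in> L2 \<Longrightarrow> \<exists>L. finite L \<and> L \<subseteq> \<Lambda> \<and>
      A / 128 * (L2_norm f)\<^sup>2 \<le> (\<Sum>l\<in>L. (cmod (L2_inner f (tf_shift (T l) g)))\<^sup>2)"
proof -
  have gL2: "g \<in> L2" using g by (simp add: M1_def)
  define r0 where "r0 = min r 1 / 4"
  have r0: "0 < r0" "r0 \<le> 1" using r by (auto simp: r0_def)
  have sep1: "separated_family \<Lambda> (\<lambda>z. z) (min r 1) N" by (rule separated_family_mono[OF sep]) simp
  have sep0: "separated_family \<Lambda> (\<lambda>z. z) r0 N" by (rule separated_family_mono[OF sep]) (use r in \<open>auto simp: r0_def\<close>)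
  obtain K where K: "0 < K"
    "\<And>(I::(real^('d + 'd)) set) p S z. separated_family I p r0 N \<Longrightarrow> finite S \<Longrightarrow> S \<subseteq> I \<Longrightarrow>
      (\<Sum>i\<in>S. ambiguity g (p i - z)) \<le> K"
    by (rule ambiguity_sum_bounded[OF g r0, where 'i="real^('d + 'd)" and N=N]) blast
  have upper: "(L2_norm (\<lambda>t. \<Sum>z\<in>S. c z * tf_shift z g t))\<^sup>2 \<le> K * (\<Sum>z\<in>S. (cmod (c z))\<^sup>2)"
    if "finite S" "S \<subseteq> \<Lambda>" for S c
    by (rule tf_Schur_synthesis[OF gL2 that(1) K(2)[OF sep0 that]])
  obtain C where C: "0 < C"
    "\<And>f \<beta>. f \<in> L2 \<Longrightarrow> 0 < \<beta> \<Longrightarrow> \<exists>S c. finite S \<and> S \<subseteq> \<Lambda> \<and> (\<Sum>z\<in>S. (cmod (c z))\<^sup>2) \<le> (C * L2_norm f)\<^sup>2 \<and>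
      L2_norm (\<lambda>t. f t - (\<Sum>z\<in>S. c z * tf_shift z g t)) \<le> \<beta> * L2_norm f"
    using frame_approximation[OF L2_tf_shift[OF gL2] A K(1) lower upper] by blast
  \<comment> \<open>The weight \<open>9 * K + A / 2\<close> collects all averaging errors:
    \<open>8 * K\<close> from twice \<open>ball_cut_inner_average\<close>, \<open>K\<close> from the
    far nodes in \<open>local_frame_bound\<close>, and \<open>A / 2\<close> from the localization
    formula.\<close>
  define e where "e = A / (32 * (9 * K + A / 2) * C\<^sup>2)"
  have KA: "0 < 9 * K + A / 2" using K(1) A by simp
  have e: "0 < e" using A C(1) KA by (simp add: e_def)
  have cancel: "X * (A / (32 * X * Y)) * Y = A / 32" if "0 < X" "0 < Y" for X Y :: real
    using that by (simp add: field_simps)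
  have eC: "(9 * K + A / 2) * e * C\<^sup>2 = A / 32" unfolding e_def by (rule cancel[OF KA]) (use C(1) in simp)
  obtain R where R: "0 < R"
    "\<And>(I::(real^('d + 'd)) set) p S z R'. R \<le> R' \<Longrightarrow> separated_family I p r0 N \<Longrightarrow> finite S \<Longrightarrow> S \<subseteq> I \<Longrightarrow>
      (\<Sum>i\<in>S. ambiguity g (p i - z) * (1 - overlap R' (p i) z)) \<le> e"
    by (rule ambiguity_overlap_sum[OF g r0 e, where 'i="real^('d + 'd)" and N=N]) blast
  obtain \<rho> where \<rho>: "0 < \<rho>" "\<And>(I::(real^('d + 'd)) set) p S z. separated_family I p r0 N \<Longrightarrow> finite S \<Longrightarrow> S \<subseteq> I \<Longrightarrow>
      (\<And>i. i \<in> S \<Longrightarrow> \<rho> \<le> norm (p i - z)) \<Longrightarrow> (\<Sum>i\<in>S. ambiguity g (p i - z)) \<le> e"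
    by (rule ambiguity_sum_tail[OF g r0 e, where 'i="real^('d + 'd)" and N=N]) blast
  obtain M where M: "separated_family \<Lambda> (\<lambda>z. z) (R + \<rho>) M"
    using separated_family_large_balls[OF sep r] by blast
  define \<eta> where "\<eta> = sqrt (A / (4 * (real M + 1)))"
  have \<eta>: "0 < \<eta>" using A by (simp add: \<eta>_def)
  have M\<eta>: "2 * real M * \<eta>\<^sup>2 \<le> A / 2"
  proof -
    have "2 * real M * \<eta>\<^sup>2 \<le> 2 * (real M + 1) * \<eta>\<^sup>2" by (intro mult_right_mono) auto
    also have "\<dots> = A / 2" using A by (simp add: \<eta>_def field_simps)
    finally show ?thesis .
  qed
  obtain d where d: "0 < d" "\<And>u. norm u < d \<Longrightarrow> L2_norm (\<lambda>t. tf_shift u g t - g t) < \<eta>"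
    using tf_shift_continuous_at_zero[OF gL2 \<eta>] by blast
  define \<epsilon> where "\<epsilon> = min (1/2) (d / (2 * (R + \<rho>)))"
  have \<epsilon>: "0 < \<epsilon>" "\<epsilon> \<le> 1/2" "\<epsilon> * (R + \<rho>) < d"
  proof -
    show "0 < \<epsilon>" using d R(1) \<rho>(1) by (simp add: \<epsilon>_def)
    show "\<epsilon> \<le> 1/2" unfolding \<epsilon>_def by (rule min.cobounded1)
    have "\<epsilon> * (R + \<rho>) \<le> d / (2 * (R + \<rho>)) * (R + \<rho>)" using R(1) \<rho>(1) by (intro mult_right_mono) (auto simp: \<epsilon>_def)
    also have "\<dots> = d / 2"
    proof -
      have "d / (2 * W) * W = d / 2" if "0 < W" for W :: real using that by simp
      from this[of "R + \<rho>"] R(1) \<rho>(1) show ?thesis by (simp only: add_pos_pos)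
    qed
    finally show "\<epsilon> * (R + \<rho>) < d" using d by simp
  qed
  \<comment> \<open>The cap 1/2 keeps at least half of the norm of \<open>f\<close> in
    \<open>f'\<close>; the other term pays for the Bessel bound applied to
    \<open>f - f'\<close>.\<close>
  define \<beta> where "\<beta> = min (1/2) (sqrt (A / (256 * K)))"
  have \<beta>: "0 < \<beta>" "\<beta> \<le> 1/2" "K * \<beta>\<^sup>2 \<le> A / 256"
  proof -
    show \<beta>0: "0 < \<beta>" "\<beta> \<le> 1/2" using A K(1) by (auto simp: \<beta>_def)
    have "\<beta>\<^sup>2 \<le> (sqrt (A / (256 * K)))\<^sup>2" using \<beta>0 by (intro power_mono) (auto simp: \<beta>_def)
    also have "\<dots> = A / (256 * K)" using A K(1) by simp
    finally have "K * \<beta>\<^sup>2 \<le> K * (A / (256 * K))" using K(1) by (intro mult_left_mono) auto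
    then show "K * \<beta>\<^sup>2 \<le> A / 256" using K(1) by simp
  qed
  have "\<exists>L. finite L \<and> L \<subseteq> \<Lambda> \<and> A / 128 * (L2_norm f)\<^sup>2 \<le> (\<Sum>l\<in>L. (cmod (L2_inner f (tf_shift (T l) g)))\<^sup>2)"
    if T: "lipschitz_perturbation \<epsilon> T" and f: "f \<in> L2" for T f
  proof -
    have sepT: "separated_family \<Lambda> T r0 N"
      unfolding r0_def by (rule separated_family_perturbed[OF sep1 T \<epsilon>(2)])
    obtain S c where S: "finite S" "S \<subseteq> \<Lambda>"
      and c: "(\<Sum>z\<in>S. (cmod (c z))\<^sup>2) \<le> (C * L2_norm f)\<^sup>2"
      and approx: "L2_norm (\<lambda>t. f t - (\<Sum>z\<in>S. c z * tf_shift z g t)) \<le> \<beta> * L2_norm f"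
      using C(2)[OF f \<beta>(1)] by blast
    define f' where "f' t = (\<Sum>z\<in>S. c z * tf_shift z g t)" for t
    have f': "f' \<in> L2" unfolding f'_def[abs_def] by (intro L2_lincomb L2_tf_shift gL2)
    let ?\<sigma> = "\<Sum>z\<in>S. (cmod (c z))\<^sup>2"
    let ?V = "measure lborel (ball (0::real^('d + 'd)) R)"
    have V: "0 < ?V" by (rule emeasure_ball_bounds(2)[OF R(1)])
    obtain M' where M': "separated_family \<Lambda> T (2 * (R + \<rho>) + R) M'"
      using separated_family_large_balls[OF sepT r0(1)] by blast
    \<comment> \<open>A finite set independent of the centre: if a node \<open>i\<close> of
      \<open>S\<close> lies in the ball about \<open>y\<close>, every \<open>l\<close> within
      \<open>R + \<rho>\<close> of \<open>y'\<close> has \<open>T l\<close> within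
      \<open>2 * (R + \<rho>)\<close> of \<open>y\<close>, hence within a further \<open>R\<close>
      of \<open>i\<close>.\<close>
    define L where "L = (\<Union>i\<in>S. {l \<in> \<Lambda>. dist (T l) i < 2 * (R + \<rho>) + R})"
    have L: "finite L" "L \<subseteq> \<Lambda>" using S(1) M' by (auto simp: L_def separated_family_def)
    define b where "b l i = L2_inner (tf_shift i g) (tf_shift (T l) g)" for l i
    let ?F = "\<lambda>y. (L2_norm (\<lambda>t. \<Sum>i\<in>S. (complex_of_real (ball_cut R y i) * c i) * tf_shift i g t))\<^sup>2"
    let ?X = "\<lambda>l y. (cmod (\<Sum>i\<in>S. (complex_of_real (ball_cut R y i) * c i) * b l i))\<^sup>2"
    let ?C = "\<lambda>y. \<Sum>i\<in>S. (cmod (complex_of_real (ball_cut R y i) * c i))\<^sup>2"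
    have loc1: "(\<Sum>j\<in>S. cmod (L2_inner (tf_shift j g) (tf_shift i g)) * (1 - overlap R j i)) \<le> e" for i
      using R(2)[OF order_refl sep0 S, of i]
      by (simp add: cmod_L2_inner_ambiguity gL2 ambiguity_diff_commute[OF gL2, of i])
    note loc = localization_formula[OF R(1) S(1), of "\<lambda>i. tf_shift i g" "\<lambda>i. i" e c, OF L2_tf_shift[OF gL2] loc1]
    have pt: "A / 2 * ?F y \<le> 2 * (\<Sum>l\<in>L. ?X l y) + K * e * ?C y" for y
    proof -
      let ?S = "{i \<in> S. dist i y < R}"
      have e1: "?C y = (\<Sum>z\<in>?S. (cmod (c z))\<^sup>2)"
        by (subst sum_ball_cut[OF S(1), of "\<lambda>i. i" y R]) (auto simp: ball_cut_simps intro!: sum.cong)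
      have e2: "(\<Sum>i\<in>S. (complex_of_real (ball_cut R y i) * c i) * tf_shift i g t) = (\<Sum>z\<in>?S. c z * tf_shift z g t)" for t
        by (subst sum_ball_cut[OF S(1), of "\<lambda>i. i" y R]) (auto simp: ball_cut_simps intro!: sum.cong)
      have e3: "(\<Sum>i\<in>S. (complex_of_real (ball_cut R y i) * c i) * b l i)
          = L2_inner (\<lambda>t. \<Sum>z\<in>?S. c z * tf_shift z g t) (tf_shift (T l) g)" for l
        by (subst sum_ball_cut[OF S(1), of "\<lambda>i. i" y R], simp add: ball_cut_simps)
          (subst L2_inner_sum_left, auto simp: ball_cut_simps b_def intro!: sum.cong L2_tf_shift gL2)
      show ?thesis
      \<comment> \<open>For centres far from \<open>S\<close> the localized piece is zero; the case
        is separated because \<open>L\<close> may then miss the nodes near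
        \<open>y'\<close>.\<close>
      proof (cases "?S = {}")
        case True
        have "0 \<le> 2 * (\<Sum>l\<in>L. ?X l y) + K * e * ?C y"
          using K(1) e by (intro add_nonneg_nonneg mult_nonneg_nonneg sum_nonneg) auto
        then show ?thesis unfolding e2 True by simp
      next
        case False
        then obtain i0 where i0: "i0 \<in> S" "dist i0 y < R" by auto
        obtain y' where y': "T y' = y" using lipschitz_perturbation_surj[OF T less_imp_le[OF \<epsilon>(1)] \<epsilon>(2)] by blast
        have "A / 2 * (L2_norm (\<lambda>t. \<Sum>z\<in>?S. c z * tf_shift z g t))\<^sup>2
            \<le> 2 * (\<Sum>l\<in>L. (cmod (L2_inner (\<lambda>t. \<Sum>z\<in>?S. c z * tf_shift z g t) (tf_shift (T l) g)))\<^sup>2)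
              + K * e * (\<Sum>i\<in>?S. (cmod (c i))\<^sup>2)"
        proof (rule local_frame_bound[OF gL2 A lower, where y=y and y'=y' and R=R and \<rho>=\<rho> and M=M and \<eta>=\<eta>])
          show "(\<Sum>i\<in>?S. ambiguity g (i - z)) \<le> K" for z
            by (rule K(2)[OF sep0]) (use S in auto)
          show "(\<Sum>i\<in>F. ambiguity g (i - z)) \<le> e" if "finite F" "F \<subseteq> \<Lambda>" "\<And>i. i \<in> F \<Longrightarrow> \<rho> \<le> norm (i - z)" for F z
            by (rule \<rho>(2)[OF sep0 that])
          show "finite {i \<in> \<Lambda>. dist i y' < R + \<rho>}" "card {i \<in> \<Lambda>. dist i y' < R + \<rho>} \<le> M"
            using M by (auto simp: separated_family_def)
          show "L2_norm (\<lambda>t. tf_shift (T l - l - (y - y')) g t - g t) \<le> \<eta>" if "l \<in> \<Lambda>" "dist l y' < R + \<rho>" for l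
          proof -
            have "norm (T l - l - (y - y')) = norm ((T l - T y') - (l - y'))" by (simp add: y' algebra_simps)
            also have "\<dots> \<le> \<epsilon> * norm (l - y')" by (rule lipschitz_perturbationD[OF T])
            also have "\<dots> \<le> \<epsilon> * (R + \<rho>)" using that(2) \<epsilon>(1) by (intro mult_left_mono) (auto simp: dist_norm)
            also have "\<dots> < d" by (rule \<epsilon>(3))
            finally show ?thesis using d(2) by (simp add: less_imp_le)
          qed
          show "{i \<in> \<Lambda>. dist i y' < R + \<rho>} \<subseteq> L"
          proof
            fix l assume l: "l \<in> {i \<in> \<Lambda>. dist i y' < R + \<rho>}"
            then have "dist (T l) y < 2 * (R + \<rho>)"
              using lipschitz_perturbation_bounds(2)[OF T \<epsilon>(2), of l y'] y' by (simp add: dist_norm)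
            then have "dist (T l) i0 < 2 * (R + \<rho>) + R"
              using i0(2) dist_triangle2[of "T l" i0 y] by linarith
            then show "l \<in> L" using l i0(1) by (auto simp: L_def)
          qed
        qed (use S(1) K(1) M\<eta> L(1) in auto)
        then show ?thesis unfolding e1 e2 e3 .
      qed
    qed
    have bK: "(\<Sum>i\<in>S. cmod (b l i)) \<le> K" for l
      using K(2)[OF sep0 S, of "T l"]
      by (simp add: b_def cmod_L2_inner_ambiguity gL2 ambiguity_diff_commute[OF gL2, of "T l"])
    note avg = ball_cut_inner_average[OF R(1) S(1) bK, where q="\<lambda>i. i" and c=c]
    let ?P = "\<Sum>l\<in>L. (cmod (\<Sum>i\<in>S. c i * b l i))\<^sup>2"
    \<comment> \<open>After exchanging the sums, the overlap defects are summed over the perturbed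
      nodes \<open>T l\<close>, where \<open>sepT\<close> makes the choice of \<open>R\<close>
      effective.\<close>
    have sumX: "(\<Sum>l\<in>L. \<integral>y. ?X l y \<partial>lborel) \<le> 2 * ?V * ?P + 4 * ?V * K * (e * ?\<sigma>)"
    proof -
      have "(\<Sum>l\<in>L. \<integral>y. ?X l y \<partial>lborel)
          \<le> (\<Sum>l\<in>L. 2 * ?V * (cmod (\<Sum>i\<in>S. c i * b l i))\<^sup>2
            + 4 * ?V * K * (\<Sum>i\<in>S. cmod (b l i) * (1 - overlap R i (T l)) * (cmod (c i))\<^sup>2))"
        by (intro sum_mono avg(2))
      also have "\<dots> = 2 * ?V * ?P + 4 * ?V * K * (\<Sum>i\<in>S. (\<Sum>l\<in>L. cmod (b l i) * (1 - overlap R i (T l))) * (cmod (c i))\<^sup>2)"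
        unfolding sum.distrib sum_distrib_left[symmetric] sum_distrib_right by (subst (2) sum.swap) simp
      also have "(\<Sum>i\<in>S. (\<Sum>l\<in>L. cmod (b l i) * (1 - overlap R i (T l))) * (cmod (c i))\<^sup>2) \<le> (\<Sum>i\<in>S. e * (cmod (c i))\<^sup>2)"
      proof (intro sum_mono mult_right_mono)
        fix i
        show "(\<Sum>l\<in>L. cmod (b l i) * (1 - overlap R i (T l))) \<le> e"
          using R(2)[OF order_refl sepT L, of i]
          by (simp add: b_def cmod_L2_inner_ambiguity gL2 overlap_commute[of R i])
      qed simp
      finally show ?thesis using V K(1) by (simp add: sum_distrib_left[symmetric] mult_left_mono)
    qed
    have "A / 2 * (?V * (L2_norm f')\<^sup>2 - ?V * e * ?\<sigma>) \<le> A / 2 * (\<integral>y. ?F y \<partial>lborel)"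
      using loc(2) A by (intro mult_left_mono) (auto simp: f'_def[abs_def])
    also have "\<dots> = (\<integral>y. A / 2 * ?F y \<partial>lborel)" by (rule integral_mult_right_zero[symmetric])
    also have "\<dots> \<le> (\<integral>y. 2 * (\<Sum>l\<in>L. ?X l y) + K * e * ?C y \<partial>lborel)"
      by (intro integral_mono pt integrable_mult_right loc(1) Bochner_Integration.integrable_add
          Bochner_Integration.integrable_sum avg(1) ball_cut_square_sum_integral(1)[OF R(1)])
    also have "\<dots> = (\<integral>y. 2 * (\<Sum>l\<in>L. ?X l y) \<partial>lborel) + (\<integral>y. K * e * ?C y \<partial>lborel)"
      by (intro Bochner_Integration.integral_add integrable_mult_right
          Bochner_Integration.integrable_sum avg(1) ball_cut_square_sum_integral(1)[OF R(1)])
    also have "\<dots> = 2 * (\<Sum>l\<in>L. \<integral>y. ?X l y \<partial>lborel) + K * e * (?V * ?\<sigma>)"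
      by (simp only: integral_mult_right_zero Bochner_Integration.integral_sum avg(1) ball_cut_square_sum_integral(2)[OF R(1)])
    also have "\<dots> \<le> 2 * (2 * ?V * ?P + 4 * ?V * K * (e * ?\<sigma>)) + K * e * (?V * ?\<sigma>)"
      by (intro add_right_mono mult_left_mono sumX) simp
    finally have "?V * (A / 2 * (L2_norm f')\<^sup>2) \<le> ?V * (4 * ?P + (9 * K + A / 2) * e * ?\<sigma>)"
      by (simp add: algebra_simps)
    then have main: "A / 2 * (L2_norm f')\<^sup>2 \<le> 4 * ?P + (9 * K + A / 2) * e * ?\<sigma>"
      using V by simp
    have "(9 * K + A / 2) * e * ?\<sigma> \<le> (9 * K + A / 2) * e * (C * L2_norm f)\<^sup>2"
      using KA e by (intro mult_left_mono c) auto
    also have "\<dots> = ((9 * K + A / 2) * e * C\<^sup>2) * (L2_norm f)\<^sup>2" by (simp add: power_mult_distrib)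
    also have "\<dots> = A / 32 * (L2_norm f)\<^sup>2" by (simp only: eC)
    finally have bound1: "(9 * K + A / 2) * e * ?\<sigma> \<le> A / 32 * (L2_norm f)\<^sup>2" .
    have ff': "L2_norm (\<lambda>t. f t - f' t) \<le> \<beta> * L2_norm f" using approx by (simp add: f'_def)
    have "\<beta> * L2_norm f \<le> 1 / 2 * L2_norm f" by (intro mult_right_mono \<beta>) simp
    then have "1 / 2 * L2_norm f \<le> L2_norm f'" using L2_norm_le_diff[OF f f'] ff' by linarith
    then have "(1 / 2 * L2_norm f)\<^sup>2 \<le> (L2_norm f')\<^sup>2" by (intro power_mono) auto
    then have "A / 2 * (1 / 2 * L2_norm f)\<^sup>2 \<le> A / 2 * (L2_norm f')\<^sup>2" using A by (intro mult_left_mono) auto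
    moreover have "A / 2 * (1 / 2 * L2_norm f)\<^sup>2 = A / 8 * (L2_norm f)\<^sup>2" by (simp add: power2_eq_square)
    ultimately have bound2: "A / 8 * (L2_norm f)\<^sup>2 \<le> A / 2 * (L2_norm f')\<^sup>2" by (simp only:)
    have P_eq: "(\<Sum>i\<in>S. c i * b l i) = L2_inner f (tf_shift (T l) g) + - L2_inner (\<lambda>t. f t - f' t) (tf_shift (T l) g)" for l
    proof -
      have "(\<Sum>i\<in>S. c i * b l i) = L2_inner f' (tf_shift (T l) g)"
        unfolding f'_def[abs_def] b_def by (subst L2_inner_sum_left) (auto intro: L2_tf_shift gL2)
      then show ?thesis by (simp add: L2_inner_diff_left f f' L2_tf_shift gL2)
    qed
    have "?P \<le> (\<Sum>l\<in>L. 2 * (cmod (L2_inner f (tf_shift (T l) g)))\<^sup>2 + 2 * (cmod (L2_inner (\<lambda>t. f t - f' t) (tf_shift (T l) g)))\<^sup>2)"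
      unfolding P_eq by (intro sum_mono order_trans[OF cmod_add_square_le]) simp
    also have "\<dots> = 2 * (\<Sum>l\<in>L. (cmod (L2_inner f (tf_shift (T l) g)))\<^sup>2) + 2 * (\<Sum>l\<in>L. (cmod (L2_inner (\<lambda>t. f t - f' t) (tf_shift (T l) g)))\<^sup>2)"
      by (simp add: sum.distrib sum_distrib_left)
    also have "(\<Sum>l\<in>L. (cmod (L2_inner (\<lambda>t. f t - f' t) (tf_shift (T l) g)))\<^sup>2) \<le> K * (L2_norm (\<lambda>t. f t - f' t))\<^sup>2"
      by (intro L2_Bessel_dual L2_diff f f' L2_tf_shift gL2 tf_Schur_synthesis K(2)[OF sepT] L less_imp_le[OF K(1)])
    also have "\<dots> \<le> K * (\<beta> * L2_norm f)\<^sup>2" using K(1) ff' by (intro mult_left_mono power_mono) auto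
    also have "\<dots> = (K * \<beta>\<^sup>2) * (L2_norm f)\<^sup>2" by (simp add: power_mult_distrib)
    also have "\<dots> \<le> A / 256 * (L2_norm f)\<^sup>2" by (intro mult_right_mono \<beta>(3)) simp
    finally have bound3: "?P \<le> 2 * (\<Sum>l\<in>L. (cmod (L2_inner f (tf_shift (T l) g)))\<^sup>2) + 2 * (A / 256 * (L2_norm f)\<^sup>2)"
      by simp
    \<comment> \<open>From \<open>A / 8\<close>, the loss \<open>A / 32\<close> in
      \<open>bound1\<close> and four times \<open>A / 128\<close> from \<open>bound3\<close> leave
      \<open>A / 16\<close>, against a factor 8 in front of the frame sum.\<close>
    have "A / 128 * (L2_norm f)\<^sup>2 \<le> (\<Sum>l\<in>L. (cmod (L2_inner f (tf_shift (T l) g)))\<^sup>2)"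
      using main bound1 bound2 bound3 by (simp add: field_simps)
    then show ?thesis using L by blast
  qed
  then show ?thesis using that \<epsilon> by blast
qed

subsection \<open>Frames and Riesz sequences via finite subsets\<close>

text \<open>Half of the lower bound is given up so that a finite subset, chosen for each
  \<open>f\<close>, already attains the rest.\<close>

lemma gabor_frame_finiteD:
  assumes "gabor_frame g \<Gamma>"
  obtains A B where "0 < A" "0 < B"
    "\<And>f. f \<in> L2 \<Longrightarrow> \<exists>S. finite S \<and> S \<subseteq> \<Gamma> \<and> A * (L2_norm f)\<^sup>2 \<le> (\<Sum>z\<in>S. (cmod (L2_inner f (tf_shift z g)))\<^sup>2)"
    "\<And>f S. f \<in> L2 \<Longrightarrow> finite S \<Longrightarrow> S \<subseteq> \<Gamma> \<Longrightarrow> (\<Sum>z\<in>S. (cmod (L2_inner f (tf_shift z g)))\<^sup>2) \<le> B * (L2_norm f)\<^sup>2"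
proof -
  let ?F = "\<lambda>f z. (cmod (L2_inner f (tf_shift z g)))\<^sup>2"
  obtain A B where AB: "0 < A" "A \<le> B" and fr: "\<And>f. f \<in> L2 \<Longrightarrow> ?F f summable_on \<Gamma> \<and>
      A * (L2_norm f)\<^sup>2 \<le> (\<Sum>\<^sub>\<infinity>z\<in>\<Gamma>. ?F f z) \<and> (\<Sum>\<^sub>\<infinity>z\<in>\<Gamma>. ?F f z) \<le> B * (L2_norm f)\<^sup>2"
    using assms unfolding gabor_frame_def by blast
  have lower: "\<exists>S. finite S \<and> S \<subseteq> \<Gamma> \<and> A / 2 * (L2_norm f)\<^sup>2 \<le> (\<Sum>z\<in>S. ?F f z)" if f: "f \<in> L2" for f
  proof (cases "L2_norm f = 0")
    case True
    then show ?thesis by (intro exI[of _ "{}"]) simp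
  next
    case False
    then have pos: "0 < A / 2 * (L2_norm f)\<^sup>2" using AB by simp
    obtain S where S: "finite S" "S \<subseteq> \<Gamma>" "dist (\<Sum>z\<in>S. ?F f z) (\<Sum>\<^sub>\<infinity>z\<in>\<Gamma>. ?F f z) \<le> A / 2 * (L2_norm f)\<^sup>2"
      using infsum_finite_approximation[of "?F f" \<Gamma>, OF _ pos] fr[OF f] by blast
    have "A / 2 * (L2_norm f)\<^sup>2 \<le> (\<Sum>z\<in>S. ?F f z)"
    proof -
      have "A * (L2_norm f)\<^sup>2 \<le> (\<Sum>\<^sub>\<infinity>z\<in>\<Gamma>. ?F f z)" using fr[OF f] by blast
      then show ?thesis using S(3) unfolding dist_real_def by linarith
    qed
    then show ?thesis using S by blast
  qed
  have upper: "(\<Sum>z\<in>S. ?F f z) \<le> B * (L2_norm f)\<^sup>2" if "f \<in> L2" "finite S" "S \<subseteq> \<Gamma>" for f S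
    using finite_sum_le_infsum[of "?F f" \<Gamma> S] fr[OF that(1)] that(2,3) by fastforce
  show ?thesis by (rule that[of "A / 2" B]) (use AB lower upper in auto)
qed

text \<open>Bounded finite sums of nonnegative terms give summability; \<open>max A B\<close>
  secures the order of the two constants that the definition demands.\<close>

lemma gabor_frame_finiteI:
  assumes A: "0 < A"
    and lower: "\<And>f. f \<in> L2 \<Longrightarrow> \<exists>S. finite S \<and> S \<subseteq> \<Gamma> \<and> A * (L2_norm f)\<^sup>2 \<le> (\<Sum>z\<in>S. (cmod (L2_inner f (tf_shift z g)))\<^sup>2)"
    and upper: "\<And>f S. f \<in> L2 \<Longrightarrow> finite S \<Longrightarrow> S \<subseteq> \<Gamma> \<Longrightarrow> (\<Sum>z\<in>S. (cmod (L2_inner f (tf_shift z g)))\<^sup>2) \<le> B * (L2_norm f)\<^sup>2"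
  shows "gabor_frame g \<Gamma>"
  unfolding gabor_frame_def
proof (rule exI[of _ A], rule exI[of _ "max A B"], intro conjI ballI)
  let ?F = "\<lambda>f z. (cmod (L2_inner f (tf_shift z g)))\<^sup>2"
  fix f assume f: "f \<in> (L2 :: (real^'a \<Rightarrow> complex) set)"
  show sum: "?F f summable_on \<Gamma>"
    by (rule nonneg_bdd_above_summable_on) (use upper[OF f] in \<open>auto intro!: bdd_aboveI\<close>)
  obtain S where S: "finite S" "S \<subseteq> \<Gamma>" "A * (L2_norm f)\<^sup>2 \<le> (\<Sum>z\<in>S. ?F f z)" using lower[OF f] by blast
  then show "A * (L2_norm f)\<^sup>2 \<le> (\<Sum>\<^sub>\<infinity>z\<in>\<Gamma>. ?F f z)"
    using finite_sum_le_infsum[OF sum S(1,2)] by fastforce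
  have "(\<Sum>\<^sub>\<infinity>z\<in>\<Gamma>. ?F f z) \<le> B * (L2_norm f)\<^sup>2" by (rule infsum_le_finite_sums[OF sum upper[OF f]])
  also have "\<dots> \<le> max A B * (L2_norm f)\<^sup>2" by (intro mult_right_mono) auto
  finally show "(\<Sum>\<^sub>\<infinity>z\<in>\<Gamma>. ?F f z) \<le> max A B * (L2_norm f)\<^sup>2" .
qed (use A in auto)

text \<open>For coefficients extended by 0 the partial sums are constant from \<open>S\<close> on,
  so the abstract sum \<open>F\<close> has distance 0 from the finite one.\<close>

lemma gabor_riesz_sequence_finiteD:
  fixes g :: "real^'d \<Rightarrow> complex"
  assumes g: "g \<in> L2" and riesz: "gabor_riesz_sequence g \<Gamma>"
  obtains A B where "0 < A" "0 < B"
    "\<And>S c. finite S \<Longrightarrow> S \<subseteq> \<Gamma> \<Longrightarrow> A * sqrt (\<Sum>z\<in>S. (cmod (c z))\<^sup>2) \<le> L2_norm (\<lambda>t. \<Sum>z\<in>S. c z * tf_shift z g t)"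
    "\<And>S c. finite S \<Longrightarrow> S \<subseteq> \<Gamma> \<Longrightarrow> L2_norm (\<lambda>t. \<Sum>z\<in>S. c z * tf_shift z g t) \<le> B * sqrt (\<Sum>z\<in>S. (cmod (c z))\<^sup>2)"
proof -
  obtain A B where AB: "0 < A" "A \<le> B" and R: "\<And>c :: real^('d + 'd) \<Rightarrow> complex. (\<lambda>z. (cmod (c z))\<^sup>2) summable_on \<Gamma> \<Longrightarrow>
      \<exists>F. has_L2_sum (\<lambda>z t. c z * tf_shift z g t) F \<Gamma> \<and>
        A * sqrt (\<Sum>\<^sub>\<infinity>z\<in>\<Gamma>. (cmod (c z))\<^sup>2) \<le> L2_norm F \<and> L2_norm F \<le> B * sqrt (\<Sum>\<^sub>\<infinity>z\<in>\<Gamma>. (cmod (c z))\<^sup>2)"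
    using riesz unfolding gabor_riesz_sequence_def by blast
  have main: "A * sqrt (\<Sum>z\<in>S. (cmod (c z))\<^sup>2) \<le> L2_norm (\<lambda>t. \<Sum>z\<in>S. c z * tf_shift z g t) \<and>
      L2_norm (\<lambda>t. \<Sum>z\<in>S. c z * tf_shift z g t) \<le> B * sqrt (\<Sum>z\<in>S. (cmod (c z))\<^sup>2)"
    if S: "finite S" "S \<subseteq> \<Gamma>" for S and c :: "real^('d + 'd) \<Rightarrow> complex"
  proof -
    define b where "b z = (if z \<in> S then c z else 0)" for z
    have hs: "((\<lambda>z. (cmod (b z))\<^sup>2) has_sum (\<Sum>z\<in>S. (cmod (c z))\<^sup>2)) \<Gamma>"
    proof -
      have "((\<lambda>z. (cmod (c z))\<^sup>2) has_sum (\<Sum>z\<in>S. (cmod (c z))\<^sup>2)) S" by (rule has_sum_finite[OF S(1)])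
      then show ?thesis by (rule has_sum_cong_neutral[THEN iffD1, rotated 3]) (use S in \<open>auto simp: b_def\<close>)
    qed
    have sm: "(\<lambda>z. (cmod (b z))\<^sup>2) summable_on \<Gamma>" "(\<Sum>\<^sub>\<infinity>z\<in>\<Gamma>. (cmod (b z))\<^sup>2) = (\<Sum>z\<in>S. (cmod (c z))\<^sup>2)"
      using hs by (auto simp: has_sum_iff)
    obtain F where F: "has_L2_sum (\<lambda>z t. b z * tf_shift z g t) F \<Gamma>"
      "A * sqrt (\<Sum>z\<in>S. (cmod (c z))\<^sup>2) \<le> L2_norm F" "L2_norm F \<le> B * sqrt (\<Sum>z\<in>S. (cmod (c z))\<^sup>2)"
      using R[OF sm(1)] unfolding sm(2) by blast
    let ?D = "\<lambda>t. \<Sum>z\<in>S. c z * tf_shift z g t"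
    have D: "?D \<in> L2" by (intro L2_lincomb L2_tf_shift g)
    have FL2: "F \<in> L2" using F(1) by (simp add: has_L2_sum_def)
    have "((\<lambda>S. L2_norm (\<lambda>t. (\<Sum>z\<in>S. b z * tf_shift z g t) - F t)) \<longlongrightarrow> 0) (finite_subsets_at_top \<Gamma>)"
      using F(1) by (simp add: has_L2_sum_def)
    moreover have "\<forall>\<^sub>F S' in finite_subsets_at_top \<Gamma>.
        L2_norm (\<lambda>t. (\<Sum>z\<in>S'. b z * tf_shift z g t) - F t) = L2_norm (\<lambda>t. ?D t - F t)"
      unfolding eventually_finite_subsets_at_top
    proof (rule exI[of _ S], intro conjI allI impI)
      fix S' assume S': "finite S' \<and> S \<subseteq> S' \<and> S' \<subseteq> \<Gamma>"
      have "(\<Sum>z\<in>S'. b z * tf_shift z g t) = ?D t" for t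
      proof -
        have "(\<Sum>z\<in>S'. b z * tf_shift z g t) = (\<Sum>z\<in>S. b z * tf_shift z g t)"
          by (rule sum.mono_neutral_right) (use S' in \<open>auto simp: b_def\<close>)
        then show ?thesis by (simp add: b_def)
      qed
      then show "L2_norm (\<lambda>t. (\<Sum>z\<in>S'. b z * tf_shift z g t) - F t) = L2_norm (\<lambda>t. ?D t - F t)" by simp
    qed (use S in auto)
    ultimately have "((\<lambda>_. L2_norm (\<lambda>t. ?D t - F t)) \<longlongrightarrow> 0) (finite_subsets_at_top \<Gamma>)"
      by (rule Lim_transform_eventually)
    then have z: "L2_norm (\<lambda>t. ?D t - F t) = 0"
      by (simp add: tendsto_const_iff)
    have "L2_norm ?D \<le> L2_norm F" using L2_norm_le_diff[OF D FL2] z by simp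
    moreover have "L2_norm F \<le> L2_norm ?D"
      using L2_norm_le_diff[OF FL2 D] z by (simp add: L2_norm_commute[of F])
    ultimately show ?thesis using F(2,3) by simp
  qed
  show ?thesis by (rule that[of A B]) (use AB main in auto)
qed

text \<open>Finite sets \<open>U n\<close> capture all but \<open>\<delta> n\<close> of the
  coefficient mass, and the upper bound then keeps every larger finite sum within
  \<open>(1/2)^n\<close> of the one over \<open>U n\<close>. The limit along this sequence is
  therefore the limit of the whole net.\<close>

lemma gabor_riesz_sequence_finiteI:
  fixes g :: "real^'d \<Rightarrow> complex"
  assumes g: "g \<in> L2" and A: "0 < A" and B: "0 < B"
    and lower: "\<And>S c. finite S \<Longrightarrow> S \<subseteq> \<Gamma> \<Longrightarrow> A * sqrt (\<Sum>z\<in>S. (cmod (c z))\<^sup>2) \<le> L2_norm (\<lambda>t. \<Sum>z\<in>S. c z * tf_shift z g t)"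
    and upper: "\<And>S c. finite S \<Longrightarrow> S \<subseteq> \<Gamma> \<Longrightarrow> L2_norm (\<lambda>t. \<Sum>z\<in>S. c z * tf_shift z g t) \<le> B * sqrt (\<Sum>z\<in>S. (cmod (c z))\<^sup>2)"
  shows "gabor_riesz_sequence g \<Gamma>"
  unfolding gabor_riesz_sequence_def
proof (rule exI[of _ A], rule exI[of _ "max A B"], intro conjI allI impI)
  fix c :: "real^('d + 'd) \<Rightarrow> complex"
  assume sm: "(\<lambda>z. (cmod (c z))\<^sup>2) summable_on \<Gamma>"
  let ?q = "\<lambda>z. (cmod (c z))\<^sup>2"
  let ?D = "\<lambda>S t. \<Sum>z\<in>S. c z * tf_shift z g t"
  define s where "s = (\<Sum>\<^sub>\<infinity>z\<in>\<Gamma>. ?q z)"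
  have DL2: "?D S \<in> L2" for S by (intro L2_lincomb L2_tf_shift g)
  have lim: "((\<lambda>S. \<Sum>z\<in>S. ?q z) \<longlongrightarrow> s) (finite_subsets_at_top \<Gamma>)"
    using sm by (simp add: s_def summable_iff_has_sum_infsum has_sum_def)
  have sum_le: "(\<Sum>z\<in>S. ?q z) \<le> s" if "finite S" "S \<subseteq> \<Gamma>" for S
    unfolding s_def by (rule finite_sum_le_infsum[OF sm that]) simp
  \<comment> \<open>The square undoes the root in the coefficient norm, and \<open>B\<close> cancels
    the constant of the upper bound.\<close>
  define \<delta> where "\<delta> n = ((1/2)^n / B)\<^sup>2" for n :: nat
  have \<delta>: "0 < \<delta> n" for n using B by (simp add: \<delta>_def)
  have "\<exists>X. finite X \<and> X \<subseteq> \<Gamma> \<and> s - \<delta> n < (\<Sum>z\<in>X. ?q z)" for n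
  proof -
    have "\<forall>\<^sub>F S in finite_subsets_at_top \<Gamma>. s - \<delta> n < (\<Sum>z\<in>S. ?q z)"
      using order_tendstoD(1)[OF lim] \<delta>[of n] by simp
    then show ?thesis unfolding eventually_finite_subsets_at_top by blast
  qed
  then obtain X where X: "\<And>n. finite (X n)" "\<And>n. X n \<subseteq> \<Gamma>" "\<And>n. s - \<delta> n < (\<Sum>z\<in>X n. ?q z)" by metis
  define U where "U n = (\<Union>k\<le>n. X k)" for n
  have U: "finite (U n)" "U n \<subseteq> \<Gamma>" "X n \<subseteq> U n" for n
    using X by (auto simp: U_def)
  have U_Suc: "U n \<subseteq> U (Suc n)" for n
    unfolding U_def by (rule UN_mono) auto
  have tail: "L2_norm (\<lambda>t. ?D S t - ?D (U n) t) \<le> (1/2)^n" if S: "finite S" "U n \<subseteq> S" "S \<subseteq> \<Gamma>" for S n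
  proof -
    have split: "(\<Sum>z\<in>S. h z) = (\<Sum>z\<in>S - U n. h z) + (\<Sum>z\<in>U n. h z)" for h :: "real^('d + 'd) \<Rightarrow> 'v::comm_monoid_add"
      by (rule sum.subset_diff[OF S(2,1)])
    have "(\<Sum>z\<in>X n. ?q z) \<le> (\<Sum>z\<in>U n. ?q z)" by (rule sum_mono2[OF U(1,3)]) simp
    then have "(\<Sum>z\<in>S - U n. ?q z) \<le> \<delta> n"
      using split[of ?q] sum_le[OF S(1,3)] X(3)[of n] by linarith
    then have "sqrt (\<Sum>z\<in>S - U n. ?q z) \<le> (1/2)^n / B"
      using B by (intro real_le_lsqrt) (auto simp: \<delta>_def)
    then have "B * sqrt (\<Sum>z\<in>S - U n. ?q z) \<le> (1/2)^n" using B by (simp add: field_simps)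
    moreover have "L2_norm (?D (S - U n)) \<le> B * sqrt (\<Sum>z\<in>S - U n. ?q z)"
      by (rule upper) (use S in auto)
    moreover have "(\<lambda>t. ?D S t - ?D (U n) t) = ?D (S - U n)"
    proof
      fix t
      show "?D S t - ?D (U n) t = ?D (S - U n) t"
        using split[of "\<lambda>z. c z * tf_shift z g t"] by simp
    qed
    ultimately show ?thesis by simp
  qed
  obtain F where F: "F \<in> L2" "\<And>n. L2_norm (\<lambda>t. ?D (U n) t - F t) \<le> 2 * (1/2)^n"
    by (rule L2_Cauchy_limit[of "\<lambda>n. ?D (U n)"]) (use DL2 tail U U_Suc in auto)
  have lim0: "((\<lambda>S. L2_norm (\<lambda>t. ?D S t - F t)) \<longlongrightarrow> 0) (finite_subsets_at_top \<Gamma>)"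
  proof (rule tendstoI)
    fix e :: real assume e: "0 < e"
    obtain n where n: "(1/2::real)^n < e / 3" using real_arch_pow_inv[of "e / 3" "1/2"] e by auto
    show "\<forall>\<^sub>F S in finite_subsets_at_top \<Gamma>. dist (L2_norm (\<lambda>t. ?D S t - F t)) 0 < e"
      unfolding eventually_finite_subsets_at_top
    proof (rule exI[of _ "U n"], intro conjI allI impI)
      fix S assume S: "finite S \<and> U n \<subseteq> S \<and> S \<subseteq> \<Gamma>"
      have "L2_norm (\<lambda>t. ?D S t - F t) \<le> L2_norm (\<lambda>t. ?D S t - ?D (U n) t) + L2_norm (\<lambda>t. ?D (U n) t - F t)"
        using L2_norm_triangle[OF L2_diff[OF DL2 DL2] L2_diff[OF DL2 F(1)], of S "U n" "U n"] by simp
      also have "\<dots> \<le> (1/2)^n + 2 * (1/2)^n" using tail[of S n] S F(2)[of n] by (intro add_mono) auto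
      also have "\<dots> < e" using n by simp
      finally show "dist (L2_norm (\<lambda>t. ?D S t - F t)) 0 < e" by simp
    qed (use U in auto)
  qed
  have normF: "((\<lambda>S. L2_norm (?D S)) \<longlongrightarrow> L2_norm F) (finite_subsets_at_top \<Gamma>)"
  proof (rule LIM_zero_cancel, rule Lim_null_comparison[OF _ lim0], intro always_eventually allI)
    fix S
    show "norm (L2_norm (?D S) - L2_norm F) \<le> L2_norm (\<lambda>t. ?D S t - F t)"
      using L2_norm_le_diff[OF DL2 F(1), of S] L2_norm_le_diff[OF F(1) DL2, of S]
      by (simp add: L2_norm_commute[of F] abs_le_iff)
  qed
  have ev: "\<forall>\<^sub>F S in finite_subsets_at_top \<Gamma>. finite S \<and> S \<subseteq> \<Gamma>"
    by (rule eventually_finite_subsets_at_top_weakI) auto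
  show "\<exists>F. has_L2_sum (\<lambda>z t. c z * tf_shift z g t) F \<Gamma> \<and>
      A * sqrt (\<Sum>\<^sub>\<infinity>z\<in>\<Gamma>. ?q z) \<le> L2_norm F \<and> L2_norm F \<le> max A B * sqrt (\<Sum>\<^sub>\<infinity>z\<in>\<Gamma>. ?q z)"
  proof (intro exI[of _ F] conjI)
    show "has_L2_sum (\<lambda>z t. c z * tf_shift z g t) F \<Gamma>"
      using F(1) lim0 by (simp add: has_L2_sum_def)
    show "A * sqrt (\<Sum>\<^sub>\<infinity>z\<in>\<Gamma>. ?q z) \<le> L2_norm F"
    proof (rule tendsto_le[OF _ normF])
      show "((\<lambda>S. A * sqrt (\<Sum>z\<in>S. ?q z)) \<longlongrightarrow> A * sqrt (\<Sum>\<^sub>\<infinity>z\<in>\<Gamma>. ?q z)) (finite_subsets_at_top \<Gamma>)"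
        using lim unfolding s_def by (intro tendsto_intros)
      show "\<forall>\<^sub>F S in finite_subsets_at_top \<Gamma>. A * sqrt (\<Sum>z\<in>S. ?q z) \<le> L2_norm (?D S)"
        using ev by eventually_elim (auto intro: lower)
    qed simp
    have "L2_norm F \<le> B * sqrt (\<Sum>\<^sub>\<infinity>z\<in>\<Gamma>. ?q z)"
    proof (rule tendsto_le[OF _ _ normF])
      show "((\<lambda>S. B * sqrt (\<Sum>z\<in>S. ?q z)) \<longlongrightarrow> B * sqrt (\<Sum>\<^sub>\<infinity>z\<in>\<Gamma>. ?q z)) (finite_subsets_at_top \<Gamma>)"
        using lim unfolding s_def by (intro tendsto_intros)
      show "\<forall>\<^sub>F S in finite_subsets_at_top \<Gamma>. L2_norm (?D S) \<le> B * sqrt (\<Sum>z\<in>S. ?q z)"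
        using ev by eventually_elim (auto intro: upper)
    qed simp
    also have "\<dots> \<le> max A B * sqrt (\<Sum>\<^sub>\<infinity>z\<in>\<Gamma>. ?q z)"
      by (intro mult_right_mono real_sqrt_ge_zero infsum_nonneg) auto
    finally show "L2_norm F \<le> max A B * sqrt (\<Sum>\<^sub>\<infinity>z\<in>\<Gamma>. ?q z)" .
  qed
qed (use A in auto)

text \<open>Continuity of the shifts keeps the ambiguity function above half the squared norm of
  \<open>g\<close> near the origin. When the Bessel bound is tested with
  \<open>tf_shift z g\<close>, every node within \<open>r\<close> of \<open>z\<close> contributes at
  least a quarter of the fourth power of that norm, which limits their number.\<close>

lemma Bessel_imp_separated:
  fixes g :: "real^'d \<Rightarrow> complex"
  assumes g: "g \<in> L2" "L2_norm g \<noteq> 0"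
    and Bessel: "\<And>f S. f \<in> L2 \<Longrightarrow> finite S \<Longrightarrow> S \<subseteq> \<Lambda> \<Longrightarrow>
      (\<Sum>z\<in>S. (cmod (L2_inner f (tf_shift z g)))\<^sup>2) \<le> B * (L2_norm f)\<^sup>2"
  obtains r N where "0 < r" "separated_family \<Lambda> (\<lambda>z. z) r N"
proof -
  let ?n = "L2_norm g"
  have n: "0 < ?n" using g(2) L2_norm_nonneg[of g] by linarith
  obtain r where r: "0 < r" "\<And>u. norm u < r \<Longrightarrow> L2_norm (\<lambda>t. tf_shift u g t - g t) < ?n / 2"
    using tf_shift_continuous_at_zero[OF g(1), of "?n / 2"] n by auto
  have amb: "?n\<^sup>2 / 2 \<le> ambiguity g u" if u: "norm u < r" for u
  proof -
    have "L2_inner g (tf_shift u g) = L2_inner g g + L2_inner g (\<lambda>t. tf_shift u g t - g t)"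
      by (simp add: L2_inner_diff_right L2_tf_shift g(1))
    moreover have "cmod (L2_inner g (\<lambda>t. tf_shift u g t - g t)) \<le> ?n * (?n / 2)"
    proof (rule order_trans[OF L2_Cauchy_Schwarz[OF g(1) L2_diff[OF L2_tf_shift[OF g(1)] g(1)]]])
      show "?n * L2_norm (\<lambda>t. tf_shift u g t - g t) \<le> ?n * (?n / 2)"
        using r(2)[OF u] n by (intro mult_left_mono) auto
    qed
    moreover have "cmod (L2_inner g g) = ?n\<^sup>2" by (simp add: L2_inner_self norm_power)
    moreover have "cmod (L2_inner g g) - cmod (L2_inner g (\<lambda>t. tf_shift u g t - g t))
        \<le> cmod (L2_inner g g + L2_inner g (\<lambda>t. tf_shift u g t - g t))"
      by (rule norm_diff_ineq)
    ultimately show ?thesis by (simp add: ambiguity_def power2_eq_square)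
  qed
  define N where "N = nat \<lceil>4 * B / ?n\<^sup>2\<rceil>"
  have "finite {i \<in> \<Lambda>. dist i z < r} \<and> card {i \<in> \<Lambda>. dist i z < r} \<le> N" for z
  proof (rule finite_if_finite_subsets_card_bdd)
    fix G assume G: "G \<subseteq> {i \<in> \<Lambda>. dist i z < r}" "finite G"
    have "real (card G) * (?n\<^sup>2 / 2)\<^sup>2 = (\<Sum>i\<in>G. (?n\<^sup>2 / 2)\<^sup>2)" by simp
    also have "\<dots> \<le> (\<Sum>i\<in>G. (cmod (L2_inner (tf_shift z g) (tf_shift i g)))\<^sup>2)"
    proof (intro sum_mono power_mono)
      fix i assume "i \<in> G"
      then have "norm (i - z) < r" using G by (auto simp: dist_norm)
      then show "?n\<^sup>2 / 2 \<le> cmod (L2_inner (tf_shift z g) (tf_shift i g))"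
        using amb by (simp add: cmod_L2_inner_ambiguity g(1))
    qed simp
    also have "\<dots> \<le> B * (L2_norm (tf_shift z g))\<^sup>2"
      by (rule Bessel) (use G g(1) in \<open>auto intro: L2_tf_shift\<close>)
    also have "\<dots> = B * ?n\<^sup>2" by (simp add: L2_norm_tf_shift g(1))
    finally have "real (card G) * ?n\<^sup>2 * ?n\<^sup>2 \<le> (4 * B) * ?n\<^sup>2"
      by (simp add: power2_eq_square)
    then have "real (card G) * ?n\<^sup>2 \<le> 4 * B" using n by simp
    then have "real (card G) \<le> 4 * B / ?n\<^sup>2" using n by (simp add: pos_le_divide_eq)
    then show "card G \<le> N" unfolding N_def by linarith
  qed
  then have "separated_family \<Lambda> (\<lambda>z. z) r N" by (simp add: separated_family_def)
  then show ?thesis using that r(1) by blast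
qed

text \<open>One \<open>K\<close> serves all admissible \<open>T\<close>, since each of them leaves
  \<open>N\<close> unchanged and reduces the separation radius from \<open>min r 1\<close> to a
  quarter of it.\<close>

lemma perturbed_synthesis_bound:
  fixes g :: "real^'d \<Rightarrow> complex"
  assumes g: "g \<in> M1" and r: "0 < r" and sep: "separated_family \<Lambda> (\<lambda>z. z) r N"
  obtains K where "0 < K"
    "\<And>\<epsilon> T S c. lipschitz_perturbation \<epsilon> T \<Longrightarrow> \<epsilon> \<le> 1/2 \<Longrightarrow> finite S \<Longrightarrow> S \<subseteq> \<Lambda> \<Longrightarrow>
      (L2_norm (\<lambda>t. \<Sum>z\<in>S. c z * tf_shift (T z) g t))\<^sup>2 \<le> K * (\<Sum>z\<in>S. (cmod (c z))\<^sup>2)"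
proof -
  have gL2: "g \<in> L2" using g by (simp add: M1_def)
  define r0 where "r0 = min r 1 / 4"
  have r0: "0 < r0" "r0 \<le> 1" using r by (auto simp: r0_def)
  have sep1: "separated_family \<Lambda> (\<lambda>z. z) (min r 1) N" by (rule separated_family_mono[OF sep]) simp
  obtain K where K: "0 < K"
    "\<And>(I::(real^('d + 'd)) set) p S z. separated_family I p r0 N \<Longrightarrow> finite S \<Longrightarrow> S \<subseteq> I \<Longrightarrow>
      (\<Sum>i\<in>S. ambiguity g (p i - z)) \<le> K"
    by (rule ambiguity_sum_bounded[OF g r0, where 'i="real^('d + 'd)" and N=N]) blast
  show ?thesis
  proof (rule that[OF K(1)])
    fix \<epsilon> and T :: "real^('d + 'd) \<Rightarrow> real^('d + 'd)" and S and c :: "real^('d + 'd) \<Rightarrow> complex"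
    assume T: "lipschitz_perturbation \<epsilon> T" "\<epsilon> \<le> 1/2" and S: "finite S" "S \<subseteq> \<Lambda>"
    have sepT: "separated_family \<Lambda> T r0 N"
      unfolding r0_def by (rule separated_family_perturbed[OF sep1 T])
    show "(L2_norm (\<lambda>t. \<Sum>z\<in>S. c z * tf_shift (T z) g t))\<^sup>2 \<le> K * (\<Sum>z\<in>S. (cmod (c z))\<^sup>2)"
      by (rule tf_Schur_synthesis[OF gL2 S(1) K(2)[OF sepT S]])
  qed
qed

lemma gabor_frame_perturbation:
  fixes g :: "real^'d \<Rightarrow> complex"
  assumes g: "g \<in> M1" and frame: "gabor_frame g \<Lambda>"
  obtains \<epsilon> where "0 < \<epsilon>" "\<And>T. lipschitz_perturbation \<epsilon> T \<Longrightarrow> gabor_frame g (T ` \<Lambda>)"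
proof -
  have gL2: "g \<in> L2" using g by (simp add: M1_def)
  obtain A B where AB: "0 < A" "0 < B"
    and lower: "\<And>f. f \<in> L2 \<Longrightarrow> \<exists>S. finite S \<and> S \<subseteq> \<Lambda> \<and> A * (L2_norm f)\<^sup>2 \<le> (\<Sum>z\<in>S. (cmod (L2_inner f (tf_shift z g)))\<^sup>2)"
    and upper: "\<And>f S. f \<in> L2 \<Longrightarrow> finite S \<Longrightarrow> S \<subseteq> \<Lambda> \<Longrightarrow> (\<Sum>z\<in>S. (cmod (L2_inner f (tf_shift z g)))\<^sup>2) \<le> B * (L2_norm f)\<^sup>2"
    using gabor_frame_finiteD[OF frame] by metis
  \<comment> \<open>A window of norm 0 has only zero coefficients, against the lower bound for the
    Gaussian, a vector known to be nonzero.\<close>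
  have "L2_norm g \<noteq> 0"
  proof
    assume z: "L2_norm g = 0"
    have "cmod (L2_inner f (tf_shift w g)) \<le> 0" if "f \<in> L2" for f w
      using L2_Cauchy_Schwarz[OF that L2_tf_shift[OF gL2], of w] z by (simp add: L2_norm_tf_shift gL2)
    then have "A * (L2_norm (gauss_window :: real^'d \<Rightarrow> complex))\<^sup>2 \<le> 0"
      using lower[OF gauss_window_L2] gauss_window_L2 by fastforce
    then show False using AB(1) gauss_window_norm_pos[where 'd='d] by (simp add: mult_le_0_iff)
  qed
  then obtain r N where r: "0 < r" and sep: "separated_family \<Lambda> (\<lambda>z. z) r N"
    using Bessel_imp_separated[OF gL2 _ upper] by blast
  obtain K where K: "0 < K"
    "\<And>\<epsilon> T S c. lipschitz_perturbation \<epsilon> T \<Longrightarrow> \<epsilon> \<le> 1/2 \<Longrightarrow> finite S \<Longrightarrow> S \<subseteq> \<Lambda> \<Longrightarrow>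
      (L2_norm (\<lambda>t. \<Sum>z\<in>S. c z * tf_shift (T z) g t))\<^sup>2 \<le> K * (\<Sum>z\<in>S. (cmod (c z))\<^sup>2)"
    by (rule perturbed_synthesis_bound[OF g r sep]) blast
  obtain \<epsilon> where \<epsilon>: "0 < \<epsilon>" "\<epsilon> \<le> 1/2"
    and low: "\<And>T f. lipschitz_perturbation \<epsilon> T \<Longrightarrow> f \<in> L2 \<Longrightarrow> \<exists>L. finite L \<and> L \<subseteq> \<Lambda> \<and>
      A / 128 * (L2_norm f)\<^sup>2 \<le> (\<Sum>l\<in>L. (cmod (L2_inner f (tf_shift (T l) g)))\<^sup>2)"
    by (rule frame_deformation[OF g r sep AB(1) lower]) blast+
  have "gabor_frame g (T ` \<Lambda>)" if T: "lipschitz_perturbation \<epsilon> T" for T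
  proof (rule gabor_frame_finiteI[where A="A / 128" and B=K])
    have inj: "inj_on T S" for S
      using lipschitz_perturbation_inj[OF T \<epsilon>(2)] by (rule inj_on_subset) simp
    fix f :: "real^'d \<Rightarrow> complex" assume f: "f \<in> L2"
    obtain L where "finite L" "L \<subseteq> \<Lambda>" "A / 128 * (L2_norm f)\<^sup>2 \<le> (\<Sum>l\<in>L. (cmod (L2_inner f (tf_shift (T l) g)))\<^sup>2)"
      using low[OF T f] by blast
    then show "\<exists>S. finite S \<and> S \<subseteq> T ` \<Lambda> \<and> A / 128 * (L2_norm f)\<^sup>2 \<le> (\<Sum>z\<in>S. (cmod (L2_inner f (tf_shift z g)))\<^sup>2)"
      by (intro exI[of _ "T ` L"]) (auto simp: sum.reindex[OF inj])
    fix S assume S: "finite S" "S \<subseteq> T ` \<Lambda>"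
    then obtain S' where S': "finite S'" "S' \<subseteq> \<Lambda>" "S = T ` S'" by (metis finite_subset_image)
    have "(\<Sum>z\<in>S'. (cmod (L2_inner f (tf_shift (T z) g)))\<^sup>2) \<le> K * (L2_norm f)\<^sup>2"
      by (intro L2_Bessel_dual f L2_tf_shift gL2 K(2)[OF T \<epsilon>(2) S'(1,2)] less_imp_le[OF K(1)])
    then show "(\<Sum>z\<in>S. (cmod (L2_inner f (tf_shift z g)))\<^sup>2) \<le> K * (L2_norm f)\<^sup>2"
      by (simp add: S'(3) sum.reindex[OF inj])
  qed (use AB in simp)
  then show ?thesis using that \<epsilon>(1) by blast
qed

lemma gabor_riesz_sequence_perturbation:
  fixes g :: "real^'d \<Rightarrow> complex"
  assumes g: "g \<in> M1" and riesz: "gabor_riesz_sequence g \<Lambda>"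
  obtains \<epsilon> where "0 < \<epsilon>" "\<And>T. lipschitz_perturbation \<epsilon> T \<Longrightarrow> gabor_riesz_sequence g (T ` \<Lambda>)"
proof (cases "\<Lambda> = {}")
  case True
  \<comment> \<open>With no nodes the Riesz condition says nothing about \<open>g\<close>, which may
    be 0; the image set is again empty, so any positive number will do.\<close>
  then show ?thesis using that[of 1] riesz by simp
next
  case False
  then obtain l0 where l0: "l0 \<in> \<Lambda>" by blast
  have gL2: "g \<in> L2" using g by (simp add: M1_def)
  obtain A B where AB: "0 < A" "0 < B"
    and lower: "\<And>S c. finite S \<Longrightarrow> S \<subseteq> \<Lambda> \<Longrightarrow> A * sqrt (\<Sum>z\<in>S. (cmod (c z))\<^sup>2) \<le> L2_norm (\<lambda>t. \<Sum>z\<in>S. c z * tf_shift z g t)"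
    and upper: "\<And>S c. finite S \<Longrightarrow> S \<subseteq> \<Lambda> \<Longrightarrow> L2_norm (\<lambda>t. \<Sum>z\<in>S. c z * tf_shift z g t) \<le> B * sqrt (\<Sum>z\<in>S. (cmod (c z))\<^sup>2)"
    by (rule gabor_riesz_sequence_finiteD[OF gL2 riesz]) blast
  \<comment> \<open>A single node with coefficient 1 contradicts the lower bound if the norm
    vanishes.\<close>
  have "L2_norm g \<noteq> 0"
    using lower[of "{l0}" "\<lambda>_. 1"] AB(1) l0 by (simp add: L2_norm_tf_shift gL2)
  moreover have "(\<Sum>z\<in>S. (cmod (L2_inner f (tf_shift z g)))\<^sup>2) \<le> B\<^sup>2 * (L2_norm f)\<^sup>2"
    if "f \<in> L2" "finite S" "S \<subseteq> \<Lambda>" for f S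
  proof (rule L2_Bessel_dual[OF that(1)])
    fix c :: "real^('d + 'd) \<Rightarrow> complex"
    have "(L2_norm (\<lambda>t. \<Sum>z\<in>S. c z * tf_shift z g t))\<^sup>2 \<le> (B * sqrt (\<Sum>z\<in>S. (cmod (c z))\<^sup>2))\<^sup>2"
      by (intro power_mono upper that) simp
    then show "(L2_norm (\<lambda>t. \<Sum>z\<in>S. c z * tf_shift z g t))\<^sup>2 \<le> B\<^sup>2 * (\<Sum>z\<in>S. (cmod (c z))\<^sup>2)"
      by (simp add: power_mult_distrib sum_nonneg)
  qed (auto intro: L2_tf_shift gL2)
  ultimately obtain r N where r: "0 < r" and sep: "separated_family \<Lambda> (\<lambda>z. z) r N"
    using Bessel_imp_separated[OF gL2] by blast
  obtain K where K: "0 < K"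
    "\<And>\<epsilon> T S c. lipschitz_perturbation \<epsilon> T \<Longrightarrow> \<epsilon> \<le> 1/2 \<Longrightarrow> finite S \<Longrightarrow> S \<subseteq> \<Lambda> \<Longrightarrow>
      (L2_norm (\<lambda>t. \<Sum>z\<in>S. c z * tf_shift (T z) g t))\<^sup>2 \<le> K * (\<Sum>z\<in>S. (cmod (c z))\<^sup>2)"
    by (rule perturbed_synthesis_bound[OF g r sep]) blast
  obtain \<epsilon> where \<epsilon>: "0 < \<epsilon>" "\<epsilon> \<le> 1/2"
    and low: "\<And>T S c. lipschitz_perturbation \<epsilon> T \<Longrightarrow> finite S \<Longrightarrow> S \<subseteq> \<Lambda> \<Longrightarrow>
      A\<^sup>2 / 8 * (\<Sum>z\<in>S. (cmod (c z))\<^sup>2) \<le> (L2_norm (\<lambda>t. \<Sum>z\<in>S. c z * tf_shift (T z) g t))\<^sup>2"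
    by (rule Riesz_deformation[OF g r sep AB(1) lower]) blast+
  have "gabor_riesz_sequence g (T ` \<Lambda>)" if T: "lipschitz_perturbation \<epsilon> T" for T
  proof (rule gabor_riesz_sequence_finiteI[OF gL2, where A="sqrt (A\<^sup>2 / 8)" and B="sqrt K"])
    have inj: "inj_on T S" for S
      using lipschitz_perturbation_inj[OF T \<epsilon>(2)] by (rule inj_on_subset) simp
    fix S and c :: "real^('d + 'd) \<Rightarrow> complex"
    assume S: "finite S" "S \<subseteq> T ` \<Lambda>"
    then obtain S' where S': "finite S'" "S' \<subseteq> \<Lambda>" "S = T ` S'" by (metis finite_subset_image)
    have "sqrt (A\<^sup>2 / 8 * (\<Sum>z\<in>S'. (cmod (c (T z)))\<^sup>2)) \<le> L2_norm (\<lambda>t. \<Sum>z\<in>S'. c (T z) * tf_shift (T z) g t)"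
      using low[OF T S'(1,2), of "\<lambda>z. c (T z)"] by (intro real_le_lsqrt) (auto intro: sum_nonneg)
    then show "sqrt (A\<^sup>2 / 8) * sqrt (\<Sum>z\<in>S. (cmod (c z))\<^sup>2) \<le> L2_norm (\<lambda>t. \<Sum>z\<in>S. c z * tf_shift z g t)"
      by (simp only: S'(3) sum.reindex[OF inj] o_def real_sqrt_mult)
    have "L2_norm (\<lambda>t. \<Sum>z\<in>S'. c (T z) * tf_shift (T z) g t) \<le> sqrt (K * (\<Sum>z\<in>S'. (cmod (c (T z)))\<^sup>2))"
      using K(2)[OF T \<epsilon>(2) S'(1,2), of "\<lambda>z. c (T z)"] by (intro real_le_rsqrt)
    then show "L2_norm (\<lambda>t. \<Sum>z\<in>S. c z * tf_shift z g t) \<le> sqrt K * sqrt (\<Sum>z\<in>S. (cmod (c z))\<^sup>2)"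
      by (simp only: S'(3) sum.reindex[OF inj] o_def real_sqrt_mult)
  qed (use AB(1) K(1) in auto)
  then show ?thesis using that \<epsilon>(1) by blast
qed

subsection \<open>Jacobians close to the identity\<close>

text \<open>Equivalence of norms in finite dimension: \<open>N\<close> is Lipschitz for the
  Euclidean norm, hence attains a positive minimum on the compact unit sphere. This makes the choice
  of matrix norm immaterial.\<close>

lemma matrix_norm_lower_bound:
  fixes N :: "real^'m^'n \<Rightarrow> real"
  assumes N: "matrix_norm N"
  obtains m where "0 < m" "\<And>A. m * norm A \<le> N A"
proof -
  have N0: "0 \<le> N A" and Nz: "N A = 0 \<longleftrightarrow> A = 0" and Ns: "N (c *\<^sub>R A) = \<bar>c\<bar> * N A"
    and Nt: "N (A + B) \<le> N A + N B" for A B c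
    using N by (auto simp: matrix_norm_def)
  have Nsum: "N (\<Sum>b\<in>S. F b) \<le> (\<Sum>b\<in>S. N (F b))" if "finite S" for S :: "(real^'m^'n) set" and F
    using that
  proof induction
    case empty
    then show ?case using Nz[of 0] by simp
  next
    case (insert b S)
    then show ?case using Nt[of "F b" "\<Sum>b\<in>S. F b"] by simp
  qed
  define C where "C = (\<Sum>b\<in>Basis. N b)"
  have upper: "N A \<le> C * norm A" for A
  proof -
    have "N A = N (\<Sum>b\<in>Basis. (A \<bullet> b) *\<^sub>R b)" by (simp only: euclidean_representation)
    also have "\<dots> \<le> (\<Sum>b\<in>Basis. N ((A \<bullet> b) *\<^sub>R b))" by (rule Nsum) simp
    also have "\<dots> \<le> (\<Sum>b\<in>Basis. norm A * N b)"
      unfolding Ns by (intro sum_mono mult_right_mono Basis_le_norm N0)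
    finally show ?thesis by (simp add: C_def sum_distrib_left mult.commute)
  qed
  have diff: "\<bar>N A - N B\<bar> \<le> C * norm (A - B)" for A B
  proof -
    have "N A \<le> N (A - B) + N B" using Nt[of "A - B" B] by simp
    moreover have "N B \<le> N (B - A) + N A" using Nt[of "B - A" A] by simp
    moreover have "N (A - B) \<le> C * norm (A - B)" "N (B - A) \<le> C * norm (A - B)"
      using upper[of "A - B"] upper[of "B - A"] by (auto simp: norm_minus_commute)
    ultimately show ?thesis by linarith
  qed
  have C0: "0 \<le> C" unfolding C_def by (intro sum_nonneg N0)
  have "C-lipschitz_on (sphere 0 1) N"
    by (rule lipschitz_onI) (use diff C0 in \<open>auto simp: dist_norm\<close>)
  then have cont: "continuous_on (sphere 0 1) N" by (rule lipschitz_on_continuous_on)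
  have "sphere (0::real^'m^'n) 1 \<noteq> {}" by simp
  then obtain A0 where A0: "A0 \<in> sphere 0 1" "\<And>A. A \<in> sphere 0 1 \<Longrightarrow> N A0 \<le> N A"
    using continuous_attains_inf[OF compact_sphere _ cont] by blast
  have "A0 \<noteq> 0" using A0(1) by auto
  then have m: "0 < N A0" using N0[of A0] Nz[of A0] by simp
  have "N A0 * norm A \<le> N A" for A
  proof (cases "A = 0")
    case False
    then have "(1 / norm A) *\<^sub>R A \<in> sphere 0 1" by simp
    then have "N A0 \<le> N ((1 / norm A) *\<^sub>R A)" by (rule A0(2))
    also have "\<dots> = N A / norm A" unfolding Ns by simp
    finally show ?thesis using False by (simp add: pos_le_divide_eq)
  qed (simp add: N0)
  then show ?thesis using that m by blast
qed

text \<open>The mean value inequality for \<open>T x - x\<close> on the whole space, which is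
  convex; the derivative of that map is the Jacobian minus the identity.\<close>

lemma jacobian_imp_lipschitz_perturbation:
  fixes T :: "real^'n \<Rightarrow> real^'n"
  assumes diff: "\<And>z. T differentiable (at z)"
    and le: "\<And>z v. norm ((jacobian T (at z) - mat 1) *v v) \<le> \<epsilon> * norm v"
  shows "lipschitz_perturbation \<epsilon> T"
  unfolding lipschitz_perturbation_def
proof (intro allI)
  fix z w
  have "((\<lambda>x. T x - x) has_derivative (\<lambda>v. (jacobian T (at x) - mat 1) *v v)) (at x)" for x
  proof -
    have "(T has_derivative (\<lambda>v. jacobian T (at x) *v v)) (at x)"
      using diff jacobian_works by blast
    then have "((\<lambda>x. T x - x) has_derivative (\<lambda>v. jacobian T (at x) *v v - v)) (at x)"
      by (intro has_derivative_diff has_derivative_ident)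
    then show ?thesis by (simp add: matrix_vector_mult_diff_rdistrib)
  qed
  then have "norm ((T z - z) - (T w - w)) \<le> \<epsilon> * norm (z - w)"
    by (intro differentiable_bound[OF convex_UNIV]) (auto intro: onorm_le le)
  then show "norm ((T z - T w) - (z - w)) \<le> \<epsilon> * norm (z - w)" by (simp add: algebra_simps)
qed

text \<open>The supremum lives in the extended reals and may be infinite for some \<open>n\<close>;
  convergence to 0 puts it eventually below any positive threshold. In
  \<open>\<epsilon> * m / b\<close> the factor \<open>m\<close> passes from \<open>N\<close> to the
  Euclidean matrix norm and \<open>b\<close> from there to the action on vectors.\<close>

lemma eventually_lipschitz_perturbation:
  fixes T :: "nat \<Rightarrow> real^'n \<Rightarrow> real^'n" and N :: "real^'n^'n \<Rightarrow> real"
  assumes N: "matrix_norm N" and diff: "\<And>n z. T n differentiable (at z)"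
    and lim: "(\<lambda>n. SUP z. ereal (N (jacobian (T n) (at z) - mat 1))) \<longlonglongrightarrow> 0"
    and \<epsilon>: "0 < \<epsilon>"
  shows "\<forall>\<^sub>F n in sequentially. lipschitz_perturbation \<epsilon> (T n)"
proof -
  obtain m where m: "0 < m" "\<And>A. m * norm A \<le> N A" using matrix_norm_lower_bound[OF N] by blast
  have "bilinear (\<lambda>(A::real^'n^'n) v. A *v v)"
    unfolding bilinear_def
    by (auto intro!: linearI simp: matrix_vector_mult_add_rdistrib matrix_vector_right_distrib
        scaleR_matrix_vector_assoc matrix_vector_mult_scaleR)
  then obtain b where b: "0 < b" "\<And>(A::real^'n^'n) v. norm (A *v v) \<le> b * norm A * norm v"
    using bilinear_bounded_pos by blast
  have "0 < ereal (\<epsilon> * m / b)" using \<epsilon> m b by simp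
  then have "\<forall>\<^sub>F n in sequentially. (SUP z. ereal (N (jacobian (T n) (at z) - mat 1))) < ereal (\<epsilon> * m / b)"
    by (rule order_tendstoD(2)[OF lim])
  then show ?thesis
  proof eventually_elim
    case (elim n)
    show ?case
    proof (rule jacobian_imp_lipschitz_perturbation[OF diff])
      fix z v
      let ?A = "jacobian (T n) (at z) - mat 1"
      have "ereal (N ?A) \<le> (SUP z. ereal (N (jacobian (T n) (at z) - mat 1)))" by (rule SUP_upper) simp
      then have "ereal (N ?A) < ereal (\<epsilon> * m / b)" using elim by (rule order_le_less_trans)
      then have "N ?A \<le> \<epsilon> * m / b" by simp
      then have "m * norm ?A \<le> m * (\<epsilon> / b)" using m(2)[of ?A] by (simp add: mult_ac)
      then have "norm ?A \<le> \<epsilon> / b" using m(1) by (simp only: mult_le_cancel_left_pos)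
      then have "b * norm ?A \<le> \<epsilon>" using b(1) by (simp add: field_simps)
      then show "norm (?A *v v) \<le> \<epsilon> * norm v"
        using b(2)[of ?A v] mult_right_mono[of "b * norm ?A" \<epsilon> "norm v"] by simp
    qed
  qed
qed

theorem theorem1p1:
  fixes g :: "real^'d \<Rightarrow> complex"
    and \<Lambda> :: "(real^('d + 'd)) set"
    and T :: "nat \<Rightarrow> real^('d + 'd) \<Rightarrow> real^('d + 'd)"
    and N :: "real^('d + 'd)^('d + 'd) \<Rightarrow> real"
  assumes "g \<in> M1"
    and "matrix_norm N"
    and "\<And>n z. T n differentiable (at z)"
    and "(\<lambda>n. SUP z. ereal (N (jacobian (T n) (at z) - mat 1))) \<longlonglongrightarrow> 0"
  shows "(gabor_frame g \<Lambda> \<longrightarrow> (\<forall>\<^sub>F n in sequentially. gabor_frame g (T n ` \<Lambda>))) \<and>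
    (gabor_riesz_sequence g \<Lambda> \<longrightarrow> (\<forall>\<^sub>F n in sequentially. gabor_riesz_sequence g (T n ` \<Lambda>)))"
proof (intro conjI impI)
  note ev = eventually_lipschitz_perturbation[OF assms(2-4)]
  assume "gabor_frame g \<Lambda>"
  then obtain \<epsilon> where \<epsilon>: "0 < \<epsilon>" "\<And>T. lipschitz_perturbation \<epsilon> T \<Longrightarrow> gabor_frame g (T ` \<Lambda>)"
    using gabor_frame_perturbation[OF assms(1)] by blast
  show "\<forall>\<^sub>F n in sequentially. gabor_frame g (T n ` \<Lambda>)"
    using ev[OF \<epsilon>(1)] by eventually_elim (rule \<epsilon>(2))
next
  note ev = eventually_lipschitz_perturbation[OF assms(2-4)]
  assume "gabor_riesz_sequence g \<Lambda>"
  then obtain \<epsilon> where \<epsilon>: "0 < \<epsilon>" "\<And>T. lipschitz_perturbation \<epsilon> T \<Longrightarrow> gabor_riesz_sequence g (T ` \<Lambda>)"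
    using gabor_riesz_sequence_perturbation[OF assms(1)] by blast
  show "\<forall>\<^sub>F n in sequentially. gabor_riesz_sequence g (T n ` \<Lambda>)"
    using ev[OF \<epsilon>(1)] by eventually_elim (rule \<epsilon>(2))
qed

end
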